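(* Let $n\ge 3$ be an integer and let $\mathcal{X}\subseteq\mathbb{C}$ be a perfect space such that for every $\mathbf{x}\in\mathcal{C}^n(\mathcal{X})$ the graph $\Gamma^n(\mathbf{x})$ contains an $n$-cycle. Assume furthermore that - the symmetric group $S_n$ acts transitively on the set of connected components of $\mathcal{C}^n(\mathcal{X})$; and - that action is not free (i.e. the isotropy groups are not trivial). The continuous CS preservers $\phi:\sigma^-_{ss}(\mathcal{X})\to M_n(\mathbb{C})$ are as follows. (1) If the complex conjugation function $z\mapsto\overline z$ is not of class $B^{n-1}_\Delta(\mathcal{X})$, they are precisely the conjugations and transpose conjugations. (2) If complex conjugation is of class $B^{n-1}_\Delta(\mathcal{X})$, they are precisely the conjugations, the transpose conjugations, and the compositions $\alpha\circ\Phi$ of conjugations and transpose conjugations $\alpha$ with the map $$\Phi:\sigma^-_{ss}(\mathcal{X})\to M_n(\mathbb{C}),\qquad (\boldsymbol{\ell}\mid\boldsymbol{\lambda})\mapsto(\boldsymbol{\ell}'\mid\boldsymbol{\lambda}),\qquad \ell'_i:=\Big(\bigoplus_{j\ne i}\ell_j\Big)^{\perp}\quad(1\le i\le n).$$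
   Context: A topological space $\mathcal{X}$ is perfect if every $x\in\mathcal{X}$ lies in the closure of $\mathcal{X}\setminus\{x\}$ (subsets of $\mathbb{C}$ carry the subspace topology; closedness in $\mathbb{C}$ is not required). $\sigma(T)$ is the spectrum (set of eigenvalues) of $T\in M_n(\mathbb{C})$, and $\sigma^-_{ss}(\mathcal{X})$ is the set of semisimple (i.e. diagonalizable) matrices $T\in M_n(\mathbb{C})$ with $\sigma(T)\subseteq\mathcal{X}$. A CS (commutativity and spectrum) preserver on a set $\mathcal{S}\subseteq M_n(\mathbb{C})$ is a map $\phi:\mathcal{S}\to M_n(\mathbb{C})$ (not assumed linear) with $\sigma(\phi(A))=\sigma(A)$ for all $A\in\mathcal{S}$, and $\phi(A)\phi(B)=\phi(B)\phi(A)$ whenever $A,B\in\mathcal{S}$ and $AB=BA$. A conjugation is a map $A\mapsto TAT^{-1}$ and a transpose conjugation a map $A\mapsto TA^tT^{-1}$, with $T\in\mathrm{GL}_n(\mathbb{C})$; both are understood as restricted to the domain in question. For an $n$-tuple $\boldsymbol{\ell}=(\ell_i)_{i=1}^n$ of lines (one-dimensional subspaces) spanning $\mathbb{C}^n$ and $\boldsymbol{\lambda}=(\lambda_i)\in\mathbb{C}^n$, $(\boldsymbol{\ell}\mid\boldsymbol{\lambda})$ denotes the semisimple operator on $\mathbb{C}^n$ acting as the scalar $\lambda_i$ on $\ell_i$ for each $i$. Orthogonal complements are with respect to the standard inner product on $\mathbb{C}^n$. (The map $\Phi$ is well defined, i.e. independent of the representation of an operator as $(\boldsymbol{\ell}\mid\boldsymbol{\lambda})$.)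 $\mathcal{C}^n(\mathcal{X})=\{(x_1,\dots,x_n)\in\mathcal{X}^n: x_i\text{ distinct}\}$ with the topology induced from $\mathcal{X}^n$. $S_n$ acts on $\mathcal{X}^n$ and $\mathcal{C}^n(\mathcal{X})$ on the right by $(x_i)_i\triangleleft\theta=(x_{\theta i})_i$, hence also on the set of connected components of $\mathcal{C}^n(\mathcal{X})$. For $\mathbf{x}\in\mathcal{X}^n$, the set of coincidences $\mathcal{E}^n(\mathbf{x})$ is the set of pairs $\{i\ne j\}\subseteq\{1,\dots,n\}$ with $x_i=x_j$. For a connected component $\mathcal{C}\subseteq\mathcal{C}^n(\mathcal{X})$, $\Gamma^n(\mathcal{C})$ is the loop-free undirected graph with vertex set $\{1,\dots,n\}$ and with an edge $\{i\neq j\}$ exactly when there is a point $\mathbf{y}\in\mathcal{X}^n$ lying in both $\overline{\mathcal{C}}$ and $\overline{\mathcal{C}\triangleleft(i\,j)}$ (closures in $\mathcal{X}^n$; $(i\,j)$ the transposition) whose only coincidence is $\{i,j\}$, i.e. $\mathcal{E}^n(\mathbf{y})=\{\{i,j\}\}$. For $\mathbf{x}\in\mathcal{C}^n(\mathcal{X})$, $\Gamma^n(\mathbf{x}):=\Gamma^n(\mathcal{C})$ for the connected component $\mathcal{C}$ containing $\mathbf{x}$. For a symmetric complex-valued function $f$ on $\mathcal{C}^m(\mathcal{X})$, $\Delta f$ is the symmetric function on $\mathcal{C}^{m+1}(\mathcal{X})$ given by $$\Delta f(z_0,\dots,z_m):=\frac{f(z_1,\dots,z_m)-f(z_0,\dots,z_{m-1})}{z_m-z_0},$$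 and $\Delta^k$ is the $k$-fold iterate of $\Delta$. A function $f:\mathcal{X}\to\mathbb{C}$ is of class $B^k_\Delta(\mathcal{X})$ if for every cluster point $z\in\mathcal{X}$ of $\mathcal{X}$ the function $\Delta^kf$ on $\mathcal{C}^{k+1}(\mathcal{X})$ is locally bounded around $(z,\dots,z)\in\mathcal{X}^{k+1}$, i.e. bounded on $U\cap\mathcal{C}^{k+1}(\mathcal{X})$ for some neighborhood $U$ of $(z,\dots,z)$ in $\mathcal{X}^{k+1}$. *)

theory Defs
  imports "HOL-Analysis.Analysis"
begin

definition perfect_space :: "complex set \<Rightarrow> bool" where
  "perfect_space X \<longleftrightarrow> (\<forall>x\<in>X. x \<in> closure (X - {x}))"

definition tuples :: "complex set \<Rightarrow> (complex ^ 'n) set" where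
  "tuples X = {x. \<forall>i. x $ i \<in> X}"

definition config :: "complex set \<Rightarrow> (complex ^ 'n) set" where
  "config X = {x \<in> tuples X. \<forall>i j. i \<noteq> j \<longrightarrow> x $ i \<noteq> x $ j}"

text \<open>The right action of the symmetric group of the index type on tuples.\<close>

definition act :: "complex ^ 'n \<Rightarrow> ('n \<Rightarrow> 'n) \<Rightarrow> complex ^ 'n"  (infixl \<open>\<lhd>\<lhd>\<close> 70) where
  "x \<lhd>\<lhd> \<theta> = (\<chi> i. x $ \<theta> i)"

definition act_set :: "(complex ^ 'n) set \<Rightarrow> ('n \<Rightarrow> 'n) \<Rightarrow> (complex ^ 'n) set" where
  "act_set C \<theta> = (\<lambda>x. x \<lhd>\<lhd> \<theta>) ` C"

definition transitive_on_components :: "'n::finite itself \<Rightarrow> complex set \<Rightarrow> bool" where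
  "transitive_on_components _ X \<longleftrightarrow>
     (\<forall>C \<in> components (config X :: (complex ^ 'n) set).
      \<forall>D \<in> components (config X :: (complex ^ 'n) set).
        \<exists>\<theta>. \<theta> permutes UNIV \<and> act_set C \<theta> = D)"

definition free_on_components :: "'n::finite itself \<Rightarrow> complex set \<Rightarrow> bool" where
  "free_on_components _ X \<longleftrightarrow>
     (\<forall>C \<in> components (config X :: (complex ^ 'n) set).
      \<forall>\<theta>. \<theta> permutes UNIV \<and> act_set C \<theta> = C \<longrightarrow> \<theta> = id)"

definition coincidences :: "complex ^ 'n \<Rightarrow> 'n set set" where
  "coincidences x = {{i, j} | i j. i \<noteq> j \<and> x $ i = x $ j}"

text \<open>All graphs have vertex set \<open>UNIV\<close>, so that a graph is given by its set of edges.\<close>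

definition Gamma :: "complex set \<Rightarrow> (complex ^ 'n) set \<Rightarrow> 'n::finite set set" where
  "Gamma X C = {{i, j} | i j. i \<noteq> j \<and>
     (\<exists>y \<in> tuples X.
        y \<in> top_of_set (tuples X) closure_of C \<and>
        y \<in> top_of_set (tuples X) closure_of act_set C (Transposition.transpose i j) \<and>
        coincidences y = {{i, j}})}"

definition Gamma_at :: "complex set \<Rightarrow> complex ^ 'n \<Rightarrow> 'n::finite set set" where
  "Gamma_at X x = Gamma X (connected_component_set (config X) x)"

definition has_cycle_of_length :: "'v set set \<Rightarrow> nat \<Rightarrow> bool" where
  "has_cycle_of_length E m \<longleftrightarrow> m \<ge> 3 \<and>
     (\<exists>vs. length vs = m \<and> distinct vs \<and>
           (\<forall>k<m. {vs ! k, vs ! (Suc k mod m)} \<in> E))"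

text \<open>
  Functions on configuration spaces of varying length are functions of lists:
  \<open>f(z\<^sub>1, \<dots>, z\<^sub>m)\<close> is \<open>f [z\<^sub>1, \<dots>, z\<^sub>m]\<close>. Only their values on lists of distinct
  elements of \<open>X\<close> of the appropriate length are meaningful.
\<close>

definition Delta :: "(complex list \<Rightarrow> complex) \<Rightarrow> complex list \<Rightarrow> complex" where
  "Delta f zs = (f (tl zs) - f (butlast zs)) / (last zs - hd zs)"

text \<open>Here \<open>X\<^sup>k\<^sup>+\<^sup>1\<close> is the product of \<open>k + 1\<close> copies of \<open>X\<close>, indexed by \<open>{..k}\<close>.\<close>

definition B_Delta :: "nat \<Rightarrow> complex set \<Rightarrow> (complex \<Rightarrow> complex) \<Rightarrow> bool" where
  "B_Delta k X f \<longleftrightarrow>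
     (\<forall>z\<in>X. z islimpt X \<longrightarrow>
        (\<exists>U. openin (product_topology (\<lambda>_. top_of_set X) {..k}) U \<and>
             (\<lambda>i\<in>{..k}. z) \<in> U \<and>
             bounded ((\<lambda>w. (Delta ^^ k) (\<lambda>zs. f (hd zs)) (map w [0..<Suc k]))
                        ` {w \<in> U. inj_on w {..k}})))"

definition eigenvalues :: "complex ^ 'n ^ 'n \<Rightarrow> complex set" where
  "eigenvalues A = {c. \<exists>v. v \<noteq> 0 \<and> A *v v = c *s v}"

definition semisimple :: "complex ^ 'n ^ 'n \<Rightarrow> bool" where
  "semisimple A \<longleftrightarrow>
     (\<exists>(P :: complex ^ 'n ^ 'n) (D :: complex ^ 'n ^ 'n).
        invertible P \<and> (\<forall>i j. i \<noteq> j \<longrightarrow> D $ i $ j = 0) \<and> A = P ** D ** matrix_inv P)"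

definition ss_with_spectrum_in :: "complex set \<Rightarrow> (complex ^ 'n ^ 'n) set" where
  "ss_with_spectrum_in X = {A. semisimple A \<and> eigenvalues A \<subseteq> X}"

definition CS_preserver_on ::
    "(complex ^ 'n ^ 'n) set \<Rightarrow> (complex ^ 'n ^ 'n \<Rightarrow> complex ^ 'n ^ 'n) \<Rightarrow> bool" where
  "CS_preserver_on S \<phi> \<longleftrightarrow>
     (\<forall>A\<in>S. eigenvalues (\<phi> A) = eigenvalues A) \<and>
     (\<forall>A\<in>S. \<forall>B\<in>S. A ** B = B ** A \<longrightarrow> \<phi> A ** \<phi> B = \<phi> B ** \<phi> A)"

definition conjugation :: "(complex ^ 'n ^ 'n \<Rightarrow> complex ^ 'n ^ 'n) \<Rightarrow> bool" where
  "conjugation \<alpha> \<longleftrightarrow> (\<exists>T. invertible T \<and> \<alpha> = (\<lambda>A. T ** A ** matrix_inv T))"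

definition transpose_conjugation :: "(complex ^ 'n ^ 'n \<Rightarrow> complex ^ 'n ^ 'n) \<Rightarrow> bool" where
  "transpose_conjugation \<alpha> \<longleftrightarrow>
     (\<exists>T. invertible T \<and> \<alpha> = (\<lambda>A. T ** Finite_Cartesian_Product.transpose A ** matrix_inv T))"

definition spanning_lines :: "('n \<Rightarrow> (complex ^ 'n) set) \<Rightarrow> bool" where
  "spanning_lines l \<longleftrightarrow>
     (\<forall>i. vec.subspace (l i) \<and> vec.dim (l i) = 1) \<and> vec.span (\<Union>i. l i) = UNIV"

text \<open>The operator \<open>(l | c)\<close>; it exists and is unique if \<open>l\<close> is a tuple of spanning lines.\<close>

definition lines_op :: "('n \<Rightarrow> (complex ^ 'n) set) \<Rightarrow> complex ^ 'n \<Rightarrow> complex ^ 'n ^ 'n" where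
  "lines_op l c = (THE T. \<forall>i. \<forall>v \<in> l i. T *v v = (c $ i) *s v)"

text \<open>
  The library's inner product on \<open>complex ^ 'n\<close> is the real part of the Hermitian one, which
  is why the latter is introduced here.
\<close>

definition hermitian_inner :: "complex ^ 'n \<Rightarrow> complex ^ 'n \<Rightarrow> complex" where
  "hermitian_inner v w = (\<Sum>i\<in>UNIV. v $ i * cnj (w $ i))"

definition orth_complement :: "(complex ^ 'n) set \<Rightarrow> (complex ^ 'n) set" where
  "orth_complement W = {v. \<forall>w\<in>W. hermitian_inner v w = 0}"

definition dual_lines :: "('n \<Rightarrow> (complex ^ 'n) set) \<Rightarrow> 'n \<Rightarrow> (complex ^ 'n) set" where
  "dual_lines l i = orth_complement (vec.span (\<Union>j\<in>-{i}. l j))"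

text \<open>
  The map \<open>(l | c) \<mapsto> (l' | c)\<close> on semisimple operators. The right-hand side does not depend on
  the representation of \<open>A\<close>, so the description is definite for semisimple \<open>A\<close>; for other \<open>A\<close>
  the value is irrelevant.
\<close>

definition Phi :: "complex ^ 'n ^ 'n \<Rightarrow> complex ^ 'n ^ 'n" where
  "Phi A = (THE B. \<exists>l c. spanning_lines l \<and> A = lines_op l c \<and> B = lines_op (dual_lines l) c)"

end

theory Submission
  imports Defs
begin

text \<open>
  Write a semisimple operator as \<open>P diag(x) P\<^sup>-\<^sup>1\<close>. If its spectrum is simple, a preserver \<open>\<phi>\<close> sends it to
  \<open>Q diag(x') Q\<^sup>-\<^sup>1\<close>, where \<open>x'\<close> permutes \<open>x\<close> and, \<open>\<phi>\<close> being continuous and the frames \<open>P\<close> forming a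
  connected space, the permutation depends only on the component of \<open>x\<close>. These permutations give
  an endomorphism of the symmetric group; the graph condition makes it the identity or trivial on
  the transpositions along an \<open>n\<close>-cycle, and a nontrivial isotropy group rules out the trivial case.
  Hence \<open>\<phi> (P diag(x) P\<^sup>-\<^sup>1) = Q diag(x) Q\<^sup>-\<^sup>1\<close> for all \<open>x\<close>, with \<open>Q\<close> depending on \<open>P\<close> only.

  So \<open>\<phi>\<close> induces a continuous map \<open>\<Psi>\<close> on rank-one idempotents that preserves orthogonality and sums of
  orthogonal pairs. Normalizing \<open>\<Psi>\<close> to fix the coordinate idempotents \<open>E\<^sub>i\<^sub>i\<close>, one finds that it maps
  \<open>E\<^sub>i\<^sub>i + a E\<^sub>i\<^sub>j\<close>, up to a transposition, to \<open>E\<^sub>i\<^sub>i + s\<^sub>i\<^sub>j(a) E\<^sub>i\<^sub>j\<close>, and orthogonality relations with three indices force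
  the Steinberg-like relation \<open>s\<^sub>i\<^sub>j(p + q r) = s\<^sub>i\<^sub>j(p) + s\<^sub>i\<^sub>k(q) s\<^sub>k\<^sub>j(r)\<close>. Up to a diagonal conjugation all \<open>s\<^sub>i\<^sub>j\<close>
  are then one continuous field endomorphism of the complex numbers, i.e. the identity or the
  conjugation, and the latter yields \<open>Phi\<close>.

  Finally, \<open>Phi\<close> is the adjoint of the functional calculus of the complex conjugation, which by Newton's
  interpolation formula is continuous exactly if the divided differences of order \<open>n - 1\<close> are locally
  bounded.
\<close>

subsection \<open>Matrices\<close>

text \<open>The rigidity comes from the frames. Any two invertible complex matrices are joined
  within a complex line, off the finitely many zeros of a determinant, so a discrete datum attached
  to frames is constant. The permutation of eigenvalues is thus the same for all frames, and since
  permuting eigenvalues amounts to reordering a frame, it is multiplicative. The edges of the graph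
  enter through limit points with a single coincidence, where \<phi> is computed from two sides. On
  rank-one idempotents the obstacle is that \<Psi> is not known to be injective: it might collapse a
  pencil of idempotents to a point. Excluding this takes a limit argument, and a third index both
  there and for linking the index pairs. For the continuity of \<open>Phi\<close> the set
  \<open>X\<close> need not be closed, so limits of nodes are shown to be eigenvalues of the limit
  operator. Conversely, a bidiagonal operator whose off-diagonal entries \<eta> tend to zero
  approaches a scalar, while its functional calculus has a corner entry equal to a divided
  difference times the power \<open>n - 1\<close> of \<eta>; this is where the order
  \<open>n - 1\<close> comes from.\<close>

abbreviation mtransp :: "complex ^ 'n ^ 'm \<Rightarrow> complex ^ 'm ^ 'n" where
  "mtransp \<equiv> Finite_Cartesian_Product.transpose"

definition cscale :: "complex \<Rightarrow> complex ^ 'n ^ 'm \<Rightarrow> complex ^ 'n ^ 'm" where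
  "cscale c A = (\<chi> i j. c * A $ i $ j)"

definition cdiag :: "complex ^ 'n \<Rightarrow> complex ^ 'n ^ 'n" where
  "cdiag d = (\<chi> i j. if i = j then d $ i else 0)"

text \<open>The inverse is a variable of its own: products, transposes and adjoints of frames then
  have explicit inverses, and no term \<open>matrix_inv\<close> has to be simplified.\<close>

definition inverse_pair :: "complex ^ 'n ^ 'n \<Rightarrow> complex ^ 'n ^ 'n \<Rightarrow> bool" where
  "inverse_pair P Q \<longleftrightarrow> P ** Q = mat 1 \<and> Q ** P = mat 1"

text \<open>Bilinear, not Hermitian: the first argument is a linear form, so that
  \<open>outer v x\<close> is the operator sending \<open>w\<close> to
  \<open>bil x w *s v\<close>.\<close>

definition bil :: "complex ^ 'n \<Rightarrow> complex ^ 'n \<Rightarrow> complex" where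
  "bil x v = (\<Sum>i\<in>UNIV. x $ i * v $ i)"

definition outer :: "complex ^ 'n \<Rightarrow> complex ^ 'n \<Rightarrow> complex ^ 'n ^ 'n" where
  "outer v x = (\<chi> i j. v $ i * x $ j)"

abbreviation ax :: "'n \<Rightarrow> complex ^ 'n" where "ax i \<equiv> axis i 1"

lemma cscale_nth [simp]: "cscale c A $ i $ j = c * A $ i $ j"
  by (simp add: cscale_def)

lemma cdiag_nth [simp]: "cdiag d $ i $ j = (if i = j then d $ i else 0)"
  by (simp add: cdiag_def)

lemma outer_nth [simp]: "outer v x $ i $ j = v $ i * x $ j"
  by (simp add: outer_def)

lemma matrix_eq_iff: "A = B \<longleftrightarrow> (\<forall>i j. A $ i $ j = (B :: 'a ^ 'n ^ 'm) $ i $ j)"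
  by (simp add: vec_eq_iff)

lemma matrix_mult_nth: "(A ** B) $ i $ j = (\<Sum>k\<in>UNIV. A $ i $ k * B $ k $ j)"
  by (simp add: matrix_matrix_mult_def)

lemma cscale_simps [simp]:
  "cscale 1 A = A" "cscale 0 A = 0" "cscale c 0 = 0" "cscale a (cscale b A) = cscale (a * b) A"
  "A ** cscale c B = cscale c (A ** B)" "cscale c C ** D = cscale c (C ** D)"
  by (simp_all add: matrix_eq_iff matrix_mult_nth sum_distrib_left mult_ac)

lemma cscale_cancel: "c \<noteq> 0 \<Longrightarrow> cscale c A = cscale c B \<Longrightarrow> A = B"
  by (simp add: matrix_eq_iff)

lemma cdiag_mult_nth [simp]: "(cdiag d ** A) $ i $ j = d $ i * A $ i $ j"
  "(B ** cdiag d) $ i $ j = B $ i $ j * d $ j"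
proof -
  have "(\<Sum>k\<in>UNIV. (if i = k then d $ i else 0) * A $ k $ j)
      = (\<Sum>k\<in>UNIV. if k = i then d $ i * A $ i $ j else 0)"
    by (rule sum.cong) auto
  then show "(cdiag d ** A) $ i $ j = d $ i * A $ i $ j"
    by (simp add: matrix_mult_nth)
  have "(\<Sum>k\<in>UNIV. B $ i $ k * (if k = j then d $ k else 0))
      = (\<Sum>k\<in>UNIV. if k = j then B $ i $ j * d $ j else 0)"
    by (rule sum.cong) auto
  then show "(B ** cdiag d) $ i $ j = B $ i $ j * d $ j"
    by (simp add: matrix_mult_nth)
qed

lemma cdiag_mult: "cdiag c ** cdiag d = cdiag (c * d)"
  by (simp add: matrix_eq_iff)

lemma cdiag_const: "cdiag (\<chi> i. c) = mat c"
  by (simp add: matrix_eq_iff mat_def)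

lemma mat_eq_cscale: "mat c = cscale c (mat 1)"
  by (simp add: matrix_eq_iff mat_def)

lemma cdiag_mult_vec: "cdiag d *v v = d * v"
proof -
  have "(\<Sum>j\<in>UNIV. (if i = j then d $ i else 0) * v $ j) = (\<Sum>j\<in>UNIV. if j = i then d $ i * v $ i else 0)" for i
    by (rule sum.cong) auto
  then show ?thesis
    by (simp add: matrix_vector_mult_def vec_eq_iff)
qed

lemma matrix_add_rdistrib': "(B + C) ** A = B ** A + C ** (A :: complex ^ 'n ^ 'n)"
  by (simp add: matrix_eq_iff matrix_mult_nth sum.distrib algebra_simps)

lemma matrix_mult_zero [simp]: "A ** 0 = 0" "0 ** A = (0 :: complex ^ 'n ^ 'n)"
  for A :: "complex ^ 'n ^ 'n"
  by (simp_all add: matrix_eq_iff matrix_mult_nth)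

lemma matrix_mult_sum_right: "A ** (\<Sum>i\<in>S. f i) = (\<Sum>i\<in>S. A ** (f i :: complex ^ 'n ^ 'n))"
  by (induction S rule: infinite_finite_induct) (simp_all add: matrix_add_ldistrib)

lemma matrix_mult_sum_left: "(\<Sum>i\<in>S. f i) ** A = (\<Sum>i\<in>S. (f i :: complex ^ 'n ^ 'n) ** (A :: complex ^ 'n ^ 'n))"
  by (induction S rule: infinite_finite_induct) (simp_all add: matrix_add_rdistrib')

lemma inverse_pairD:
  assumes "inverse_pair P Q"
  shows "P ** Q = mat 1" "Q ** P = mat 1" "P ** (Q ** A) = A" "Q ** (P ** A) = A"
    "A ** P ** Q = A" "A ** Q ** P = A" "P *v (Q *v v) = v" "Q *v (P *v v) = v"
  using assms
  by (simp_all add: inverse_pair_def matrix_mul_assoc matrix_vector_mul_assoc)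
     (simp_all add: matrix_mul_assoc[symmetric])

lemma inverse_pair_sym: "inverse_pair P Q \<longleftrightarrow> inverse_pair Q P"
  by (auto simp: inverse_pair_def)

lemma inverse_pair_matrix_inv: "invertible P \<Longrightarrow> inverse_pair P (matrix_inv P)"
  unfolding invertible_def matrix_inv_def inverse_pair_def by (rule someI_ex)

lemma inverse_pair_unique: "inverse_pair P Q \<Longrightarrow> inverse_pair P R \<Longrightarrow> Q = R"
  using inverse_pairD(4)[of P Q R] by (simp add: inverse_pair_def)

lemma inverse_pair_iff: "inverse_pair P Q \<longleftrightarrow> invertible P \<and> Q = matrix_inv P"
  using inverse_pair_matrix_inv inverse_pair_unique by (auto simp: invertible_def inverse_pair_def)

lemma inverse_pairI: "P ** Q = mat 1 \<Longrightarrow> inverse_pair P (Q :: complex ^ 'n ^ 'n)"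
  unfolding inverse_pair_def using matrix_left_right_inverse by blast

lemma inverse_pair_mult: "inverse_pair P P' \<Longrightarrow> inverse_pair Q Q' \<Longrightarrow> inverse_pair (P ** Q) (Q' ** P')"
  by (rule inverse_pairI) (simp add: matrix_mul_assoc inverse_pairD)

lemma inverse_pair_transpose: "inverse_pair P Q \<Longrightarrow> inverse_pair (mtransp Q) (mtransp P)"
  by (simp add: inverse_pair_def flip: matrix_transpose_mul)

lemma inverse_pair_nth:
  "inverse_pair P Q \<Longrightarrow> (\<Sum>k\<in>UNIV. P $ i $ k * Q $ k $ j) = (if i = j then 1 else 0)"
  "inverse_pair P Q \<Longrightarrow> (\<Sum>k\<in>UNIV. Q $ i $ k * P $ k $ j) = (if i = j then 1 else 0)"
  using matrix_mult_nth[of P Q i j] matrix_mult_nth[of Q P i j] by (simp_all add: inverse_pairD mat_def)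

subsection \<open>Functional calculus of diagonalizable matrices\<close>

definition diagop :: "complex ^ 'n ^ 'n \<Rightarrow> complex ^ 'n ^ 'n \<Rightarrow> complex ^ 'n \<Rightarrow> complex ^ 'n ^ 'n" where
  "diagop P Q d = P ** cdiag d ** Q"

lemma diagop_nth: "diagop P Q d $ i $ j = (\<Sum>k\<in>UNIV. P $ i $ k * d $ k * Q $ k $ j)"
  unfolding diagop_def by (subst matrix_mult_nth) (simp only: cdiag_mult_nth)

lemma diagop_mult: "inverse_pair P Q \<Longrightarrow> diagop P Q c ** diagop P Q d = diagop P Q (c * d)"
  by (simp add: diagop_def matrix_mul_assoc inverse_pairD flip: cdiag_mult)

lemma diagop_commute: "inverse_pair P Q \<Longrightarrow> diagop P Q c ** diagop P Q d = diagop P Q d ** diagop P Q c"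
  by (simp add: diagop_mult mult.commute)

lemma diagop_const: "inverse_pair P Q \<Longrightarrow> diagop P Q (\<chi> i. c) = mat c"
  unfolding diagop_def cdiag_const
  by (subst (1 2) mat_eq_cscale) (simp add: inverse_pairD)

lemma diagop_add: "diagop P Q (c + d) = diagop P Q c + diagop P Q d"
  and diagop_diff: "diagop P Q (c - d) = diagop P Q c - diagop P Q d"
  and diagop_scale: "diagop P Q (a *s d) = cscale a (diagop P Q d)"
  by (simp_all add: matrix_eq_iff diagop_nth algebra_simps sum.distrib sum_subtractf sum_distrib_left)

lemma diagop_conj: "inverse_pair P Q \<Longrightarrow> Q ** diagop P Q d ** P = cdiag d"
  by (simp add: diagop_def matrix_mul_assoc inverse_pairD)

lemma diagop_inject: "inverse_pair P Q \<Longrightarrow> diagop P Q c = diagop P Q d \<Longrightarrow> c = d"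
proof -
  assume *: "inverse_pair P Q" "diagop P Q c = diagop P Q d"
  then have "cdiag c = cdiag d"
    using diagop_conj by metis
  then have "cdiag c $ i $ i = cdiag d $ i $ i" for i by simp
  then show "c = d" by (simp add: vec_eq_iff)
qed

lemma diagop_vec: "inverse_pair P Q \<Longrightarrow> diagop P Q d *v (P *v v) = P *v (d * v)"
  unfolding diagop_def by (simp add: matrix_vector_mul_assoc[symmetric] cdiag_mult_vec inverse_pairD)

text \<open>Well-definedness of the functional calculus: \<open>Q' ** P\<close> intertwines the
  diagonal matrices of \<open>a\<close> and \<open>b\<close>, so its entries vanish except between
  equal eigenvalues, where \<open>c\<close> and \<open>d\<close> agree as well.\<close>

lemma diagop_transfer:
  assumes P: "inverse_pair P P'" and Q: "inverse_pair Q Q'"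
    and eq: "diagop P P' a = diagop Q Q' b"
    and imp: "\<And>i j. a $ i = b $ j \<Longrightarrow> c $ i = d $ j"
  shows "diagop P P' c = diagop Q Q' d"
proof -
  define S where "S = Q' ** P"
  have "Q' ** diagop P P' a ** P = Q' ** diagop Q Q' b ** P" by (simp add: eq)
  then have "S ** cdiag a = cdiag b ** S"
    using P Q by (simp add: diagop_def S_def matrix_mul_assoc inverse_pairD)
  then have "(S ** cdiag a) $ i $ j = (cdiag b ** S) $ i $ j" for i j by simp
  then have "S $ i $ j * a $ j = b $ i * S $ i $ j" for i j by (simp del: matrix_mult_nth)
  then have "S $ i $ j = 0 \<or> a $ j = b $ i" for i j
    by (metis mult.commute mult_cancel_right)
  then have "S ** cdiag c = cdiag d ** S"
    unfolding matrix_eq_iff cdiag_mult_nth by (metis imp mult.commute mult_zero_left)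
  then have "Q ** (S ** cdiag c) ** P' = Q ** (cdiag d ** S) ** P'" by simp
  then show ?thesis
    using P Q by (simp add: diagop_def S_def matrix_mul_assoc inverse_pairD)
qed

text \<open>What commutes with an operator commutes with every function of it; the hypothesis on
  \<open>c\<close> says that it is a function of \<open>a\<close>.\<close>

lemma commute_diagop_transfer:
  assumes P: "inverse_pair P P'" and B: "B ** diagop P P' a = diagop P P' a ** B"
    and imp: "\<And>i j. a $ i = a $ j \<Longrightarrow> c $ i = c $ j"
  shows "B ** diagop P P' c = diagop P P' c ** B"
proof -
  define S where "S = P' ** B ** P"
  have "P' ** (B ** diagop P P' a) ** P = P' ** (diagop P P' a ** B) ** P" by (simp add: B)
  then have "S ** cdiag a = cdiag a ** S"
    using P by (simp add: diagop_def S_def matrix_mul_assoc inverse_pairD)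
  then have "(S ** cdiag a) $ i $ j = (cdiag a ** S) $ i $ j" for i j by simp
  then have "S $ i $ j * a $ j = a $ i * S $ i $ j" for i j by (simp del: matrix_mult_nth)
  then have "S $ i $ j = 0 \<or> a $ j = a $ i" for i j
    by (metis mult.commute mult_cancel_right)
  then have "S ** cdiag c = cdiag c ** S"
    unfolding matrix_eq_iff cdiag_mult_nth by (metis imp mult.commute mult_zero_left)
  then have "P ** (S ** cdiag c) ** P' = P ** (cdiag c ** S) ** P'" by simp
  then show ?thesis
    using P by (simp add: diagop_def S_def matrix_mul_assoc inverse_pairD)
qed

lemma eigenvalues_diagop:
  fixes P :: "complex ^ 'n ^ 'n"
  assumes "inverse_pair P Q"
  shows "eigenvalues (diagop P Q d) = range (($) d)"
proof
  show "eigenvalues (diagop P Q d) \<subseteq> range (($) d)"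
  proof
    fix c assume "c \<in> eigenvalues (diagop P Q d)"
    then obtain v where v: "v \<noteq> 0" "diagop P Q d *v v = c *s v"
      by (auto simp: eigenvalues_def)
    define w where "w = Q *v v"
    have vw: "v = P *v w" using assms by (simp add: w_def inverse_pairD)
    have "P *v (d * w) = P *v (c *s w)"
      using v assms by (simp add: vw diagop_vec vec.scale)
    then have "d * w = c *s w" using assms by (metis inverse_pairD(8))
    moreover have "w \<noteq> 0" using v vw by auto
    ultimately obtain i where "w $ i \<noteq> 0" "d $ i * w $ i = c * w $ i"
      by (auto simp: vec_eq_iff)
    then show "c \<in> range (($) d)" by auto
  qed
next
  show "range (($) d) \<subseteq> eigenvalues (diagop P Q d)"
  proof clarify
    fix i
    have "P *v ax i \<noteq> 0"
    proof
      assume "P *v ax i = 0"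
      then have "ax i = (0 :: complex ^ 'n)" using inverse_pairD(8)[OF assms, of "ax i"] by simp
      then show False by (simp add: axis_eq_0_iff)
    qed
    moreover have "d * ax i = d $ i *s ax i" by (simp add: vec_eq_iff axis_def)
    ultimately show "d $ i \<in> eigenvalues (diagop P Q d)"
      unfolding eigenvalues_def using diagop_vec[OF assms, of d "ax i"]
      by (auto simp: vec.scale intro!: exI[of _ "P *v ax i"])
  qed
qed

lemma semisimple_iff:
  fixes A :: "complex ^ 'n ^ 'n"
  shows "semisimple A \<longleftrightarrow> (\<exists>P Q d. inverse_pair P Q \<and> A = diagop P Q d)"
proof
  assume "semisimple A"
  then obtain P D :: "complex ^ 'n ^ 'n" where PD: "invertible P" "\<forall>i j. i \<noteq> j \<longrightarrow> D $ i $ j = 0" "A = P ** D ** matrix_inv P"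
    unfolding semisimple_def by blast
  have "D = cdiag (\<chi> i. D $ i $ i)" using PD(2) by (simp add: matrix_eq_iff)
  with PD(3) have "A = diagop P (matrix_inv P) (\<chi> i. D $ i $ i)"
    unfolding diagop_def by simp
  then show "\<exists>P Q d. inverse_pair P Q \<and> A = diagop P Q d"
    using inverse_pair_matrix_inv[OF PD(1)] by blast
next
  assume "\<exists>P Q d. inverse_pair P Q \<and> A = diagop P Q d"
  then obtain P Q d where "inverse_pair P Q" "A = diagop P Q d" by blast
  then show "semisimple A"
    unfolding semisimple_def diagop_def inverse_pair_iff
    by (intro exI[of _ P] exI[of _ "cdiag d"]) simp
qed

lemma ss_with_spectrum_in_iff:
  "A \<in> ss_with_spectrum_in X \<longleftrightarrow> (\<exists>P Q d. inverse_pair P Q \<and> d \<in> tuples X \<and> A = diagop P Q d)"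
  by (auto simp: ss_with_spectrum_in_def semisimple_iff tuples_def eigenvalues_diagop)
     (metis range_subsetD)

lemma diagop_in_ss: "inverse_pair P Q \<Longrightarrow> d \<in> tuples X \<Longrightarrow> diagop P Q d \<in> ss_with_spectrum_in X"
  by (auto simp: ss_with_spectrum_in_iff)

lemma injective_imp_inverse_pair:
  assumes "\<And>x. Q *v x = 0 \<Longrightarrow> x = (0 :: complex ^ 'n)"
  obtains Q' where "inverse_pair Q Q'"
  using assms by (metis inverse_pair_matrix_inv invertible_left_inverse matrix_left_invertible_ker)

lemma distinct_eigenvalues_diagonalizable:
  fixes M :: "complex ^ 'n ^ 'n"
  assumes eig: "eigenvalues M = range (($) c)" and inj: "\<And>i j. i \<noteq> j \<Longrightarrow> c $ i \<noteq> c $ j"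
  obtains Q Q' where "inverse_pair Q Q'" "M = diagop Q Q' c"
proof -
  have "\<exists>v. v \<noteq> 0 \<and> M *v v = c $ i *s v" for i
    using eig by (auto simp: eigenvalues_def)
  then obtain v where v: "\<And>i. v i \<noteq> 0" "\<And>i. M *v v i = c $ i *s v i" by metis
  define Q :: "complex ^ 'n ^ 'n" where "Q = (\<chi> a i. v i $ a)"
  have MQ: "M *v (Q *v x) = Q *v (c * x)" for x
  proof -
    have Qx: "Q *v x = (\<Sum>i\<in>UNIV. x $ i *s v i)" for x
      by (simp add: vec_eq_iff Q_def matrix_vector_mult_def sum_component mult.commute)
    show ?thesis
      by (simp add: Qx vec.sum vec.scale v mult.commute)
  qed
  \<comment> \<open>\<open>Q *v x = 0\<close> is a linear relation between eigenvectors, and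
    applying \<open>M - mat (c $ k)\<close> multiplies its \<open>i\<close>-th coefficient by
    \<open>c $ i - c $ k\<close>. Taking all indices but one for \<open>S\<close> leaves a single
    term.\<close>
  have ker: "Q *v ((\<chi> i. x $ i * (\<Prod>j\<in>S. c $ i - c $ j))) = 0" if x: "Q *v x = 0" and "finite S" for x S
    using that(2)
  proof (induction S)
    case empty
    then show ?case using x by (simp add: vec_nth_inverse)
  next
    case (insert k S)
    let ?y = "\<chi> i. x $ i * (\<Prod>j\<in>S. c $ i - c $ j)"
    have "(\<chi> i. x $ i * (\<Prod>j\<in>insert k S. c $ i - c $ j)) = c * ?y - c $ k *s ?y"
      using insert by (simp add: vec_eq_iff algebra_simps)
    then show ?case
      using insert.IH MQ[of ?y] by (simp add: matrix_vector_mult_diff_distrib vec.scale)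
  qed
  have "x = 0" if x: "Q *v x = 0" for x
  proof -
    have "x $ k = 0" for k
    proof -
      define p where "p = (\<Prod>j\<in>-{k}. c $ k - c $ j)"
      have "(\<Prod>j\<in>-{k}. c $ i - c $ j) = (if i = k then p else 0)" for i
        unfolding p_def by (auto intro!: prod_zero)
      then have "(\<chi> i. x $ i * (\<Prod>j\<in>-{k}. c $ i - c $ j)) = (x $ k * p) *s ax k"
        by (simp add: vec_eq_iff axis_def)
      then have "(x $ k * p) *s (Q *v ax k) = 0"
        using ker[OF x, of "-{k}"] by (simp add: vec.scale)
      moreover have "Q *v ax k = v k"
        by (simp add: vec_eq_iff Q_def matrix_vector_mult_def axis_def if_distrib cong: if_cong)
      moreover have "p \<noteq> 0" unfolding p_def using inj by auto
      ultimately show ?thesis using v(1)[of k] by (simp add: vec.scale_eq_0_iff)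
    qed
    then show ?thesis by (simp add: vec_eq_iff)
  qed
  then obtain Q' where Q': "inverse_pair Q Q'"
    using injective_imp_inverse_pair by blast
  have "M ** Q *v x = Q ** cdiag c *v x" for x
    using MQ by (simp add: matrix_vector_mul_assoc[symmetric] cdiag_mult_vec)
  then have "M ** Q = Q ** cdiag c" by (simp add: matrix_eq)
  then have "M = diagop Q Q' c"
    unfolding diagop_def using inverse_pairD(5)[OF Q', of M] by simp
  with Q' that show thesis by blast
qed

lemma commute_cdiag_imp_diag:
  assumes "N ** cdiag c = cdiag c ** N" "\<And>i j. i \<noteq> j \<Longrightarrow> c $ i \<noteq> c $ j"
  shows "N = cdiag (\<chi> i. N $ i $ i)"
proof -
  have "(N ** cdiag c) $ i $ j = (cdiag c ** N) $ i $ j" for i j using assms(1) by simp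
  then have "N $ i $ j * c $ j = c $ i * N $ i $ j" for i j by (simp del: matrix_mult_nth)
  then have "N $ i $ j = 0" if "i \<noteq> j" for i j
    using assms(2)[OF that] by (metis mult.commute mult_cancel_right)
  then show ?thesis by (auto simp: matrix_eq_iff)
qed

subsection \<open>Rank-one operators\<close>

lemma bil_simps [simp]:
  "bil (x + y) v = bil x v + bil y v" "bil x (v + w) = bil x v + bil x w"
  "bil (x - y) v = bil x v - bil y v" "bil x (v - w) = bil x v - bil x w"
  "bil (c *s x) v = c * bil x v" "bil x (c *s v) = c * bil x v"
  "bil (- x) v = - bil x v" "bil x (- v) = - bil x v"
  "bil 0 v = 0" "bil x 0 = 0"
  "bil (ax i) v = v $ i" "bil x (ax i) = x $ i"
proof -
  show "bil (ax i) v = v $ i" "bil x (ax i) = x $ i"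
    unfolding bil_def axis_def
    by (simp_all add: if_distrib if_distribR cong: if_cong)
qed (simp_all add: bil_def algebra_simps sum.distrib sum_subtractf sum_distrib_left sum_negf)

lemma bil_commute: "bil x v = bil v x"
  by (simp add: bil_def mult.commute)

lemma outer_simps:
  "outer (v + w) x = outer v x + outer w x" "outer v (x + y) = outer v x + outer v y"
  "outer (v - w) x = outer v x - outer w x" "outer v (x - y) = outer v x - outer v y"
  "outer (c *s v) x = cscale c (outer v x)" "outer v (c *s x) = cscale c (outer v x)"
  "outer (- v) x = - outer v x" "outer v (- x) = - outer v x"
  by (simp_all add: matrix_eq_iff algebra_simps)

lemma outer_mult: "outer v x ** outer w y = cscale (bil x w) (outer v y)"
  by (simp add: matrix_eq_iff matrix_mult_nth bil_def sum_distrib_left sum_distrib_right mult_ac)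

lemma mult_outer: "A ** outer v x = outer (A *v v) x"
  by (simp add: matrix_eq_iff matrix_mult_nth matrix_vector_mult_def sum_distrib_left sum_distrib_right mult_ac)

lemma outer_mult_matrix: "outer v x ** A = outer v (x v* A)"
  by (simp add: matrix_eq_iff matrix_mult_nth vector_matrix_mult_def sum_distrib_left sum_distrib_right mult_ac)

lemma transpose_outer: "mtransp (outer v x) = outer x v"
  by (simp add: matrix_eq_iff transpose_def mult.commute)

lemma trace_outer: "trace (outer v x) = bil x v"
  by (simp add: trace_def bil_def mult.commute)

lemma diagop_eq_sum:
  "diagop P Q d = (\<Sum>i\<in>UNIV. cscale (d $ i) (outer (column i P) (row i Q)))"
  by (simp add: matrix_eq_iff diagop_nth sum_component column_def row_def mult_ac)

lemma diagop_axis: "diagop P Q (ax i) = outer (column i P) (row i Q)"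
  by (simp add: matrix_eq_iff diagop_nth column_def row_def axis_def if_distrib cong: if_cong)
     (simp add: if_distribR if_distrib cong: if_cong)

lemma bil_row_column: "inverse_pair P Q \<Longrightarrow> bil (row i Q) (column j P) = (if i = j then 1 else 0)"
  by (simp add: bil_def row_def column_def inverse_pair_nth)

definition rank1_idem :: "complex ^ 'n ^ 'n \<Rightarrow> bool" where
  "rank1_idem R \<longleftrightarrow> (\<exists>v x. bil x v = 1 \<and> R = outer v x)"

lemma rank1_idem_outer [simp]: "bil x v = 1 \<Longrightarrow> rank1_idem (outer v x)"
  by (auto simp: rank1_idem_def)

lemma rank1_idem_idem: "rank1_idem p \<Longrightarrow> p ** p = p"
  by (auto simp: rank1_idem_def outer_mult)

lemma trace_rank1_idem: "rank1_idem p \<Longrightarrow> trace p = 1"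
  by (auto simp: rank1_idem_def trace_outer)

lemma rank1_idem_nonzero: "rank1_idem p \<Longrightarrow> p \<noteq> 0"
  using trace_rank1_idem[of p] by (auto simp: trace_def)

text \<open>\<open>p = q ** p ** q\<close> is a scalar multiple of \<open>q\<close>, and the traces
  force the scalar to be 1.\<close>

lemma rank1_idem_le_eq:
  assumes p: "rank1_idem p" and q: "rank1_idem q" and "p ** q = p" "q ** p = p"
  shows "p = q"
proof -
  obtain v x w y where *: "bil x v = 1" "p = outer v x" "bil y w = 1" "q = outer w y"
    using p q by (auto simp: rank1_idem_def)
  have "p = q ** p ** q" using assms(3,4) by simp
  then have **: "p = cscale (bil y v * bil x w) q" by (simp add: * outer_mult)
  have "trace p = 1" "trace q = 1" using * by (simp_all add: trace_outer)
  moreover have "trace p = (bil y v * bil x w) * trace q"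
    by (subst **) (simp add: trace_def sum_distrib_left)
  ultimately have "bil y v * bil x w = 1" by simp
  with ** show ?thesis by simp
qed

text \<open>Multiplying the equation by \<open>p\<close> on either side kills \<open>r\<close> and
  \<open>r'\<close>. This is the device by which two splittings of one sum identify two
  images.\<close>

lemma rank1_idem_exchange:
  assumes "rank1_idem p" "rank1_idem q" "q + r = p + r'"
    and "p ** r = 0" "r ** p = 0" "p ** r' = 0" "r' ** p = 0"
  shows "p = q"
proof (rule rank1_idem_le_eq[OF assms(1,2)])
  have "p ** (q + r) = p ** (p + r')" "(q + r) ** p = (p + r') ** p" using assms by simp_all
  then show "p ** q = p" "q ** p = p"
    unfolding matrix_add_ldistrib matrix_add_rdistrib' assms(4-7) rank1_idem_idem[OF assms(1)]
    by simp_all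
qed

subsection \<open>Orthoadditive maps on rank-one idempotents\<close>

lemma ax_nth [simp]: "(ax i :: complex ^ 'n) $ j = (if i = j then 1 else 0)"
  by (simp add: axis_def)

lemma tendsto_matrix_mult [tendsto_intros]:
  fixes f g :: "'a \<Rightarrow> complex ^ 'n ^ 'n"
  assumes "(f \<longlongrightarrow> A) F" "(g \<longlongrightarrow> B) F"
  shows "((\<lambda>x. f x ** g x) \<longlongrightarrow> A ** B) F"
  unfolding matrix_matrix_mult_def
  by (intro tendsto_vec_lambda tendsto_sum tendsto_mult tendsto_vec_nth assms)

lemma continuous_on_matrix_mult [continuous_intros]:
  fixes f g :: "'a::topological_space \<Rightarrow> complex ^ 'n ^ 'n"
  shows "continuous_on S f \<Longrightarrow> continuous_on S g \<Longrightarrow> continuous_on S (\<lambda>x. f x ** g x)"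
  by (simp add: continuous_on_def tendsto_matrix_mult)

lemma continuous_on_outer [continuous_intros]:
  "continuous_on S f \<Longrightarrow> continuous_on S g \<Longrightarrow> continuous_on S (\<lambda>x. outer (f x) (g x))"
  unfolding outer_def by (intro continuous_on_vec_lambda continuous_intros)

lemma continuous_on_vector_scalar_mult [continuous_intros]:
  fixes f :: "'a::topological_space \<Rightarrow> complex"
  shows "continuous_on S f \<Longrightarrow> continuous_on S g \<Longrightarrow> continuous_on S (\<lambda>x. f x *s g x)"
  unfolding vector_scalar_mult_def by (intro continuous_on_vec_lambda continuous_intros)

text \<open>Additivity takes the form of equal sums of orthogonal pairs because only the values at
  rank-one idempotents are constrained.\<close>

locale rank1_map =
  fixes \<Psi> :: "complex ^ 'n ^ 'n \<Rightarrow> complex ^ 'n ^ 'n"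
  assumes card3: "CARD('n) \<ge> 3"
    and rank1: "rank1_idem p \<Longrightarrow> rank1_idem (\<Psi> p)"
    and orth: "rank1_idem p \<Longrightarrow> rank1_idem q \<Longrightarrow> p ** q = 0 \<Longrightarrow> q ** p = 0 \<Longrightarrow> \<Psi> p ** \<Psi> q = 0"
    and sum2: "rank1_idem p \<Longrightarrow> rank1_idem q \<Longrightarrow> rank1_idem p' \<Longrightarrow> rank1_idem q' \<Longrightarrow>
      p ** q = 0 \<Longrightarrow> q ** p = 0 \<Longrightarrow> p' ** q' = 0 \<Longrightarrow> q' ** p' = 0 \<Longrightarrow>
      p + q = p' + q' \<Longrightarrow> \<Psi> p + \<Psi> q = \<Psi> p' + \<Psi> q'"
    and cont: "continuous_on {p. rank1_idem p} \<Psi>"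
begin

lemma orth_outer:
  assumes "bil x v = 1" "bil y w = 1" "bil x w = 0" "bil y v = 0"
  shows "\<Psi> (outer v x) ** \<Psi> (outer w y) = 0"
  by (rule orth) (simp_all add: assms outer_mult)

text \<open>The vectors \<open>v, w\<close> with forms \<open>x, y\<close> and the sheared vectors
  \<open>v, w - c *s v\<close> with forms \<open>x + c *s y, y\<close> describe the same plane and
  the same complement.\<close>

lemma sum2_outer:
  assumes "bil x v = 1" "bil y w = 1" "bil x w = 0" "bil y v = 0"
  shows "\<Psi> (outer v x) + \<Psi> (outer w y) = \<Psi> (outer v (x + c *s y)) + \<Psi> (outer (w - c *s v) y)"
proof (rule sum2)
  show "outer v x + outer w y = outer v (x + c *s y) + outer (w - c *s v) y"
    by (simp add: outer_simps)
qed (simp_all add: assms outer_mult)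

text \<open>
  If \<open>\<Psi>\<close> were constant on a pencil of idempotents with common range, exchanging idempotents within
  sums of orthogonal pairs (and one limit) would make \<open>\<Psi> (outer v \<eta>)\<close> independent of \<open>v\<close> for several \<open>\<eta>\<close>,
  and two orthogonal coordinate idempotents would have the same image.
\<close>

lemma no_collapse:
  assumes "i \<noteq> j" "i \<noteq> k" "j \<noteq> k"
    and const: "\<And>a. \<Psi> (outer (ax i) (ax i + a *s ax j)) = \<Psi> (outer (ax i) (ax i))"
  shows False
proof -
  note dist = assms(1-3) assms(1-3)[symmetric]
  define Z where "Z = \<Psi> (outer (ax i) (ax i))"
  have 1: "\<Psi> (outer (ax i) (ax i + c *s \<eta>)) = Z"
    if \<eta>: "\<eta> $ i = 0" and w: "w $ i = 0" "bil \<eta> w = 1" "w $ j \<noteq> 0" for \<eta> w c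
  proof -
    let ?q = "outer (ax i) (ax i + c *s \<eta>)"
    have ww: "Z ** \<Psi> (outer (w - c *s ax i) \<eta>) = 0" "\<Psi> (outer (w - c *s ax i) \<eta>) ** Z = 0" for c
    proof -
      \<comment> \<open>The coefficient makes \<open>?x\<close> annihilate
        \<open>w - c *s ax i\<close>; since \<open>?x\<close> lies in the collapsed pencil,
        \<open>Z\<close> inherits the orthogonality.\<close>
      let ?x = "ax i + (c / w $ j) *s ax j"
      have "Z = \<Psi> (outer (ax i) ?x)" using const by (simp add: Z_def)
      then show "Z ** \<Psi> (outer (w - c *s ax i) \<eta>) = 0" "\<Psi> (outer (w - c *s ax i) \<eta>) ** Z = 0"
        using dist that by (auto intro!: orth_outer)
    qed
    have "\<Psi> ?q + \<Psi> (outer (w - c *s ax i) \<eta>) = Z + \<Psi> (outer w \<eta>)"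
      unfolding Z_def using that by (intro sum2_outer[symmetric]) auto
    then have "Z = \<Psi> ?q"
      using ww[of c] ww[of 0] that dist
      by (elim rank1_idem_exchange[rotated 2]) (auto simp: Z_def intro!: rank1)
    then show ?thesis by simp
  qed
  define good where "good = (\<lambda>\<eta>. \<eta> $ i = 0 \<and> (\<forall>c. \<Psi> (outer (ax i) (ax i + c *s \<eta>)) = Z))"
  \<comment> \<open>Shear the pair of \<open>ax i\<close> and \<open>s\<close>: the image of the
    first summand does not change because \<eta> is \<open>good\<close>, so neither does that of the
    second.\<close>
  have 2: "\<Psi> (outer (s + c *s ax i) \<eta>) = \<Psi> (outer s \<eta>)"
    if "good \<eta>" "s $ i = 0" "bil \<eta> s = 1" for \<eta> s c
  proof -
    have "\<Psi> (outer (ax i) (ax i)) + \<Psi> (outer s \<eta>)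
        = \<Psi> (outer (ax i) (ax i + (-c) *s \<eta>)) + \<Psi> (outer (s - (-c) *s ax i) \<eta>)"
      using that by (intro sum2_outer) (auto simp: good_def)
    moreover have "s - (-c) *s ax i = s + c *s ax i" by (simp add: vec_eq_iff)
    moreover have "\<Psi> (outer (ax i) (ax i + (-c) *s \<eta>)) = \<Psi> (outer (ax i) (ax i))"
      using that(1) unfolding good_def Z_def by blast
    ultimately show ?thesis by simp
  qed
  have 3: "\<Psi> (outer s \<eta>) = \<Psi> (outer (s + d) \<eta>)"
    if \<eta>: "good \<eta>" and s: "s $ i = 0" "bil \<eta> s = 1" and d: "d $ i = 0" "bil \<eta> d = 0"
      and \<kappa>: "\<kappa> $ i = 0" "bil \<kappa> d = 1" "bil \<kappa> s = 0" for s \<eta> d \<kappa>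
  proof -
    define p where "p = \<Psi> (outer (s + d) \<eta>)"
    let ?K = "\<lambda>\<epsilon>. outer d (\<kappa> + \<epsilon> *s ax i)"
    \<comment> \<open>\<kappa> does not annihilate \<open>s + d\<close>. By 2, however, this vector
      may be moved along \<open>ax i\<close>, and for \<epsilon> \<noteq> 0 the form
      \<open>\<kappa> + \<epsilon> *s ax i\<close> annihilates a suitable translate. Continuity then
      carries the orthogonality to \<epsilon> = 0.\<close>
    have K: "p ** \<Psi> (?K \<epsilon>) = 0 \<and> \<Psi> (?K \<epsilon>) ** p = 0" if "\<epsilon> \<noteq> 0" for \<epsilon>
    proof -
      have "p = \<Psi> (outer (s + d + (- 1 / \<epsilon>) *s ax i) \<eta>)"
        unfolding p_def using \<eta> s d by (subst 2) auto
      moreover have "\<eta> $ i = 0" using \<eta> by (simp add: good_def)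
      ultimately show ?thesis
        using that s d \<kappa> by (auto intro!: orth_outer)
    qed
    have "continuous_on UNIV (\<lambda>\<epsilon>. \<Psi> (?K \<epsilon>))"
      by (rule continuous_on_compose2[OF cont])
         (auto simp: d \<kappa> intro!: continuous_intros)
    then have lim: "((\<lambda>\<epsilon>. \<Psi> (?K \<epsilon>)) \<longlongrightarrow> \<Psi> (?K 0)) (at 0)"
      unfolding continuous_on_eq_continuous_at[OF open_UNIV] isCont_def by blast
    have "((\<lambda>\<epsilon>. p ** \<Psi> (?K \<epsilon>)) \<longlongrightarrow> p ** \<Psi> (?K 0)) (at 0)"
      "((\<lambda>\<epsilon>. \<Psi> (?K \<epsilon>) ** p) \<longlongrightarrow> \<Psi> (?K 0) ** p) (at 0)"
      by (intro tendsto_intros lim)+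
    moreover have "((\<lambda>\<epsilon>. p ** \<Psi> (?K \<epsilon>)) \<longlongrightarrow> 0) (at 0)" "((\<lambda>\<epsilon>. \<Psi> (?K \<epsilon>) ** p) \<longlongrightarrow> 0) (at 0)"
      by (rule tendsto_eventually, use K in \<open>auto simp: eventually_at_filter\<close>)+
    ultimately have K0: "p ** \<Psi> (outer d \<kappa>) = 0" "\<Psi> (outer d \<kappa>) ** p = 0"
      using tendsto_unique[OF _ \<open>((\<lambda>\<epsilon>. p ** \<Psi> (?K \<epsilon>)) \<longlongrightarrow> p ** \<Psi> (?K 0)) (at 0)\<close>]
        tendsto_unique[OF _ \<open>((\<lambda>\<epsilon>. \<Psi> (?K \<epsilon>) ** p) \<longlongrightarrow> \<Psi> (?K 0) ** p) (at 0)\<close>] by auto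
    have "p = \<Psi> (outer s \<eta>)"
    proof (rule rank1_idem_exchange)
      show "\<Psi> (outer s \<eta>) + \<Psi> (outer d \<kappa>) = p + \<Psi> (outer d (\<kappa> - \<eta>))"
      proof -
        have "\<Psi> (outer d \<kappa>) + \<Psi> (outer s \<eta>)
            = \<Psi> (outer d (\<kappa> + (-1) *s \<eta>)) + \<Psi> (outer (s - (-1) *s d) \<eta>)"
          using s d \<kappa> by (intro sum2_outer)
        then show ?thesis by (simp add: p_def add.commute)
      qed
      show "p ** \<Psi> (outer d (\<kappa> - \<eta>)) = 0" "\<Psi> (outer d (\<kappa> - \<eta>)) ** p = 0"
        unfolding p_def using s d \<kappa> by (auto intro!: orth_outer)
    qed (use K0 s d in \<open>auto simp: p_def intro!: rank1\<close>)
    then show ?thesis by (simp add: p_def)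
  qed
  \<comment> \<open>The auxiliary vector in 1 needs a nonzero \<open>j\<close>-th coordinate, hence
    the choice \<open>ax j + ax k\<close> for the form \<open>ax k\<close>.\<close>
  have g: "good (ax j)" "good (ax k)" "good (ax j - ax k)"
    unfolding good_def using dist 1[of "ax j" "ax j"] 1[of "ax k" "ax j + ax k"] 1[of "ax j - ax k" "ax j"]
    by auto
  have k: "\<Psi> (outer (ax k) (ax k)) = \<Psi> (outer (ax k + ax j) (ax k))"
    using dist g by (intro 3[where \<kappa> = "ax j"]) auto
  have j: "\<Psi> (outer (ax j) (ax j)) = \<Psi> (outer (ax j + ax k) (ax j))"
    using dist g by (intro 3[where \<kappa> = "ax k"]) auto
  have jk: "\<Psi> (outer (ax j) (ax j - ax k)) = \<Psi> (outer (- ax k) (ax j - ax k))"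
  proof -
    have "\<Psi> (outer (ax j) (ax j - ax k)) = \<Psi> (outer (ax j + (- ax j - ax k)) (ax j - ax k))"
      using dist g by (intro 3[where \<kappa> = "- ax k"]) auto
    then show ?thesis by simp
  qed
  \<comment> \<open>In each of the two shears of the coordinate pair one summand keeps its image by
    \<open>k\<close> or \<open>j\<close> and cancels. What remains is linked by \<open>jk\<close>,
    so two orthogonal idempotents get the same image.\<close>
  have "\<Psi> (outer (ax j) (ax j)) + \<Psi> (outer (ax k) (ax k))
      = \<Psi> (outer (ax j) (ax j + (-1) *s ax k)) + \<Psi> (outer (ax k - (-1) *s ax j) (ax k))"
    using dist by (intro sum2_outer) auto
  then have a: "\<Psi> (outer (ax j) (ax j)) = \<Psi> (outer (ax j) (ax j - ax k))"
    using k by simp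
  have "\<Psi> (outer (ax k) (ax k)) + \<Psi> (outer (ax j) (ax j))
      = \<Psi> (outer (ax k) (ax k + (-1) *s ax j)) + \<Psi> (outer (ax j - (-1) *s ax k) (ax j))"
    using dist by (intro sum2_outer) auto
  then have b: "\<Psi> (outer (ax k) (ax k)) = \<Psi> (outer (ax k) (ax k - ax j))"
    using j by simp
  have "outer (ax k) (ax k - ax j) = outer (- ax k) (ax j - ax k)"
    by (simp add: outer_simps)
  with a b jk have eq: "\<Psi> (outer (ax j) (ax j)) = \<Psi> (outer (ax k) (ax k))" by simp
  have r: "rank1_idem (\<Psi> (outer (ax j) (ax j)))" by (intro rank1) auto
  have "\<Psi> (outer (ax j) (ax j)) ** \<Psi> (outer (ax k) (ax k)) = 0"
    using dist by (intro orth_outer) auto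
  with eq rank1_idem_idem[OF r] rank1_idem_nonzero[OF r] show False by simp
qed

end

lemma bil_single:
  assumes "\<And>l. l \<noteq> j \<Longrightarrow> x $ l = 0 \<or> v $ l = 0"
  shows "bil x v = x $ j * v $ j"
proof -
  have "bil x v = (\<Sum>l\<in>UNIV. if l = j then x $ j * v $ j else 0)"
    unfolding bil_def by (rule sum.cong) (use assms in auto)
  then show ?thesis by simp
qed

lemma third_index:
  assumes "CARD('n) \<ge> 3" shows "\<exists>k :: 'n. k \<noteq> i \<and> k \<noteq> j"
proof (rule ccontr)
  assume "\<not> ?thesis"
  then have "(UNIV :: 'n set) \<subseteq> {i, j}" by auto
  then have "CARD('n) \<le> card {i, j}" by (intro card_mono) auto
  also have "\<dots> \<le> 2" by (simp add: card_insert_if)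
  finally show False using assms by simp
qed

text \<open>Off-diagonal pairs are linked by changing one index at a time. A pair that begins with
  \<open>j\<close> is reached from \<open>(i, j)\<close> through a third index:
  \<open>(i, j)\<close>, \<open>(i, m)\<close>, \<open>(j, m)\<close>,
  \<open>(j, j')\<close>.\<close>

lemma pairs_connected:
  fixes f :: "'n :: finite \<Rightarrow> 'n \<Rightarrow> 'b"
  assumes card: "CARD('n) \<ge> 3"
    and col: "\<And>i j k. i \<noteq> j \<Longrightarrow> k \<noteq> j \<Longrightarrow> i \<noteq> k \<Longrightarrow> f i j = f k j"
    and row: "\<And>i j k. i \<noteq> j \<Longrightarrow> i \<noteq> k \<Longrightarrow> j \<noteq> k \<Longrightarrow> f i j = f i k"
    and "i \<noteq> j" "i' \<noteq> j'"
  shows "f i j = f i' j'"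
proof (cases "i' = j")
  case False
  then have "f i j = f i' j" using assms(4) col[of i j i'] by (cases "i = i'") auto
  also have "\<dots> = f i' j'" using False assms(5) row[of i' j j'] by (cases "j = j'") auto
  finally show ?thesis .
next
  case True
  obtain m where m: "m \<noteq> i" "m \<noteq> j" using third_index[OF card] by blast
  have "f i j = f i m" using m assms(4) row[of i j m] by auto
  also have "\<dots> = f j m" using m assms(4) col[of i m j] by auto
  also have "\<dots> = f i' j'" using m assms(5) row[of j m j'] True by (cases "m = j'") auto
  finally show ?thesis .
qed

text \<open>For \<open>outer v x\<close> with \<open>bil x v = 1\<close> the two conditions mean
  \<open>v $ j = 0\<close> and \<open>x $ j = 0\<close>, expressed without choosing the factors,
  which are unique only up to scaling.\<close>

definition row0 :: "complex ^ 'n ^ 'n \<Rightarrow> 'n \<Rightarrow> bool" where "row0 A j \<longleftrightarrow> (\<forall>b. A $ j $ b = 0)"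
definition col0 :: "complex ^ 'n ^ 'n \<Rightarrow> 'n \<Rightarrow> bool" where "col0 A j \<longleftrightarrow> (\<forall>b. A $ b $ j = 0)"

lemma bil_nonzero:
  assumes "bil x v = 1" shows "(\<exists>i. x $ i \<noteq> 0) \<and> (\<exists>i. v $ i \<noteq> 0)"
proof -
  have "\<exists>i. x $ i * v $ i \<noteq> 0"
    using assms sum.neutral[of UNIV "\<lambda>i. x $ i * v $ i"] unfolding bil_def
    by (metis zero_neq_one)
  then show ?thesis by auto
qed

lemma row0_outer: "bil x v = 1 \<Longrightarrow> row0 (outer v x) j \<longleftrightarrow> v $ j = 0"
  and col0_outer: "bil x v = 1 \<Longrightarrow> col0 (outer v x) j \<longleftrightarrow> x $ j = 0"
  using bil_nonzero[of x v] by (auto simp: row0_def col0_def)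

section \<open>Normalized maps: the row and the column type\<close>

locale normalized_rank1_map = rank1_map \<Psi> for \<Psi> :: "complex ^ 'n ^ 'n \<Rightarrow> complex ^ 'n ^ 'n" +
  assumes norm: "\<And>i. \<Psi> (outer (ax i) (ax i)) = outer (ax i) (ax i)"
begin

lemma image:
  assumes "bil x v = 1"
  obtains y \<eta> where "\<Psi> (outer v x) = outer y \<eta>" "bil \<eta> y = 1"
  using rank1[OF rank1_idem_outer[OF assms]] that unfolding rank1_idem_def by blast

lemma test:
  assumes "bil x v = 1" "\<Psi> (outer v x) = outer y \<eta>" "bil \<eta> y = 1"
    and "bil z' w' = 1" "\<Psi> (outer w' z') = outer w z" "bil z w = 1"
    and "bil x w' = 0" "bil z' v = 0"
  shows "bil z y = 0 \<and> bil \<eta> w = 0"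
proof -
  have "\<Psi> (outer v x) ** \<Psi> (outer w' z') = 0" "\<Psi> (outer w' z') ** \<Psi> (outer v x) = 0"
    by (rule orth_outer; use assms in simp)+
  then have "cscale (bil \<eta> w) (outer y z) = 0" "cscale (bil z y) (outer w \<eta>) = 0"
    using assms by (simp_all add: outer_mult)
  moreover have "outer y z \<noteq> 0" "outer w \<eta> \<noteq> 0"
    using bil_nonzero[OF assms(3)] bil_nonzero[OF assms(6)] by (auto simp: matrix_eq_iff)
  ultimately show ?thesis
    by (metis cscale_cancel cscale_simps(3))
qed

lemma support:
  assumes "bil x v = 1" "\<Psi> (outer v x) = outer y \<eta>" "bil \<eta> y = 1" "v $ k = 0" "x $ k = 0"
  shows "y $ k = 0 \<and> \<eta> $ k = 0"
  using test[OF assms(1-3), of "ax k" "ax k" "ax k" "ax k"] assms norm by simp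

abbreviation pencil :: "'n \<Rightarrow> 'n \<Rightarrow> complex \<Rightarrow> complex ^ 'n ^ 'n" where
  "pencil i j a \<equiv> \<Psi> (outer (ax i) (ax i + a *s ax j))"

text \<open>The other summand of the sheared coordinate pair; its image complements that of the
  pencil within the plane of \<open>ax i\<close> and \<open>ax j\<close>.\<close>

abbreviation copencil :: "'n \<Rightarrow> 'n \<Rightarrow> complex \<Rightarrow> complex ^ 'n ^ 'n" where
  "copencil i j a \<equiv> \<Psi> (outer (ax j - a *s ax i) (ax j))"

lemma pencil_add_copencil:
  assumes "i \<noteq> j"
  shows "pencil i j a + copencil i j a = outer (ax i) (ax i) + outer (ax j) (ax j)"
  using sum2_outer[of "ax i" "ax i" "ax j" "ax j" a] assms norm by simp

lemma pencil_image:
  assumes "i \<noteq> j"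
  obtains y \<eta> where "pencil i j a = outer y \<eta>" "bil \<eta> y = 1"
    "\<forall>k. k \<noteq> i \<longrightarrow> k \<noteq> j \<longrightarrow> y $ k = 0 \<and> \<eta> $ k = 0"
proof -
  have *: "bil (ax i + a *s ax j) (ax i) = 1" using assms by simp
  from image[OF *] obtain y \<eta> where y: "pencil i j a = outer y \<eta>" "bil \<eta> y = 1" .
  moreover have "y $ k = 0 \<and> \<eta> $ k = 0" if "k \<noteq> i" "k \<noteq> j" for k
    using support[OF * y, of k] that by auto
  ultimately show thesis using that by blast
qed

text \<open>In the block of the indices \<open>i\<close> and \<open>j\<close> the two images add up
  to the identity, so a vanishing row of one is a vanishing column of the other.\<close>

lemma copencil_row0_col0:
  assumes "i \<noteq> j"
  shows "row0 (pencil i j a) j \<longleftrightarrow> col0 (copencil i j a) i"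
    and "col0 (pencil i j a) j \<longleftrightarrow> row0 (copencil i j a) i"
proof -
  obtain y \<eta> where y: "pencil i j a = outer y \<eta>" "bil \<eta> y = 1"
    "\<forall>l. l \<noteq> i \<longrightarrow> l \<noteq> j \<longrightarrow> y $ l = 0 \<and> \<eta> $ l = 0" by (rule pencil_image[OF assms, of a])
  obtain u \<omega> where u: "copencil i j a = outer u \<omega>" "bil \<omega> u = 1"
    by (rule image[of "ax j" "ax j - a *s ax i"]) (use assms in auto)
  have eq: "outer y \<eta> $ b $ c + outer u \<omega> $ b $ c
      = (outer (ax i) (ax i) + outer (ax j) (ax j) :: complex ^ 'n ^ 'n) $ b $ c" for b c
    using pencil_add_copencil[OF assms, of a] by (simp only: y u flip: vector_add_component)
  show "row0 (pencil i j a) j \<longleftrightarrow> col0 (copencil i j a) i"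
    unfolding y(1) u(1) row0_outer[OF y(2)] col0_outer[OF u(2)]
    using eq[of i i] eq[of j j] eq[of j i] assms by auto
  show "col0 (pencil i j a) j \<longleftrightarrow> row0 (copencil i j a) i"
    unfolding y(1) u(1) col0_outer[OF y(2)] row0_outer[OF u(2)]
    using eq[of i i] eq[of j j] eq[of i j] assms by auto
qed

text \<open>If row and column \<open>j\<close> vanished throughout, every member of the pencil would
  have the image of the coordinate idempotent, against \<open>no_collapse\<close>.\<close>

lemma pencil_nonconst:
  assumes "i \<noteq> j"
  shows "\<exists>a. \<not> (row0 (pencil i j a) j \<and> col0 (pencil i j a) j)"
proof (rule ccontr)
  assume neg: "\<not> ?thesis"
  obtain k where k: "k \<noteq> i" "k \<noteq> j" using third_index[OF card3] by blast
  have "pencil i j a = \<Psi> (outer (ax i) (ax i))" for a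
  proof -
    obtain y \<eta> where y: "pencil i j a = outer y \<eta>" "bil \<eta> y = 1"
      "\<forall>k. k \<noteq> i \<longrightarrow> k \<noteq> j \<longrightarrow> y $ k = 0 \<and> \<eta> $ k = 0" by (rule pencil_image[OF assms, of a])
    have "row0 (pencil i j a) j" "col0 (pencil i j a) j" using neg by blast+
    then have "y $ j = 0" "\<eta> $ j = 0" unfolding y(1) row0_outer[OF y(2)] col0_outer[OF y(2)] .
    then have z: "y $ k = 0" "\<eta> $ k = 0" if "k \<noteq> i" for k
      using y(3) that by metis+
    then have "\<eta> $ i * y $ i = 1" using y(2) bil_single[of i \<eta> y] by simp
    then have "(outer y \<eta>) $ b $ c = outer (ax i) (ax i) $ b $ c" for b c
      using z[of b] z[of c] by (cases "b = i"; cases "c = i") (simp_all add: mult.commute)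
    then have "outer y \<eta> = outer (ax i) (ax i)" unfolding matrix_eq_iff by blast
    then show ?thesis unfolding norm y(1) .
  qed
  then show False using no_collapse[of i j k] assms k by auto
qed

text \<open>The supports meet in \<open>c\<close> only, so each pairing between the two images is a
  single product, and orthogonality makes one of its factors vanish.\<close>

lemma overlap:
  assumes "bil x v = 1" "bil z w = 1" "bil x w = 0" "bil z v = 0"
    and c: "\<And>l. l \<noteq> c \<Longrightarrow> v $ l = 0 \<and> x $ l = 0 \<or> w $ l = 0 \<and> z $ l = 0"
  shows "col0 (\<Psi> (outer v x)) c \<or> row0 (\<Psi> (outer w z)) c"
    and "row0 (\<Psi> (outer v x)) c \<or> col0 (\<Psi> (outer w z)) c"
proof -
  obtain y \<eta> where y: "\<Psi> (outer v x) = outer y \<eta>" "bil \<eta> y = 1" by (rule image[OF assms(1)])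
  obtain u \<zeta> where u: "\<Psi> (outer w z) = outer u \<zeta>" "bil \<zeta> u = 1" by (rule image[OF assms(2)])
  have "y $ l = 0 \<and> \<eta> $ l = 0 \<or> u $ l = 0 \<and> \<zeta> $ l = 0" if "l \<noteq> c" for l
    using c[OF that] support[OF assms(1) y, of l] support[OF assms(2) u, of l] by blast
  then have "bil \<zeta> y = \<zeta> $ c * y $ c" "bil \<eta> u = \<eta> $ c * u $ c" by (intro bil_single; blast)+
  moreover have "bil \<zeta> y = 0 \<and> bil \<eta> u = 0" by (rule test[OF assms(1) y assms(2) u assms(3,4)])
  ultimately show "col0 (\<Psi> (outer v x)) c \<or> row0 (\<Psi> (outer w z)) c"
    "row0 (\<Psi> (outer v x)) c \<or> col0 (\<Psi> (outer w z)) c"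
    unfolding y(1) u(1) row0_outer[OF y(2)] col0_outer[OF y(2)] row0_outer[OF u(2)] col0_outer[OF u(2)]
    by auto
qed

text \<open>\<open>overlap\<close> gives an alternative for each pair of parameters. A parameter at
  which one pencil fails to have one type forces the other type on the whole second pencil, whose
  nonconstancy forces it back on the first.\<close>

lemma type_col:
  assumes "i \<noteq> j" "k \<noteq> j" "i \<noteq> k"
  shows "(\<forall>a. row0 (pencil i j a) j) \<and> (\<forall>a. row0 (pencil k j a) j) \<or>
    (\<forall>a. col0 (pencil i j a) j) \<and> (\<forall>a. col0 (pencil k j a) j)"
proof -
  have "col0 (pencil i j a) j \<or> row0 (pencil k j b) j" "row0 (pencil i j a) j \<or> col0 (pencil k j b) j" for a b
    by (rule overlap; use assms in auto)+
  then show ?thesis using pencil_nonconst[OF assms(1)] pencil_nonconst[OF assms(2)] by blast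
qed

text \<open>Pencils with the same first index are not orthogonal to each other, but their copencils
  are; the alternative is obtained there and translated back.\<close>

lemma type_row:
  assumes "i \<noteq> j" "i \<noteq> k" "j \<noteq> k"
  shows "(\<forall>a. row0 (pencil i j a) j) \<and> (\<forall>a. row0 (pencil i k a) k) \<or>
    (\<forall>a. col0 (pencil i j a) j) \<and> (\<forall>a. col0 (pencil i k a) k)"
proof -
  have "col0 (copencil i j a) i \<or> row0 (copencil i k b) i" "row0 (copencil i j a) i \<or> col0 (copencil i k b) i" for a b
    by (rule overlap; use assms in auto)+
  then have "row0 (pencil i j a) j \<or> col0 (pencil i k b) k" "col0 (pencil i j a) j \<or> row0 (pencil i k b) k" for a b
    unfolding copencil_row0_col0[OF assms(1)] copencil_row0_col0[OF assms(2)] by blast+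
  then show ?thesis using pencil_nonconst[OF assms(1)] pencil_nonconst[OF assms(2)] by blast
qed

lemma type_dichotomy:
  "(\<forall>i j a. i \<noteq> j \<longrightarrow> row0 (pencil i j a) j) \<or> (\<forall>i j a. i \<noteq> j \<longrightarrow> col0 (pencil i j a) j)"
proof -
  define f where "f = (\<lambda>i j. \<forall>a. row0 (pencil i j a) j)"
  have f: "f i j = f i' j'" if "i \<noteq> j" "i' \<noteq> j'" for i j i' j'
  proof (rule pairs_connected[OF card3 _ _ that])
    show "f i j = f k j" if "i \<noteq> j" "k \<noteq> j" "i \<noteq> k" for i j k
      unfolding f_def using type_col[OF that] pencil_nonconst[OF that(1)] pencil_nonconst[OF that(2)] by blast
    show "f i j = f i k" if "i \<noteq> j" "i \<noteq> k" "j \<noteq> k" for i j k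
      unfolding f_def using type_row[OF that] pencil_nonconst[OF that(1)] pencil_nonconst[OF that(2)] by blast
  qed
  show ?thesis
  proof (cases "\<exists>i j. i \<noteq> j \<and> f i j")
    case True
    then show ?thesis using f unfolding f_def by blast
  next
    case False
    have "\<forall>a. col0 (pencil i j a) j" if "i \<noteq> j" for i j
    proof -
      obtain k where "k \<noteq> i" "k \<noteq> j" using third_index[OF card3] by blast
      then show ?thesis using type_col[of i j k] False that unfolding f_def by blast
    qed
    then show ?thesis by blast
  qed
qed

end

section \<open>Continuous endomorphisms of the complex field\<close>

lemma additive_continuous_real_linear:
  fixes f :: "complex \<Rightarrow> complex"
  assumes add: "\<And>x y. f (x + y) = f x + f y" and cont: "continuous_on UNIV f"
  shows "f (complex_of_real r * z) = of_real r * f z"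
proof -
  have f0: "f 0 = 0" using add[of 0 0] by simp
  have fneg: "f (- x) = - f x" for x using add[of x "- x"] f0 by (simp add: add_eq_0_iff)
  have nat: "f (of_nat n * x) = of_nat n * f x" for n x
    by (induction n) (simp_all add: f0 add distrib_right)
  have int: "f (of_int k * x) = of_int k * f x" for k x
    by (cases k rule: int_cases2) (simp_all add: nat fneg)
  have rat: "f (of_real q * z) = of_real q * f z" if "q \<in> \<rat>" for q
  proof -
    obtain a b :: int where q: "q = of_int a / of_int b" "b > 0"
      by (rule Rats_cases'[OF \<open>q \<in> \<rat>\<close>]) blast
    have "of_int b * f (of_real q * z) = f (of_int b * (of_real q * z))" by (simp add: int)
    also have "of_int b * (of_real q * z) = of_int a * z" using q by simp
    also have "f \<dots> = of_int a * f z" by (rule int)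
    also have "of_int a * f z = of_int b * (of_real q * f z)" using q by simp
    finally show ?thesis using q(2) by (metis mult_left_cancel of_int_eq_0_iff less_irrefl)
  qed
  have "closed {r. f (complex_of_real r * z) = of_real r * f z}"
    by (intro closed_Collect_eq continuous_intros continuous_on_compose2[OF cont]) auto
  moreover have "closure \<rat> \<subseteq> {r. f (complex_of_real r * z) = of_real r * f z}"
    using calculation rat by (intro closure_minimal) auto
  ultimately show ?thesis using Rats_closure_real by auto
qed

lemma continuous_field_endomorphism:
  fixes f :: "complex \<Rightarrow> complex"
  assumes add: "\<And>x y. f (x + y) = f x + f y" and mult: "\<And>x y. f (x * y) = f x * f y"
    and one: "f 1 = 1" and cont: "continuous_on UNIV f"
  shows "f = id \<or> f = cnj"
proof -
  note lin = additive_continuous_real_linear[OF add cont]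
  have r: "f (of_real r) = of_real r" for r using lin[of r 1] one by simp
  have "f \<i> * f \<i> = -1" using mult[of \<i> \<i>] r[of "-1"] by simp
  then have "(f \<i> - \<i>) * (f \<i> + \<i>) = 0" by (simp add: algebra_simps)
  then have i: "f \<i> = \<i> \<or> f \<i> = - \<i>" by (simp add: eq_neg_iff_add_eq_0)
  have f: "f z = of_real (Re z) + of_real (Im z) * f \<i>" for z
    using add[of "of_real (Re z)" "of_real (Im z) * \<i>"] r lin[of "Im z" \<i>]
    by (metis complex_eq mult.commute)
  from i show ?thesis
  proof
    assume "f \<i> = \<i>"
    then have "f z = id z" for z by (subst f) (simp add: complex_eq_iff)
    then show ?thesis by blast
  next
    assume "f \<i> = - \<i>"
    then have "f z = cnj z" for z by (subst f) (simp add: complex_eq_iff)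
    then show ?thesis by blast
  qed
qed

section \<open>Row type: the coordinate functions of the pencils\<close>

locale row_type_rank1_map = normalized_rank1_map \<Psi> for \<Psi> :: "complex ^ 'n ^ 'n \<Rightarrow> complex ^ 'n ^ 'n" +
  assumes row_type: "\<And>i j a. i \<noteq> j \<Longrightarrow> row0 (pencil i j a) j"
begin

text \<open>The diagonal value is a convention that spares the image formula for rows a case
  distinction at the coordinate equal to 1.\<close>

definition entry :: "'n \<Rightarrow> 'n \<Rightarrow> complex \<Rightarrow> complex" where
  "entry i j a = (if i = j then a else pencil i j a $ i $ j)"

lemma pencil_eq:
  assumes "i \<noteq> j"
  shows "pencil i j a = outer (ax i) (ax i + entry i j a *s ax j)"
proof -
  obtain y \<eta> where y: "pencil i j a = outer y \<eta>" "bil \<eta> y = 1"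
    "\<forall>k. k \<noteq> i \<longrightarrow> k \<noteq> j \<longrightarrow> y $ k = 0 \<and> \<eta> $ k = 0" by (rule pencil_image[OF assms, of a])
  have "y $ j = 0" using row_type[OF assms, of a] unfolding y(1) row0_outer[OF y(2)] .
  then have z: "y $ k = 0" if "k \<noteq> i" for k using y(3) that by metis
  then have "\<eta> $ i * y $ i = 1" using y(2) bil_single[of i \<eta> y] by simp
  moreover have "entry i j a = y $ i * \<eta> $ j" using assms by (simp add: entry_def y(1))
  ultimately have "(outer y \<eta>) $ b $ c = outer (ax i) (ax i + entry i j a *s ax j) $ b $ c" for b c
    using z[of b] y(3)[rule_format, of c] assms
    by (cases "b = i"; cases "c = i"; cases "c = j") (simp_all add: mult.commute)
  then have "outer y \<eta> = outer (ax i) (ax i + entry i j a *s ax j)" unfolding matrix_eq_iff by blast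
  then show ?thesis unfolding y(1) .
qed

lemma copencil_eq:
  assumes "i \<noteq> j"
  shows "copencil i j a = outer (ax j - entry i j a *s ax i) (ax j)"
proof -
  have "copencil i j a = outer (ax i) (ax i) + outer (ax j) (ax j) - pencil i j a"
    using pencil_add_copencil[OF assms, of a] by (simp add: algebra_simps)
  also have "\<dots> = outer (ax j - entry i j a *s ax i) (ax j)"
    unfolding pencil_eq[OF assms] by (simp add: outer_simps)
  finally show ?thesis .
qed

lemma entry_zero: "entry i j 0 = 0"
  by (simp add: entry_def norm)

lemma row_image:
  assumes "\<xi> $ i = 1"
  shows "\<Psi> (outer (ax i) \<xi>) = outer (ax i) (\<chi> j. entry i j (\<xi> $ j))"
proof -
  have *: "bil \<xi> (ax i) = 1" using assms by simp
  obtain y \<eta> where y: "\<Psi> (outer (ax i) \<xi>) = outer y \<eta>" "bil \<eta> y = 1" by (rule image[OF *])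
  have t: "y $ j = 0" "\<eta> $ j = entry i j (\<xi> $ j) * \<eta> $ i" if "i \<noteq> j" for j
  proof -
    \<comment> \<open>The form \<xi> annihilates \<open>ax j - \<xi> $ j *s ax i\<close>, so this
      member of the copencil probes the \<open>j\<close>-th coordinate of the image.\<close>
    have "bil (ax j) y = 0 \<and> bil \<eta> (ax j - entry i j (\<xi> $ j) *s ax i) = 0"
      using that assms by (intro test[OF * y _ copencil_eq[OF that, of "\<xi> $ j"]]) auto
    then show "y $ j = 0" "\<eta> $ j = entry i j (\<xi> $ j) * \<eta> $ i" by simp_all
  qed
  then have i: "\<eta> $ i * y $ i = 1" using y(2) bil_single[of i \<eta> y] by auto
  have "outer y \<eta> $ b $ c = outer (ax i) (\<chi> j. entry i j (\<xi> $ j)) $ b $ c" for b c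
  proof (cases "b = i")
    case True
    then show ?thesis using t(2)[of c] i assms by (cases "c = i") (auto simp: entry_def mult_ac)
  qed (use t(1)[of b] in auto)
  then show ?thesis unfolding y(1) matrix_eq_iff by blast
qed

lemma col_image:
  assumes "v $ i = 1"
  shows "\<Psi> (outer v (ax i)) = outer (\<chi> j. if j = i then 1 else - entry j i (- (v $ j))) (ax i)"
proof -
  have *: "bil (ax i) v = 1" using assms by simp
  obtain y \<eta> where y: "\<Psi> (outer v (ax i)) = outer y \<eta>" "bil \<eta> y = 1" by (rule image[OF *])
  have t: "\<eta> $ j = 0" "y $ j = - entry j i (- (v $ j)) * y $ i" if "j \<noteq> i" for j
  proof -
    have "bil (ax j + entry j i (- (v $ j)) *s ax i) y = 0 \<and> bil \<eta> (ax j) = 0"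
      using that assms by (intro test[OF * y _ pencil_eq[OF that, of "- (v $ j)"]]) auto
    then show "\<eta> $ j = 0" "y $ j = - entry j i (- (v $ j)) * y $ i" by (simp_all add: add_eq_0_iff)
  qed
  then have i: "\<eta> $ i * y $ i = 1" using y(2) bil_single[of i \<eta> y] by auto
  have "outer y \<eta> $ b $ c = outer (\<chi> j. if j = i then 1 else - entry j i (- (v $ j))) (ax i) $ b $ c" for b c
  proof (cases "c = i")
    case True
    then show ?thesis using t(2)[of b] i by (cases "b = i") (auto simp: mult_ac)
  qed (use t(1)[of c] in auto)
  then show ?thesis unfolding y(1) matrix_eq_iff by blast
qed

lemma entry_fundamental:
  assumes "i \<noteq> j" "i \<noteq> k" "j \<noteq> k"
  shows "entry i j (p + q * r) = entry i j p - entry i k q * entry k j (- r)"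
proof -
  \<comment> \<open>The coordinate of \<open>?v\<close> along \<open>ax i\<close> is solved so that
    \<open>?\<xi>\<close> annihilates \<open>?v\<close>; the claim is the orthogonality of the
    images. The sign stays inside the last \<open>entry\<close> because additivity is only derived
    from this identity.\<close>
  let ?\<xi> = "ax i + p *s ax j + q *s ax k" and ?v = "ax j - (p + q * r) *s ax i + r *s ax k"
  have \<xi>: "?\<xi> $ i = 1" and v: "?v $ j = 1" using assms by auto
  let ?\<eta> = "\<chi> b. entry i b (?\<xi> $ b)"
  let ?y = "\<chi> b. if b = j then 1 else - entry b j (- (?v $ b))"
  have sum: "bil ?\<eta> ?y = (\<Sum>b\<in>{i, j, k}. ?\<eta> $ b * ?y $ b)"
    unfolding bil_def using assms by (intro sum.mono_neutral_right) (auto simp: entry_zero)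
  have "bil ?\<xi> ?v = 0" using assms by simp
  then have "\<Psi> (outer (ax i) ?\<xi>) ** \<Psi> (outer ?v (ax j)) = 0"
    using assms by (intro orth_outer) auto
  then have "outer (ax i) ?\<eta> ** outer ?y (ax j) = 0"
    unfolding row_image[OF \<xi>] col_image[OF v] .
  then have "cscale (bil ?\<eta> ?y) (outer (ax i) (ax j)) $ i $ j = 0"
    unfolding outer_mult by simp
  then have "bil ?\<eta> ?y = 0" by (simp del: bil_simps)
  then show ?thesis
    unfolding sum using assms by (simp add: entry_def algebra_simps)
qed

lemma entry_add: assumes "i \<noteq> j" shows "entry i j (p + q) = entry i j p + entry i j q"
proof -
  obtain k where "k \<noteq> i" "k \<noteq> j" using third_index[OF card3] by blast
  then show ?thesis using assms entry_fundamental[of i j k p q 1] entry_fundamental[of i j k 0 q 1] by (simp add: entry_zero)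
qed

lemma entry_mult:
  assumes "i \<noteq> j" "i \<noteq> k" "j \<noteq> k"
  shows "entry i j (q * r) = entry i k q * entry k j r"
  using entry_fundamental[OF assms, of 0 q r] entry_add[of k j r "- r"] assms by (simp add: entry_zero add_eq_0_iff)

text \<open>By \<open>entry_mult\<close> a zero would spread to all values
  \<open>entry i j a\<close> with a third index \<open>i\<close>, and that pencil would be
  constant.\<close>

lemma entry_one_nonzero:
  assumes "k \<noteq> j" shows "entry k j 1 \<noteq> 0"
proof
  assume 0: "entry k j 1 = 0"
  obtain i where i: "i \<noteq> k" "i \<noteq> j" using third_index[OF card3] by blast
  then have "entry i j a = 0" for a using entry_mult[of i j k a 1] 0 assms by simp
  then have "pencil i j a = \<Psi> (outer (ax i) (ax i))" for a
    using pencil_eq[OF i(2), of a] by (simp add: norm)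
  then show False using no_collapse[of i j k] i assms by auto
qed

definition \<tau> :: "complex \<Rightarrow> complex" where
  "\<tau> a = (let (i, j) = (SOME (i, j). i \<noteq> j) in entry i j a / entry i j 1)"

text \<open>\<open>entry_mult\<close> with one factor equal to 1 shows that the ratio
  \<open>entry i j a / entry i j 1\<close> survives a change of either index.\<close>

lemma entry_eq_\<tau>:
  assumes "i \<noteq> j"
  shows "entry i j a = \<tau> a * entry i j 1"
proof -
  obtain i0 j0 :: 'n where ij0: "(SOME (i, j). i \<noteq> j) = (i0, j0)" by fastforce
  have "\<exists>p :: 'n \<times> 'n. case p of (i, j) \<Rightarrow> i \<noteq> j" using assms by auto
  then have "case (SOME (i :: 'n, j). i \<noteq> j) of (i, j) \<Rightarrow> i \<noteq> j" by (rule someI_ex)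
  then have ne: "i0 \<noteq> j0" unfolding ij0 by simp
  have "entry i j a / entry i j 1 = entry i0 j0 a / entry i0 j0 1"
  proof (rule pairs_connected[where f = "\<lambda>i j. entry i j a / entry i j 1", OF card3 _ _ assms ne])
    show "entry i j a / entry i j 1 = entry k j a / entry k j 1" if "i \<noteq> j" "k \<noteq> j" "i \<noteq> k" for i j k
      using entry_mult[of i j k 1 a] entry_mult[of i j k 1 1] entry_one_nonzero that by simp
    show "entry i j a / entry i j 1 = entry i k a / entry i k 1" if "i \<noteq> j" "i \<noteq> k" "j \<noteq> k" for i j k
      using entry_mult[of i j k a 1] entry_mult[of i j k 1 1] entry_one_nonzero that by simp
  qed
  then have "\<tau> a = entry i j a / entry i j 1" by (simp add: \<tau>_def ij0)
  then show ?thesis using entry_one_nonzero[OF assms] by simp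
qed

lemma \<tau>_cases: "\<tau> = id \<or> \<tau> = cnj"
proof -
  obtain i j k :: 'n where d: "i \<noteq> j" "k \<noteq> i" "k \<noteq> j" using third_index[OF card3] by metis
  have \<tau>: "\<tau> a = entry i j a / entry i j 1" for a using entry_eq_\<tau>[OF d(1), of a] entry_one_nonzero[OF d(1)] by simp
  show ?thesis
  proof (rule continuous_field_endomorphism)
    show "\<tau> (x + y) = \<tau> x + \<tau> y" for x y by (simp add: \<tau> entry_add[OF d(1)] add_divide_distrib)
    show "\<tau> 1 = 1" using entry_one_nonzero[OF d(1)] by (simp add: \<tau>)
    show "\<tau> (x * y) = \<tau> x * \<tau> y" for x y
    proof -
      have "\<tau> (x * y) * entry i j 1 = \<tau> x * entry i k 1 * (\<tau> y * entry k j 1)"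
        using entry_mult[of i j k x y] d entry_eq_\<tau>[of i j "x * y"] entry_eq_\<tau>[of i k x] entry_eq_\<tau>[of k j y] by simp
      also have "\<dots> = \<tau> x * \<tau> y * entry i j 1" using entry_mult[of i j k 1 1] d by simp
      finally show ?thesis using entry_one_nonzero[OF d(1)] by simp
    qed
    have "continuous_on UNIV (\<lambda>a. pencil i j a)"
      by (rule continuous_on_compose2[OF cont]) (use d in \<open>auto intro!: continuous_intros\<close>)
    then have "continuous_on UNIV (\<lambda>a. pencil i j a $ i $ j)" by (intro continuous_intros)
    then have "continuous_on UNIV (\<lambda>a. pencil i j a $ i $ j / entry i j 1)"
      by (rule continuous_on_divide[OF _ continuous_on_const]) (use entry_one_nonzero[OF d(1)] in auto)
    moreover have "\<tau> = (\<lambda>a. pencil i j a $ i $ j / entry i j 1)"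
      unfolding fun_eq_iff \<tau> using d by (simp add: entry_def)
    ultimately show "continuous_on UNIV \<tau>" by simp
  qed
qed

text \<open>The values at 1 form a multiplicative cocycle on the index pairs, hence a coboundary
  based at \<open>o'\<close>.\<close>

lemma entry_one_cocycle:
  obtains d where "\<And>i. d i \<noteq> 0" "\<And>i j. i \<noteq> j \<Longrightarrow> entry i j 1 = d j / d i"
proof -
  fix o' :: 'n
  define d where "d = (\<lambda>i. if i = o' then 1 else entry o' i 1)"
  have c: "entry i j 1 = entry i k 1 * entry k j 1" if "i \<noteq> j" "i \<noteq> k" "j \<noteq> k" for i j k
    using entry_mult[OF that, of 1 1] by simp
  have "d i \<noteq> 0" for i using entry_one_nonzero by (auto simp: d_def)
  moreover have "entry i j 1 = d j / d i" if ij: "i \<noteq> j" for i j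
  proof -
    consider "i = o'" | "j = o'" "i \<noteq> o'" | "i \<noteq> o'" "j \<noteq> o'" by blast
    then show ?thesis
    proof cases
      case 2
      \<comment> \<open>The cocycle identity requires three different indices, so
        \<open>entry i o' 1\<close> and \<open>entry o' i 1\<close> are seen to be inverse to each
        other only through a third one.\<close>
      obtain k where k: "k \<noteq> i" "k \<noteq> o'" using third_index[OF card3] by blast
      have "entry k i 1 = entry k i 1 * entry i o' 1 * entry o' i 1"
        using c[of k i o'] c[of k o' i] 2 k by auto
      then show ?thesis using 2 entry_one_nonzero[of k i] entry_one_nonzero[of o' i] k by (simp add: d_def field_simps)
    qed (use ij c[of o' j i] entry_one_nonzero in \<open>auto simp: d_def\<close>)
  qed
  ultimately show thesis using that by blast
qed

end

section \<open>From coordinate rows and columns to all rank-one idempotents\<close>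

definition vmap :: "(complex \<Rightarrow> complex) \<Rightarrow> complex ^ 'n \<Rightarrow> complex ^ 'n" where
  "vmap \<tau> v = (\<chi> i. \<tau> (v $ i))"

definition mmap :: "(complex \<Rightarrow> complex) \<Rightarrow> complex ^ 'n ^ 'n \<Rightarrow> complex ^ 'n ^ 'n" where
  "mmap \<tau> A = (\<chi> i j. \<tau> (A $ i $ j))"

text \<open>Only one of \<omega> and \<xi> annihilates \<open>v\<close>, so they are linearly
  independent and have a nonzero 2 by 2 minor. Solving in these two coordinates leaves a third one
  zero, which opens \<open>outer w \<omega>\<close> to probes by coordinate columns.\<close>

lemma two_support_vector:
  fixes \<xi> :: "complex ^ 'n"
  assumes card: "CARD('n) \<ge> 3" and "bil \<xi> v = 1" "bil \<omega> v = 0" "\<omega> \<noteq> 0"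
  obtains w k where "bil \<xi> w = 0" "bil \<omega> w = 1" "w $ k = 0"
proof -
  have "\<exists>k l. \<omega> $ k * \<xi> $ l \<noteq> \<omega> $ l * \<xi> $ k"
  proof (rule ccontr)
    assume "\<not> ?thesis"
    then have *: "\<omega> $ k * \<xi> $ l = \<omega> $ l * \<xi> $ k" for k l by blast
    have "\<omega> $ k * bil \<xi> v = bil \<omega> v * \<xi> $ k" for k
      unfolding bil_def sum_distrib_left sum_distrib_right
    proof (rule sum.cong)
      show "\<omega> $ k * (\<xi> $ l * v $ l) = \<omega> $ l * v $ l * \<xi> $ k" for l
        using arg_cong[OF *[of k l], of "\<lambda>x. x * v $ l"] by (simp add: mult_ac)
    qed simp
    then show False using assms by (simp add: vec_eq_iff)
  qed
  then obtain k l where kl: "\<omega> $ k * \<xi> $ l - \<omega> $ l * \<xi> $ k \<noteq> 0" by auto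
  obtain m where m: "m \<noteq> k" "m \<noteq> l" using third_index[OF card] by blast
  define c where "c = \<omega> $ k * \<xi> $ l - \<omega> $ l * \<xi> $ k"
  define w :: "complex ^ 'n" where "w = (1 / c) *s (\<xi> $ l *s ax k - \<xi> $ k *s ax l)"
  have "bil \<xi> w = 0" by (simp add: w_def algebra_simps)
  moreover have "bil \<omega> w = 1" using kl by (simp add: w_def c_def[symmetric] mult.commute diff_divide_distrib[symmetric])
  moreover have "w $ m = 0" using m by (simp add: w_def)
  ultimately show thesis using that by blast
qed

locale standard_rank1_map = rank1_map \<Psi> for \<Psi> :: "complex ^ 'n ^ 'n \<Rightarrow> complex ^ 'n ^ 'n" +
  fixes \<tau> :: "complex \<Rightarrow> complex"
  assumes \<tau>_cases: "\<tau> = id \<or> \<tau> = cnj"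
    and row_std: "\<And>i \<xi>. \<xi> $ i = 1 \<Longrightarrow> \<Psi> (outer (ax i) \<xi>) = outer (ax i) (vmap \<tau> \<xi>)"
    and col_std: "\<And>i v. v $ i = 1 \<Longrightarrow> \<Psi> (outer v (ax i)) = outer (vmap \<tau> v) (ax i)"
begin

sublocale normalized_rank1_map \<Psi>
proof
  have "vmap \<tau> (ax i :: complex ^ 'n) = ax i" for i using \<tau>_cases by (auto simp: vmap_def vec_eq_iff)
  then show "\<Psi> (outer (ax i) (ax i)) = outer (ax i) (ax i)" for i by (simp add: row_std)
qed

lemma \<tau>_simps: "\<tau> (a + b) = \<tau> a + \<tau> b" "\<tau> (a - b) = \<tau> a - \<tau> b" "\<tau> (a * b) = \<tau> a * \<tau> b"
  "\<tau> 0 = 0" "\<tau> 1 = 1" "\<tau> (sum f S) = (\<Sum>x\<in>S. \<tau> (f x))"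
  using \<tau>_cases by auto

lemma vmap_simps: "vmap \<tau> (x + y) = vmap \<tau> x + vmap \<tau> y" "vmap \<tau> (x - y) = vmap \<tau> x - vmap \<tau> y"
  "vmap \<tau> (c *s x) = \<tau> c *s vmap \<tau> x" "bil (vmap \<tau> x) (vmap \<tau> y) = \<tau> (bil x y)"
  by (simp_all add: vec_eq_iff vmap_def \<tau>_simps bil_def)

lemma annihilator:
  fixes \<omega> \<eta> :: "complex ^ 'n"
  assumes "\<And>u. bil \<omega> u = 0 \<Longrightarrow> bil \<eta> (vmap \<tau> u) = 0" "bil \<omega> w = 1"
  shows "\<eta> = bil \<eta> (vmap \<tau> w) *s vmap \<tau> \<omega>"
proof -
  have "\<eta> $ i = bil \<eta> (vmap \<tau> w) * \<tau> (\<omega> $ i)" for i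
  proof -
    have "bil \<eta> (vmap \<tau> (ax i - \<omega> $ i *s w)) = 0" using assms by (intro assms(1)) simp
    moreover have "vmap \<tau> (ax i :: complex ^ 'n) = ax i" using \<tau>_simps by (simp add: vmap_def vec_eq_iff)
    ultimately show ?thesis by (simp add: vmap_simps mult.commute)
  qed
  then show ?thesis by (simp add: vec_eq_iff vmap_def)
qed

lemma image_of_vanishing_functional:
  assumes z: "bil \<zeta> z = 1" "\<zeta> $ k = 0" and y: "\<Psi> (outer z \<zeta>) = outer y \<eta>" "bil \<eta> y = 1"
    and \<omega>: "bil \<omega> z = 0"
  shows "bil (vmap \<tau> \<omega>) y = 0"
proof -
  have 1: "bil (vmap \<tau> \<omega>) y = 0" if "\<omega> $ k = 1" "bil \<omega> z = 0" for \<omega>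
  proof -
    have "\<tau> (\<omega> $ k) = 1" using that \<tau>_simps by simp
    then have "bil (vmap \<tau> \<omega>) y = 0 \<and> bil \<eta> (ax k) = 0"
      using that z by (intro test[OF z(1) y _ row_std[OF that(1)]]) (auto simp: vmap_def)
    then show ?thesis by simp
  qed
  have "\<exists>i. \<zeta> $ i * z $ i \<noteq> 0"
    using z(1) sum.neutral[of UNIV "\<lambda>i. \<zeta> $ i * z $ i"] unfolding bil_def by (metis zero_neq_one)
  then obtain i where i: "\<zeta> $ i \<noteq> 0" "z $ i \<noteq> 0" by auto
  with z have ik: "i \<noteq> k" by auto
  \<comment> \<open>A form that annihilates \<open>z\<close> and has \<open>k\<close>-th coordinate
    1. Adding it brings a form with vanishing \<open>k\<close>-th coordinate into the range of 1,
    and linearity removes it again.\<close>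
  let ?\<omega> = "ax k - (z $ k / z $ i) *s ax i"
  show ?thesis
  proof (cases "\<omega> $ k = 0")
    case True
    have "bil (vmap \<tau> ?\<omega>) y = 0" "bil (vmap \<tau> (?\<omega> + \<omega>)) y = 0"
      using True ik i \<omega> by (intro 1; simp)+
    then show ?thesis by (simp add: vmap_simps)
  next
    case False
    then have "bil (vmap \<tau> ((1 / \<omega> $ k) *s \<omega>)) y = 0" using \<omega> by (intro 1) auto
    moreover have "\<tau> (1 / \<omega> $ k) \<noteq> 0" using False \<tau>_cases by auto
    ultimately show ?thesis by (simp add: vmap_simps)
  qed
qed

lemma functional_of_vanishing_image:
  assumes z: "bil \<zeta> z = 1" "z $ k = 0" and y: "\<Psi> (outer z \<zeta>) = outer y \<eta>" "bil \<eta> y = 1"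
    and \<omega>: "bil \<zeta> \<omega> = 0"
  shows "bil \<eta> (vmap \<tau> \<omega>) = 0"
proof -
  have 1: "bil \<eta> (vmap \<tau> \<omega>) = 0" if "\<omega> $ k = 1" "bil \<zeta> \<omega> = 0" for \<omega>
  proof -
    have "\<tau> (\<omega> $ k) = 1" using that \<tau>_simps by simp
    then have "bil (ax k) y = 0 \<and> bil \<eta> (vmap \<tau> \<omega>) = 0"
      using that z by (intro test[OF z(1) y _ col_std[OF that(1)]]) (auto simp: vmap_def)
    then show ?thesis by simp
  qed
  have "\<exists>i. \<zeta> $ i * z $ i \<noteq> 0"
    using z(1) sum.neutral[of UNIV "\<lambda>i. \<zeta> $ i * z $ i"] unfolding bil_def by (metis zero_neq_one)
  then obtain i where i: "\<zeta> $ i \<noteq> 0" "z $ i \<noteq> 0" by auto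
  with z have ik: "i \<noteq> k" by auto
  let ?\<omega> = "ax k - (\<zeta> $ k / \<zeta> $ i) *s ax i"
  show ?thesis
  proof (cases "\<omega> $ k = 0")
    case True
    have "bil \<eta> (vmap \<tau> ?\<omega>) = 0" "bil \<eta> (vmap \<tau> (?\<omega> + \<omega>)) = 0"
      using True ik i \<omega> by (intro 1; simp)+
    then show ?thesis by (simp add: vmap_simps)
  next
    case False
    then have "bil \<eta> (vmap \<tau> ((1 / \<omega> $ k) *s \<omega>)) = 0" using \<omega> by (intro 1) auto
    moreover have "\<tau> (1 / \<omega> $ k) \<noteq> 0" using False \<tau>_cases by auto
    ultimately show ?thesis by (simp add: vmap_simps)
  qed
qed

text \<open>Probes need known images. If \<open>w\<close> has a zero coordinate, coordinate columns
  determine the form of the image of \<open>outer w \<omega>\<close> up to scaling, and such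
  idempotents suffice to locate \<open>y\<close>; dually for \<eta>.\<close>

lemma image_std:
  assumes v: "bil \<xi> v = 1"
  shows "\<Psi> (outer v \<xi>) = outer (vmap \<tau> v) (vmap \<tau> \<xi>)"
proof -
  obtain y \<eta> where y: "\<Psi> (outer v \<xi>) = outer y \<eta>" "bil \<eta> y = 1" by (rule image[OF v])
  have Y: "bil (vmap \<tau> \<omega>) y = 0" if \<omega>: "bil \<omega> v = 0" for \<omega>
  proof (cases "\<omega> = 0")
    case False
    obtain w k where w: "bil \<xi> w = 0" "bil \<omega> w = 1" "w $ k = 0"
      by (rule two_support_vector[OF card3 v \<omega> False])
    obtain z \<zeta> where z: "\<Psi> (outer w \<omega>) = outer z \<zeta>" "bil \<zeta> z = 1" by (rule image[OF w(2)])
    have "\<zeta> = bil \<zeta> (vmap \<tau> w) *s vmap \<tau> \<omega>"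
      by (rule annihilator) (use functional_of_vanishing_image[OF w(2,3) z] w in auto)
    moreover have "bil \<zeta> y = 0"
      using test[OF v y w(2) z] w \<omega> by simp
    moreover have "\<zeta> \<noteq> 0" using z by auto
    ultimately show ?thesis by (metis bil_simps(5) mult_eq_0_iff vec.scale_zero_left)
  qed (simp add: vmap_def bil_def \<tau>_simps)
  have H: "bil \<eta> (vmap \<tau> \<omega>) = 0" if \<omega>: "bil \<xi> \<omega> = 0" for \<omega>
  proof (cases "\<omega> = 0")
    case False
    obtain w k where w: "bil v w = 0" "bil \<omega> w = 1" "w $ k = 0"
      using two_support_vector[OF card3, of v \<xi> \<omega>] v \<omega> False by (metis bil_commute)
    then have w': "bil w \<omega> = 1" by (simp add: bil_commute)
    obtain z \<zeta> where z: "\<Psi> (outer \<omega> w) = outer z \<zeta>" "bil \<zeta> z = 1" by (rule image[OF w'])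
    have "z = bil z (vmap \<tau> w) *s vmap \<tau> \<omega>"
      using image_of_vanishing_functional[OF w' w(3) z]
      by (intro annihilator) (use w in \<open>auto simp: bil_commute\<close>)
    moreover have "bil \<eta> z = 0"
      using test[OF v y w' z] w \<omega> by (simp add: bil_commute)
    moreover have "z \<noteq> 0" using z by auto
    ultimately show ?thesis by (metis bil_simps(6) mult_eq_0_iff vec.scale_zero_left)
  qed (simp add: vmap_def bil_def \<tau>_simps)
  have "y = bil y (vmap \<tau> \<xi>) *s vmap \<tau> v"
    by (rule annihilator) (use Y v in \<open>auto simp: bil_commute\<close>)
  then obtain a where a: "y = a *s vmap \<tau> v" by blast
  have "\<eta> = bil \<eta> (vmap \<tau> v) *s vmap \<tau> \<xi>"
    by (rule annihilator) (use H v in auto)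
  then obtain b where b: "\<eta> = b *s vmap \<tau> \<xi>" by blast
  have "b * a = 1" using y(2) v by (simp add: a b vmap_simps \<tau>_simps mult.commute)
  then show ?thesis by (simp add: y a b outer_simps mult.commute)
qed

end

section \<open>Normalization and classification\<close>

lemma bil_vector_matrix: "bil (x v* A) w = bil x (A *v w)"
proof -
  have "bil (x v* A) w = (\<Sum>i\<in>UNIV. \<Sum>j\<in>UNIV. x $ j * (A $ j $ i * w $ i))"
    by (simp add: bil_def vector_matrix_mult_def sum_distrib_left sum_distrib_right mult_ac)
  also have "\<dots> = (\<Sum>j\<in>UNIV. \<Sum>i\<in>UNIV. x $ j * (A $ j $ i * w $ i))" by (rule sum.swap)
  also have "\<dots> = bil x (A *v w)"
    by (simp add: bil_def matrix_vector_mult_def sum_distrib_left)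
  finally show ?thesis .
qed

lemma rank1_idem_conj:
  assumes "inverse_pair P Q" "rank1_idem R"
  shows "rank1_idem (P ** R ** Q)"
proof -
  obtain v x where R: "bil x v = 1" "R = outer v x" using assms by (auto simp: rank1_idem_def)
  have "bil (x v* Q) (P *v v) = 1" using R assms(1) by (simp add: bil_vector_matrix inverse_pairD)
  then show ?thesis unfolding R(2) mult_outer outer_mult_matrix by (rule rank1_idem_outer)
qed

lemma rank1_idem_transpose: "rank1_idem R \<Longrightarrow> rank1_idem (mtransp R)"
  by (auto simp: rank1_idem_def transpose_outer) (metis bil_commute)

lemma rank1_map_conj:
  assumes "rank1_map \<Psi>" and PQ: "inverse_pair P Q"
  shows "rank1_map (\<lambda>R. P ** \<Psi> R ** Q)"
proof -
  interpret rank1_map \<Psi> by fact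
  have mult: "P ** A ** Q ** (P ** B ** Q) = P ** (A ** B) ** Q" for A B
    using PQ by (simp add: matrix_mul_assoc inverse_pairD)
  show ?thesis
  proof
    show "continuous_on {p. rank1_idem p} (\<lambda>R. P ** \<Psi> R ** Q)"
      by (intro continuous_intros cont)
    show "P ** \<Psi> p ** Q ** (P ** \<Psi> q ** Q) = 0"
      if "rank1_idem p" "rank1_idem q" "p ** q = 0" "q ** p = 0" for p q
      unfolding mult orth[OF that] by simp
    show "P ** \<Psi> p ** Q + P ** \<Psi> q ** Q = P ** \<Psi> p' ** Q + P ** \<Psi> q' ** Q"
      if "rank1_idem p" "rank1_idem q" "rank1_idem p'" "rank1_idem q'"
        "p ** q = 0" "q ** p = 0" "p' ** q' = 0" "q' ** p' = 0" "p + q = p' + q'" for p q p' q'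
      using sum2[OF that] by (metis matrix_add_ldistrib matrix_add_rdistrib')
  qed (use card3 rank1 rank1_idem_conj[OF PQ] in auto)
qed

lemma transpose_add: "mtransp (A + B) = mtransp A + mtransp B"
  by (simp add: matrix_eq_iff transpose_def)

lemma transpose_zero: "mtransp 0 = 0"
  by (simp add: matrix_eq_iff transpose_def)

lemma continuous_on_transpose [continuous_intros]:
  "continuous_on S f \<Longrightarrow> continuous_on S (\<lambda>x. mtransp (f x))"
  unfolding transpose_def by (intro continuous_on_vec_lambda continuous_intros)

lemma rank1_map_transpose:
  assumes "rank1_map \<Psi>"
  shows "rank1_map (\<lambda>R. mtransp (\<Psi> R))"
proof -
  interpret rank1_map \<Psi> by fact
  show ?thesis
  proof
    show "continuous_on {p. rank1_idem p} (\<lambda>R. mtransp (\<Psi> R))"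
      by (intro continuous_intros cont)
    show "mtransp (\<Psi> p) ** mtransp (\<Psi> q) = 0"
      if "rank1_idem p" "rank1_idem q" "p ** q = 0" "q ** p = 0" for p q
      unfolding matrix_transpose_mul[symmetric] orth[OF that(2,1,4,3)] by (rule transpose_zero)
    show "mtransp (\<Psi> p) + mtransp (\<Psi> q) = mtransp (\<Psi> p') + mtransp (\<Psi> q')"
      if "rank1_idem p" "rank1_idem q" "rank1_idem p'" "rank1_idem q'"
        "p ** q = 0" "q ** p = 0" "p' ** q' = 0" "q' ** p' = 0" "p + q = p' + q'" for p q p' q'
      using sum2[OF that] by (metis transpose_add)
  qed (use card3 rank1 rank1_idem_transpose in auto)
qed

text \<open>The images of the coordinate idempotents are pairwise orthogonal, so their vectors and
  forms are the columns and rows of an inverse pair.\<close>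

lemma (in rank1_map) normalize:
  obtains P Q where "inverse_pair P Q" "normalized_rank1_map (\<lambda>R. Q ** \<Psi> R ** P)"
proof -
  have "\<exists>y \<eta>. \<Psi> (outer (ax i) (ax i)) = outer y \<eta> \<and> bil \<eta> y = 1" for i
    using rank1[OF rank1_idem_outer[of "ax i" "ax i"]] unfolding rank1_idem_def by auto
  then obtain y \<eta> where y: "\<And>i. \<Psi> (outer (ax i) (ax i)) = outer (y i) (\<eta> i)" "\<And>i. bil (\<eta> i) (y i) = 1"
    by metis
  have ort: "bil (\<eta> i) (y j) = 0" if "i \<noteq> j" for i j
  proof -
    have "outer (y i) (\<eta> i) ** outer (y j) (\<eta> j) = 0"
      unfolding y(1)[symmetric] using that by (intro orth_outer) auto
    then have "cscale (bil (\<eta> i) (y j)) (outer (y i) (\<eta> j)) = 0" by (simp add: outer_mult)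
    moreover have "outer (y i) (\<eta> j) \<noteq> 0"
      using bil_nonzero[OF y(2)[of i]] bil_nonzero[OF y(2)[of j]] by (auto simp: matrix_eq_iff)
    ultimately show ?thesis by (metis cscale_cancel cscale_simps(3))
  qed
  define P :: "complex ^ 'n ^ 'n" where "P = (\<chi> a i. y i $ a)"
  define Q :: "complex ^ 'n ^ 'n" where "Q = (\<chi> i a. \<eta> i $ a)"
  have "Q ** P = mat 1"
    using y(2) ort unfolding matrix_eq_iff matrix_mult_nth by (auto simp: P_def Q_def mat_def bil_def)
  then have PQ: "inverse_pair P Q" using inverse_pairI inverse_pair_sym by blast
  have Ey: "outer (y i) (\<eta> i) = P ** outer (ax i) (ax i) ** Q" for i
    unfolding mult_outer outer_mult_matrix
    by (simp add: matrix_eq_iff P_def Q_def matrix_vector_mult_def vector_matrix_mult_def if_distrib if_distribR cong: if_cong)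
  have "rank1_map (\<lambda>R. Q ** \<Psi> R ** P)"
    using rank1_map_conj[OF rank1_map_axioms] PQ inverse_pair_sym by blast
  moreover have "Q ** \<Psi> (outer (ax i) (ax i)) ** P = outer (ax i) (ax i)" for i
    unfolding y(1) Ey using PQ by (simp add: matrix_mul_assoc inverse_pairD)
  ultimately have "normalized_rank1_map (\<lambda>R. Q ** \<Psi> R ** P)"
    by (intro normalized_rank1_map.intro normalized_rank1_map_axioms.intro)
  with PQ that show thesis by blast
qed

lemma mmap_outer: "\<tau> = id \<or> \<tau> = cnj \<Longrightarrow> mmap \<tau> (outer v x) = outer (vmap \<tau> v) (vmap \<tau> x)"
  by (auto simp: matrix_eq_iff mmap_def vmap_def)

lemma (in row_type_rank1_map) standardize:
  obtains P Q where "inverse_pair P Q" "\<And>R. rank1_idem R \<Longrightarrow> \<Psi> R = P ** mmap \<tau> R ** Q"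
proof -
  obtain d where d: "\<And>i. d i \<noteq> 0" "\<And>i j. i \<noteq> j \<Longrightarrow> entry i j 1 = d j / d i"
    by (rule entry_one_cocycle) blast
  \<comment> \<open>Conjugation by this diagonal matrix multiplies the entry at \<open>i\<close>,
    \<open>j\<close> by \<open>d i / d j\<close> and so cancels the coboundary
    \<open>entry i j 1\<close>.\<close>
  define Q where "Q = cdiag (\<chi> i. d i)"
  define P where "P = cdiag (\<chi> i. 1 / d i)"
  have PQ: "inverse_pair P Q"
    by (rule inverse_pairI) (simp add: P_def Q_def cdiag_mult matrix_eq_iff mat_def d)
  define \<Psi>' where "\<Psi>' = (\<lambda>R. Q ** \<Psi> R ** P)"
  have nth: "\<Psi>' R $ a $ b = d a * \<Psi> R $ a $ b / d b" for R a b
    by (simp add: \<Psi>'_def P_def Q_def)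
  have \<tau>: "\<tau> 0 = 0" "\<tau> 1 = 1" "\<tau> (- x) = - \<tau> x" for x using \<tau>_cases by auto
  have "rank1_map \<Psi>'"
    unfolding \<Psi>'_def using rank1_map_conj[OF rank1_map_axioms] PQ inverse_pair_sym by blast
  then interpret S: standard_rank1_map \<Psi>' \<tau>
  proof (intro standard_rank1_map.intro standard_rank1_map_axioms.intro)
    show "\<Psi>' (outer (ax i) \<xi>) = outer (ax i) (vmap \<tau> \<xi>)" if "\<xi> $ i = 1" for i \<xi>
    proof -
      have "d i * entry i b (\<xi> $ b) / d b = \<tau> (\<xi> $ b)" for b
        using that d entry_eq_\<tau>[of i b "\<xi> $ b"] \<tau> by (cases "i = b") (auto simp: entry_def)
      then show ?thesis
        unfolding matrix_eq_iff nth row_image[OF that] by (auto simp: vmap_def)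
    qed
    show "\<Psi>' (outer v (ax i)) = outer (vmap \<tau> v) (ax i)" if "v $ i = 1" for i v
    proof -
      have "d b * - entry b i (- (v $ b)) / d i = \<tau> (v $ b)" if "b \<noteq> i" for b
        using that d entry_eq_\<tau>[of b i "- (v $ b)"] \<tau> by simp
      then show ?thesis
        using that d \<tau> unfolding matrix_eq_iff nth col_image[OF that] by (auto simp: vmap_def)
    qed
  qed (auto simp: \<tau>_cases)
  have "\<Psi> R = P ** mmap \<tau> R ** Q" if "rank1_idem R" for R
  proof -
    have "\<Psi>' R = mmap \<tau> R"
      using that S.image_std \<tau>_cases by (auto simp: rank1_idem_def mmap_outer)
    then have "P ** mmap \<tau> R ** Q = P ** (Q ** \<Psi> R ** P) ** Q" by (simp add: \<Psi>'_def)
    then show ?thesis using PQ by (simp add: matrix_mul_assoc inverse_pairD)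
  qed
  with PQ that show thesis by blast
qed

lemma conjugation_alt: "conjugation \<alpha> \<longleftrightarrow> (\<exists>T T'. inverse_pair T T' \<and> \<alpha> = (\<lambda>A. T ** A ** T'))"
  unfolding conjugation_def inverse_pair_iff by auto

lemma transpose_conjugation_alt:
  "transpose_conjugation \<alpha> \<longleftrightarrow> (\<exists>T T'. inverse_pair T T' \<and> \<alpha> = (\<lambda>A. T ** mtransp A ** T'))"
  unfolding transpose_conjugation_def inverse_pair_iff by auto

theorem rank1_map_classification:
  assumes "rank1_map \<Psi>"
  obtains \<alpha> \<tau> where "conjugation \<alpha> \<or> transpose_conjugation \<alpha>" "\<tau> = id \<or> \<tau> = cnj"
    "\<And>R. rank1_idem R \<Longrightarrow> \<Psi> R = \<alpha> (mmap \<tau> R)"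
proof -
  obtain P Q where PQ: "inverse_pair P Q" and N: "normalized_rank1_map (\<lambda>R. Q ** \<Psi> R ** P)"
    by (rule rank1_map.normalize[OF assms])
  have conj_inv: "\<Psi> R = P ** (Q ** \<Psi> R ** P) ** Q" for R
    using PQ by (simp add: matrix_mul_assoc inverse_pairD)
  interpret N: normalized_rank1_map "\<lambda>R. Q ** \<Psi> R ** P" by fact
  from N.type_dichotomy show thesis
  proof
    assume "\<forall>i j a. i \<noteq> j \<longrightarrow> row0 (N.pencil i j a) j"
    then interpret R: row_type_rank1_map "\<lambda>R. Q ** \<Psi> R ** P" by unfold_locales blast
    obtain P' Q' where PQ': "inverse_pair P' Q'"
      and eq: "\<And>R. rank1_idem R \<Longrightarrow> Q ** \<Psi> R ** P = P' ** mmap R.\<tau> R ** Q'" by (rule R.standardize) blast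
    have "\<Psi> R = (P ** P') ** mmap R.\<tau> R ** (Q' ** Q)" if "rank1_idem R" for R
      by (subst conj_inv) (simp add: eq[OF that] matrix_mul_assoc)
    moreover have "conjugation (\<lambda>A. (P ** P') ** A ** (Q' ** Q))"
      using inverse_pair_mult[OF PQ PQ'] unfolding conjugation_alt by blast
    ultimately show thesis using that R.\<tau>_cases by blast
  next
    assume col: "\<forall>i j a. i \<noteq> j \<longrightarrow> col0 (N.pencil i j a) j"
    \<comment> \<open>Transposition exchanges \<open>row0\<close> and \<open>col0\<close> and
      reduces the column type to the row type.\<close>
    define \<Psi>t where "\<Psi>t = (\<lambda>R. mtransp (Q ** \<Psi> R ** P))"
    have "rank1_map \<Psi>t" unfolding \<Psi>t_def by (rule rank1_map_transpose[OF N.rank1_map_axioms])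
    then interpret T: rank1_map \<Psi>t .
    have nt: "\<Psi>t (outer (ax i) (ax i)) = outer (ax i) (ax i)" for i
      unfolding \<Psi>t_def N.norm by (rule transpose_outer)
    interpret T: normalized_rank1_map \<Psi>t by unfold_locales (rule nt)
    have rt: "row0 (T.pencil i j a) j" if "i \<noteq> j" for i j a
      using col that unfolding \<Psi>t_def row0_def col0_def by (simp add: transpose_def)
    interpret R: row_type_rank1_map \<Psi>t by unfold_locales (rule rt)
    obtain P' Q' where PQ': "inverse_pair P' Q'"
      and eq: "\<And>R. rank1_idem R \<Longrightarrow> \<Psi>t R = P' ** mmap R.\<tau> R ** Q'" by (rule R.standardize) blast
    have "\<Psi> R = (P ** mtransp Q') ** mtransp (mmap R.\<tau> R) ** (mtransp P' ** Q)" if "rank1_idem R" for R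
    proof -
      have "Q ** \<Psi> R ** P = mtransp (\<Psi>t R)" by (simp add: \<Psi>t_def)
      also have "\<dots> = mtransp Q' ** mtransp (mmap R.\<tau> R) ** mtransp P'"
        unfolding eq[OF that] matrix_transpose_mul by (simp add: matrix_mul_assoc)
      finally show ?thesis by (subst conj_inv) (simp add: matrix_mul_assoc)
    qed
    moreover have "transpose_conjugation (\<lambda>A. (P ** mtransp Q') ** mtransp A ** (mtransp P' ** Q))"
      using inverse_pair_mult[OF PQ inverse_pair_transpose[OF PQ']] unfolding transpose_conjugation_alt by blast
    ultimately show thesis using that R.\<tau>_cases by blast
  qed
qed

subsection \<open>Frames and configurations\<close>

lemma det_line_poly:
  fixes A B :: "complex ^ 'n ^ 'n"
  obtains p where "\<And>z. poly p z = det (A + cscale z B)"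
proof
  fix z :: complex
  let ?M = "\<chi> i j. [:A $ i $ j, B $ i $ j:] :: complex poly ^ 'n ^ 'n"
  have "poly (of_int k) z = of_int k" for k and z :: complex
    by (simp add: of_int_poly)
  then show "poly (det ?M) z = det (A + cscale z B)"
    by (simp add: det_def poly_sum poly_prod)
qed

text \<open>On the complex line through \<open>A\<close> and \<open>B\<close> singularity is a
  polynomial condition that excludes finitely many parameters, and the plane without a finite set is
  connected.\<close>

lemma connected_GL: "connected {P :: complex ^ 'n ^ 'n. invertible P}"
proof (subst connected_iff_connected_component, unfold connected_component_def, clarify)
  fix A B :: "complex ^ 'n ^ 'n"
  assume AB: "invertible A" "invertible B"
  obtain p where p: "\<And>z. poly p z = det (A + cscale z (B - A))" 
    by (rule det_line_poly[of A "B - A"]) blast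
  have "poly p 0 \<noteq> 0" "poly p 1 \<noteq> 0" using AB by (simp_all add: p invertible_det_nz)
  then have "finite {z. poly p z = 0}" by (intro poly_roots_finite) auto
  then have "connected (- {z. poly p z = 0})"
    by (intro path_connected_imp_connected path_connected_complement_countable countable_finite) simp_all
  moreover have "continuous_on (- {z. poly p z = 0}) (\<lambda>z. A + cscale z (B - A))"
    unfolding cscale_def by (intro continuous_intros continuous_on_vec_lambda)
  ultimately have "connected ((\<lambda>z. A + cscale z (B - A)) ` (- {z. poly p z = 0}))"
    by (rule connected_continuous_image[rotated])
  moreover have "A \<in> (\<lambda>z. A + cscale z (B - A)) ` (- {z. poly p z = 0})"
    using \<open>poly p 0 \<noteq> 0\<close> by (intro image_eqI[of _ _ 0]) auto
  moreover have "B \<in> (\<lambda>z. A + cscale z (B - A)) ` (- {z. poly p z = 0})"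
    using \<open>poly p 1 \<noteq> 0\<close> by (intro image_eqI[of _ _ 1]) auto
  ultimately show "\<exists>T. connected T \<and> T \<subseteq> {P. invertible P} \<and> A \<in> T \<and> B \<in> T"
    by (intro exI[of _ "(\<lambda>z. A + cscale z (B - A)) ` (- {z. poly p z = 0})"]) (auto simp: p invertible_det_nz)
qed

lemma continuous_on_det:
  fixes f :: "'a::topological_space \<Rightarrow> complex ^ 'n ^ 'n"
  shows "continuous_on S f \<Longrightarrow> continuous_on S (\<lambda>x. det (f x))"
  unfolding det_def by (intro continuous_intros)

text \<open>Cramer's rule writes the entries of the inverse as quotients of determinants.\<close>

lemma continuous_on_matrix_inv:
  "continuous_on {P :: complex ^ 'n ^ 'n. invertible P} matrix_inv"
proof -
  let ?f = "\<lambda>A :: complex ^ 'n ^ 'n. \<chi> k j. det (\<chi> a b. if b = k then ax j $ a else A $ a $ b) / det A"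
  have "?f A = matrix_inv A" if "invertible A" for A
  proof -
    have "A *v (matrix_inv A *v ax j) = ax j" for j
      using inverse_pairD(7)[OF inverse_pair_matrix_inv[OF that]] .
    then have c: "matrix_inv A *v ax j = (\<chi> k. det (\<chi> a b. if b = k then ax j $ a else A $ a $ b) / det A)" for j
      using that by (subst (asm) cramer) (auto simp: invertible_det_nz)
    have "matrix_inv A $ k $ j = (matrix_inv A *v ax j) $ k" for k j
      by (simp add: matrix_vector_mult_def if_distrib cong: if_cong)
    then show ?thesis by (simp add: matrix_eq_iff c del: ax_nth)
  qed
  moreover have "continuous_on {P. invertible P} ?f"
  proof (intro continuous_on_vec_lambda continuous_on_divide continuous_on_det)
    show "continuous_on {P. invertible P} (\<lambda>A. if b = k then ax j $ a else (A :: complex ^ 'n ^ 'n) $ a $ b)" for a b j k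
      by (cases "b = k") (auto intro!: continuous_intros)
  qed (auto intro!: continuous_intros simp: invertible_det_nz)
  ultimately show ?thesis
    by (subst continuous_on_cong[of _ _ _ ?f]) auto
qed

text \<open>Newton's product evaluated at an operator; it serves both for spectral projections and
  for interpolation.\<close>

primrec lprod :: "complex ^ 'n ^ 'n \<Rightarrow> (nat \<Rightarrow> complex) \<Rightarrow> nat \<Rightarrow> complex ^ 'n ^ 'n" where
  "lprod A z 0 = mat 1"
| "lprod A z (Suc k) = lprod A z k ** (A - mat (z k))"

lemma lprod_diagop:
  assumes "inverse_pair P Q"
  shows "lprod (diagop P Q d) z k = diagop P Q (\<chi> i. \<Prod>l<k. d $ i - z l)"
proof (induction k)
  case 0
  then show ?case using diagop_const[OF assms, of 1] by simp
next
  case (Suc k)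
  have "diagop P Q d - mat (z k) = diagop P Q (d - (\<chi> i. z k))"
    by (simp add: diagop_diff diagop_const[OF assms])
  then show ?case
    using Suc by (simp add: diagop_mult[OF assms]) (simp add: times_vec_def)
qed

lemma tendsto_mat:
  "(f \<longlongrightarrow> c) F \<Longrightarrow> ((\<lambda>x. mat (f x) :: complex ^ 'n ^ 'n) \<longlongrightarrow> mat c) F"
  unfolding mat_def by (intro tendsto_vec_lambda) auto

lemma tendsto_lprod:
  fixes f :: "'a \<Rightarrow> complex ^ 'n ^ 'n"
  assumes "(f \<longlongrightarrow> A) F" "\<And>l. l < k \<Longrightarrow> ((\<lambda>x. z x l) \<longlongrightarrow> w l) F"
  shows "((\<lambda>x. lprod (f x) (z x) k) \<longlongrightarrow> lprod A w k) F"
  using assms(2) by (induction k) (auto intro!: tendsto_intros tendsto_mat assms(1))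

lemma continuous_on_lprod:
  fixes f :: "'a::topological_space \<Rightarrow> complex ^ 'n ^ 'n"
  shows "continuous_on S f \<Longrightarrow> continuous_on S (\<lambda>x. lprod (f x) z k)"
  unfolding continuous_on_def by (auto intro!: tendsto_lprod)

lemma continuous_on_trace:
  fixes f :: "'a::topological_space \<Rightarrow> complex ^ 'n ^ 'n"
  shows "continuous_on S f \<Longrightarrow> continuous_on S (\<lambda>x. trace (f x))"
  unfolding trace_def by (intro continuous_intros)

lemma trace_conj: "inverse_pair P Q \<Longrightarrow> trace (P ** A ** Q) = trace (A :: complex ^ 'n ^ 'n)"
  using trace_mul_sym[of "P ** A" Q] by (simp add: matrix_mul_assoc inverse_pairD)

lemma trace_diagop: "inverse_pair P Q \<Longrightarrow> trace (diagop P Q d) = (\<Sum>i\<in>UNIV. d $ i)"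
  unfolding diagop_def by (simp add: trace_conj) (simp add: trace_def)

lemma continuous_on_diagop [continuous_intros]:
  fixes f g :: "'a::topological_space \<Rightarrow> complex ^ 'n ^ 'n"
  assumes "continuous_on S f" "continuous_on S g" "continuous_on S d"
  shows "continuous_on S (\<lambda>x. diagop (f x) (g x) (d x))"
proof -
  have "continuous_on S (\<lambda>x. cdiag (d x))"
    unfolding cdiag_def
  proof (intro continuous_on_vec_lambda)
    show "continuous_on S (\<lambda>x. if i = j then d x $ i else 0)" for i j
      using assms(3) by (cases "i = j") (auto intro!: continuous_intros)
  qed
  then show ?thesis unfolding diagop_def using assms by (intro continuous_intros)
qed

section \<open>The permutation action on configurations\<close>

lemma act_nth [simp]: "(x \<lhd>\<lhd> \<theta>) $ i = x $ \<theta> i"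
  by (simp add: act_def)

lemma act_act: "x \<lhd>\<lhd> \<theta> \<lhd>\<lhd> \<rho> = x \<lhd>\<lhd> (\<theta> \<circ> \<rho>)"
  by (simp add: vec_eq_iff)

lemma act_id [simp]: "x \<lhd>\<lhd> id = x"
  by (simp add: vec_eq_iff)

lemma config_inj: "x \<in> config X \<Longrightarrow> x $ i = x $ j \<longleftrightarrow> i = j"
  by (auto simp: config_def)

lemma config_act_inject: "x \<in> config X \<Longrightarrow> x \<lhd>\<lhd> \<theta> = x \<lhd>\<lhd> \<rho> \<Longrightarrow> \<theta> = \<rho>"
  by (auto simp: vec_eq_iff config_inj fun_eq_iff)

lemma tuples_act: "x \<in> tuples X \<Longrightarrow> x \<lhd>\<lhd> \<theta> \<in> tuples X"
  by (simp add: tuples_def)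

lemma config_tuples: "x \<in> config X \<Longrightarrow> x \<in> tuples X"
  by (simp add: config_def)

lemma continuous_on_act: "continuous_on S f \<Longrightarrow> continuous_on S (\<lambda>x. f x \<lhd>\<lhd> \<theta>)"
  unfolding act_def by (intro continuous_on_vec_lambda continuous_intros)

text \<open>Permuting the eigenvalues amounts to reordering the columns of the frame, in a way
  independent of the eigenvalues.\<close>

lemma diagop_permute:
  assumes \<theta>: "\<theta> permutes UNIV" and P: "inverse_pair P P'"
  obtains R R' where "inverse_pair R R'" "\<And>x. diagop P P' (x \<lhd>\<lhd> \<theta>) = diagop R R' x"
proof
  let ?R = "(\<chi> a i. P $ a $ inv \<theta> i)" and ?R' = "\<chi> i b. P' $ inv \<theta> i $ b"
  have bij: "bij \<theta>" using \<theta> permutes_bij by blast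
  have re: "(\<Sum>k\<in>UNIV. f k) = (\<Sum>i\<in>UNIV. f (inv \<theta> i))" for f :: "'a \<Rightarrow> complex"
    by (rule sum.reindex_bij_betw[symmetric]) (simp add: bij bij_imp_bij_inv)
  show "diagop P P' (x \<lhd>\<lhd> \<theta>) = diagop ?R ?R' x" for x
    unfolding matrix_eq_iff diagop_nth
    by (subst re) (simp add: surj_f_inv_f bij bij_is_surj)
  show "inverse_pair ?R ?R'"
  proof (rule inverse_pairI)
    have "(?R ** ?R') $ a $ b = (\<Sum>k\<in>UNIV. P $ a $ k * P' $ k $ b)" for a b
      unfolding matrix_mult_nth by (subst (2) re) simp
    then show "?R ** ?R' = mat 1"
      unfolding matrix_eq_iff inverse_pair_nth(1)[OF P] by (simp add: mat_def)
  qed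
qed

lemma connected_coordinate_permutation:
  fixes \<mu> :: "complex ^ 'n \<Rightarrow> complex ^ 'n"
  assumes C: "connected C" "C \<subseteq> config X" and cont: "continuous_on C \<mu>"
    and range: "\<And>x. x \<in> C \<Longrightarrow> range (($) (\<mu> x)) = range (($) x)" and x0: "x0 \<in> C"
  obtains \<pi> where "\<pi> permutes UNIV" "\<And>x. x \<in> C \<Longrightarrow> \<mu> x = x \<lhd>\<lhd> \<pi>"
proof -
  have sel: "\<exists>k. \<mu> x $ i = x $ k" if "x \<in> C" for x i
    using range[OF that] by (metis rangeI rangeE)
  then obtain \<pi> where \<pi>: "\<And>i. \<mu> x0 $ i = x0 $ \<pi> i" using x0 by metis
  have eq: "\<mu> x $ i = x $ \<pi> i" if x: "x \<in> C" for x i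
  proof -
    \<comment> \<open>\<open>\<mu> x $ i\<close> is always a coordinate of \<open>x\<close>, and
      these are distinct; hence the complement of \<open>U\<close> is the zero set of the remaining
      factors and closed as well.\<close>
    define U where "U = {x \<in> C. \<mu> x $ i - x $ \<pi> i = 0}"
    define V where "V = {x \<in> C. (\<Prod>k\<in>-{\<pi> i}. \<mu> x $ i - x $ k) = 0}"
    have "closedin (top_of_set C) U" "closedin (top_of_set C) V"
      unfolding U_def V_def
      by (intro continuous_closedin_preimage_constant continuous_intros cont)+
    moreover have "U = C - V"
    proof -
      have "y \<in> V \<longleftrightarrow> y \<notin> U" if y: "y \<in> C" for y
      proof -
        obtain k where "\<mu> y $ i = y $ k" using sel[OF y] by blast
        moreover have "y $ k = y $ l \<longleftrightarrow> k = l" for k l using config_inj y C(2) by blast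
        ultimately show ?thesis using y by (auto simp: U_def V_def)
      qed
      then show ?thesis by (auto simp: U_def)
    qed
    ultimately have "U = {} \<or> U = C"
      using C(1)[unfolded connected_clopen] by (metis openin_diff openin_subtopology_self)
    moreover have "x0 \<in> U" using x0 \<pi> by (simp add: U_def)
    ultimately show ?thesis using x by (auto simp: U_def)
  qed
  have "surj \<pi>"
    unfolding surj_def
  proof
    fix k
    have "x0 $ k \<in> range (($) (\<mu> x0))" using range[OF x0] by auto
    then obtain i where "x0 $ k = x0 $ \<pi> i" using \<pi> by auto
    then show "\<exists>i. k = \<pi> i" using x0 C config_inj by (metis subsetD)
  qed
  then have "bij \<pi>" by (simp add: bij_def finite_UNIV_surj_inj)
  then have "\<pi> permutes UNIV" by (intro bij_imp_permutes) auto
  with eq that show thesis by (simp add: vec_eq_iff)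
qed

lemma eq_on_closure:
  fixes F G :: "complex ^ 'n \<Rightarrow> 'b::t2_space"
  assumes "continuous_on S F" "continuous_on S G" "D \<subseteq> S" "\<And>x. x \<in> D \<Longrightarrow> F x = G x"
    and "y \<in> S" "y \<in> closure D"
  shows "F y = G y"
proof -
  obtain x where x: "\<And>n. x n \<in> D" "x \<longlonglongrightarrow> y" using assms(6) closure_sequential by blast
  then have S: "\<And>n. x n \<in> S" using assms(3) by blast
  have "(\<lambda>n. F (x n)) \<longlonglongrightarrow> F y" "(\<lambda>n. G (x n)) \<longlonglongrightarrow> G y"
    using assms(1,2,5) x S by (auto intro: continuous_on_tendsto_compose)
  then show ?thesis using LIMSEQ_unique assms(4)[OF x(1)] by simp
qed

lemma closure_of_tuplesD:
  "y \<in> top_of_set S closure_of C \<Longrightarrow> y \<in> closure (C :: (complex ^ 'n) set)"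
  by (auto simp: closure_of_subtopology intro: subsetD[OF closure_mono])

text \<open>Coordinates are chosen one by one: each ball contains infinitely many points of
  \<open>X\<close>, of which only finitely many are taken.\<close>

lemma perfect_dense_config:
  assumes "perfect_space X" "x \<in> tuples X"
  shows "x \<in> closure (config X :: (complex ^ 'n) set)"
  unfolding closure_approachable
proof safe
  fix e :: real assume e: "e > 0"
  define \<delta> where "\<delta> = e / (2 * CARD('n))"
  have \<delta>: "\<delta> > 0" using e by (simp add: \<delta>_def)
  have inf: "infinite (X \<inter> ball (x $ i) \<delta>)" for i
  proof -
    have "x $ i islimpt X"
      using assms by (auto simp: perfect_space_def tuples_def islimpt_in_closure)
    then show ?thesis using \<delta> by (auto simp: islimpt_eq_infinite_ball)
  qed
  have "\<exists>g. inj_on g S \<and> (\<forall>i\<in>S. g i \<in> X \<inter> ball (x $ i) \<delta>)" if "finite S" for S :: "'n set"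
    using that
  proof (induction S)
    case (insert i S)
    then obtain g where g: "inj_on g S" "\<forall>i\<in>S. g i \<in> X \<inter> ball (x $ i) \<delta>" by blast
    have "infinite (X \<inter> ball (x $ i) \<delta> - g ` S)" using inf insert.hyps(1) by simp
    then obtain w where w: "w \<in> X \<inter> ball (x $ i) \<delta>" "w \<notin> g ` S" by (metis DiffD1 DiffD2 finite.emptyI equals0I)
    have "inj_on (g(i := w)) (insert i S)" using g(1) w insert.hyps(2) by (auto simp: inj_on_def)
    moreover have "\<forall>j\<in>insert i S. (g(i := w)) j \<in> X \<inter> ball (x $ j) \<delta>" using g(2) w by auto
    ultimately show ?case by blast
  qed simp
  then obtain g where g: "inj g" "\<And>i. g i \<in> X \<inter> ball (x $ i) \<delta>" by (metis UNIV_I finite)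
  define y where "y = (\<chi> i. g i)"
  have "y \<in> config X" using g by (auto simp: y_def config_def tuples_def inj_eq)
  moreover have "dist y x < e"
  proof -
    have "norm (y - x) \<le> (\<Sum>i\<in>UNIV. norm ((y - x) $ i))" by (simp add: norm_vec_def L2_set_le_sum)
    also have "\<dots> \<le> (\<Sum>i\<in>(UNIV::'n set). \<delta>)"
      using g(2) by (intro sum_mono) (auto simp: y_def dist_norm norm_minus_commute less_imp_le)
    also have "\<dots> < e" using e by (simp add: \<delta>_def)
    finally show ?thesis by (simp add: dist_norm)
  qed
  ultimately show "\<exists>y\<in>config X. dist y x < e" by blast
qed

subsection \<open>Monodromy of a continuous preserver\<close>

abbreviation transposition :: "'a \<Rightarrow> 'a \<Rightarrow> 'a \<Rightarrow> 'a" where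
  "transposition \<equiv> Transposition.transpose"

text \<open>Transpositions are conjugate, so if \<psi> kills one of them it kills all and is
  trivial, which the fixed \<open>\<theta>0\<close> forbids. Otherwise it fixes the transpositions
  along the cycle, and these generate the group.\<close>

lemma symmetric_group_endomorphism_id:
  fixes \<psi> :: "('n::finite \<Rightarrow> 'n) \<Rightarrow> 'n \<Rightarrow> 'n"
  assumes card: "CARD('n) \<ge> 3"
    and perm: "\<And>\<theta>. \<theta> permutes UNIV \<Longrightarrow> \<psi> \<theta> permutes UNIV"
    and hom: "\<And>\<theta> \<rho>. \<theta> permutes UNIV \<Longrightarrow> \<rho> permutes UNIV \<Longrightarrow> \<psi> (\<theta> \<circ> \<rho>) = \<psi> \<theta> \<circ> \<psi> \<rho>"
    and cycle: "has_cycle_of_length E CARD('n)"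
    and edge: "\<And>i j. {i, j} \<in> E \<Longrightarrow> \<psi> (transposition i j) = id \<or> \<psi> (transposition i j) = transposition i j"
    and fixed: "\<theta>0 permutes UNIV" "\<psi> \<theta>0 = \<theta>0" "\<theta>0 \<noteq> id"
    and \<theta>: "\<theta> permutes UNIV"
  shows "\<psi> \<theta> = \<theta>"
proof -
  have tp: "transposition i j permutes UNIV" for i j :: 'n by (simp add: permutes_swap_id)
  have \<psi>id: "\<psi> id = id"
  proof -
    have "\<psi> id \<circ> \<psi> id = \<psi> id" using hom[of id id] by (simp add: permutes_id)
    then have "inv (\<psi> id) \<circ> (\<psi> id \<circ> \<psi> id) = inv (\<psi> id) \<circ> \<psi> id" by simp
    then show ?thesis
      using permutes_inv_o(2)[OF perm[OF permutes_id]] by (simp add: o_assoc)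
  qed
  have tri: "transposition a b = transposition a c \<circ> transposition b c \<circ> transposition a c"
    if "a \<noteq> b" "a \<noteq> c" "b \<noteq> c" for a b c :: 'n
    using transpose_comp_triple[of a b c] that by (simp add: transpose_commute[of c b])
  have triple: "\<psi> (transposition a b) = \<psi> (transposition a c) \<circ> \<psi> (transposition b c) \<circ> \<psi> (transposition a c)"
    if "a \<noteq> b" "a \<noteq> c" "b \<noteq> c" for a b c
  proof -
    note tri[OF that]
    then show ?thesis
      using hom[OF tp[of a c] tp[of b c]] hom[OF permutes_compose[OF tp[of b c] tp[of a c]] tp[of a c]] by simp
  qed
  have invol: "\<psi> (transposition a b) \<circ> \<psi> (transposition a b) = id" for a b
    using hom[OF tp tp, of a b a b] \<psi>id by simp
  have generate: "\<psi> \<rho> = \<rho>" if "\<And>a b. a \<noteq> b \<Longrightarrow> \<psi> (transposition a b) = transposition a b" "\<rho> permutes UNIV" for \<rho>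
    using that(2) finite[of UNIV]
  proof (induction rule: permutes_induct)
    case (swap a b p)
    then show ?case by (metis hom tp that(1))
  qed (rule \<psi>id)
  have "\<psi> (transposition i j) \<noteq> id" if ij: "i \<noteq> j" for i j
  proof
    assume tr: "\<psi> (transposition i j) = id"
    have step: "\<psi> (transposition i k) = id \<longleftrightarrow> \<psi> (transposition i j) = id" if "i \<noteq> j" "i \<noteq> k" "j \<noteq> k" for i j k
    proof -
      have "\<psi> (transposition i k) = id" if "\<psi> (transposition i j) = id" "i \<noteq> j" "i \<noteq> k" "j \<noteq> k" for i j k
        using triple[of k i j] that invol[of k j] by (simp add: transpose_commute[of k i])
      then show ?thesis using that by metis
    qed
    have all: "\<psi> (transposition a b) = id" if "a \<noteq> b" for a b
    proof -
      have "(\<psi> (transposition i j) = id) = (\<psi> (transposition a b) = id)"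
      proof (rule pairs_connected[where f = "\<lambda>i j. \<psi> (transposition i j) = id", OF card _ _ ij that])
        show "(\<psi> (transposition i j) = id) = (\<psi> (transposition k j) = id)" if "i \<noteq> j" "k \<noteq> j" "i \<noteq> k" for i j k
          using step[of j i k] that by (simp add: transpose_commute)
        show "(\<psi> (transposition i j) = id) = (\<psi> (transposition i k) = id)" if "i \<noteq> j" "i \<noteq> k" "j \<noteq> k" for i j k
          using step[of i j k] that by simp
      qed
      with tr show ?thesis by simp
    qed
    have "\<psi> \<rho> = id" if "\<rho> permutes UNIV" for \<rho>
      using that finite[of UNIV]
    proof (induction rule: permutes_induct)
      case (swap a b p)
      then show ?case by (metis all comp_id hom tp)
    qed (rule \<psi>id)
    with fixed show False by auto
  qed
  with edge have edge': "\<psi> (transposition i j) = transposition i j" if "{i, j} \<in> E" for i j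
    using that by (cases "i = j") (auto simp: \<psi>id)
  obtain vs where vs: "length vs = CARD('n)" "distinct vs"
    "\<And>k. k < CARD('n) \<Longrightarrow> {vs ! k, vs ! (Suc k mod CARD('n))} \<in> E"
    using cycle by (auto simp: has_cycle_of_length_def)
  let ?o = "vs ! 0"
  \<comment> \<open>Walking along the cycle, \<open>transposition ?o (vs ! Suc k)\<close> is the
    conjugate of an edge transposition by the one settled before.\<close>
  have base: "\<psi> (transposition ?o (vs ! k)) = transposition ?o (vs ! k)" if "k < CARD('n)" for k
    using that
  proof (induction k)
    case (Suc k)
    then have e: "\<psi> (transposition (vs ! k) (vs ! Suc k)) = transposition (vs ! k) (vs ! Suc k)"
      using edge' vs(3)[of k] by (metis Suc_lessD mod_less)
    show ?case
    proof (cases "k = 0")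
      case False
      then have ne: "?o \<noteq> vs ! Suc k" "?o \<noteq> vs ! k" "vs ! Suc k \<noteq> vs ! k"
        using Suc.prems vs(1,2) by (simp_all add: nth_eq_iff_index_eq)
      show ?thesis
        using triple[OF ne] tri[OF ne] Suc e by (metis Suc_lessD transpose_commute)
    qed (use e in simp)
  qed (simp add: \<psi>id)
  have "set vs = UNIV" using vs(1,2) by (metis card_eq_UNIV_imp_eq_UNIV distinct_card finite)
  then have "\<exists>k < CARD('n). a = vs ! k" for a using vs(1) by (metis UNIV_I in_set_conv_nth)
  then have o: "\<psi> (transposition ?o a) = transposition ?o a" for a using base by metis
  have "\<psi> (transposition a b) = transposition a b" for a b
  proof (cases "a = b \<or> a = ?o \<or> b = ?o")
    case False
    then have ne: "a \<noteq> b" "a \<noteq> ?o" "b \<noteq> ?o" by auto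
    show ?thesis
      using triple[OF ne] tri[OF ne] o by (metis transpose_commute)
  qed (use o in \<open>auto simp: \<psi>id transpose_commute[of _ ?o]\<close>)
  with generate \<theta> show ?thesis by blast
qed

locale cs_preserver =
  fixes X :: "complex set" and \<phi> :: "complex ^ 'n ^ 'n \<Rightarrow> complex ^ 'n ^ 'n"
  assumes cont: "continuous_on (ss_with_spectrum_in X) \<phi>"
    and pres: "CS_preserver_on (ss_with_spectrum_in X) \<phi>"
begin

lemma eig: "A \<in> ss_with_spectrum_in X \<Longrightarrow> eigenvalues (\<phi> A) = eigenvalues A"
  and comm: "A \<in> ss_with_spectrum_in X \<Longrightarrow> B \<in> ss_with_spectrum_in X \<Longrightarrow> A ** B = B ** A \<Longrightarrow>
    \<phi> A ** \<phi> B = \<phi> B ** \<phi> A"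
  using pres by (auto simp: CS_preserver_on_def)

lemma continuous_on_\<phi>_diagop:
  "inverse_pair P P' \<Longrightarrow> continuous_on (tuples X) (\<lambda>x. \<phi> (diagop P P' x))"
  by (rule continuous_on_compose2[OF cont]) (auto intro!: continuous_intros diagop_in_ss)

end

locale cs_preserver_component = cs_preserver X \<phi>
  for X :: "complex set" and \<phi> :: "complex ^ 'n ^ 'n \<Rightarrow> complex ^ 'n ^ 'n" +
  fixes C :: "(complex ^ 'n) set" and x0 :: "complex ^ 'n"
  assumes connC: "connected C" and C: "C \<subseteq> config X" and x0: "x0 \<in> C"
begin

text \<open>\<open>Q\<close> lists the eigenvectors of the image in the order of the eigenvalues
  \<open>x0\<close>; this normalizes the permutation on \<open>C\<close> itself to the
  identity.\<close>

definition eigenframe :: "complex ^ 'n ^ 'n \<Rightarrow> complex ^ 'n ^ 'n \<Rightarrow> complex ^ 'n ^ 'n \<Rightarrow> complex ^ 'n ^ 'n \<Rightarrow> bool" where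
  "eigenframe P P' Q Q' \<longleftrightarrow> inverse_pair P P' \<and> inverse_pair Q Q' \<and> \<phi> (diagop P P' x0) = diagop Q Q' x0"

lemma x0_config: "x0 \<in> config X" using C x0 by blast

lemma C_tuples: "x \<in> C \<Longrightarrow> x \<in> tuples X" using C config_tuples by blast

lemma eigenframe_exists:
  assumes P: "inverse_pair P P'" obtains Q Q' where "eigenframe P P' Q Q'"
proof -
  have "eigenvalues (\<phi> (diagop P P' x0)) = range (($) x0)"
    using eig[OF diagop_in_ss[OF P C_tuples[OF x0]]] eigenvalues_diagop[OF P] by simp
  then obtain Q Q' where "inverse_pair Q Q'" "\<phi> (diagop P P' x0) = diagop Q Q' x0"
    by (rule distinct_eigenvalues_diagonalizable) (use config_inj[OF x0_config] in auto)
  with P that show thesis by (simp add: eigenframe_def)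
qed

text \<open>Operators with frame \<open>P\<close> commute with the one at \<open>x0\<close>, whose
  image has simple spectrum; so all their images are diagonal in the frame \<open>Q\<close>.\<close>

lemma simultaneous_diagonalization:
  assumes F: "eigenframe P P' Q Q'"
  obtains \<mu> where "continuous_on (tuples X) \<mu>" "\<mu> x0 = x0"
    "\<And>x. x \<in> tuples X \<Longrightarrow> \<phi> (diagop P P' x) = diagop Q Q' (\<mu> x)"
    "\<And>x. x \<in> tuples X \<Longrightarrow> range (($) (\<mu> x)) = range (($) x)"
proof
  have P: "inverse_pair P P'" and Q: "inverse_pair Q Q'" and 0: "\<phi> (diagop P P' x0) = diagop Q Q' x0"
    using F by (auto simp: eigenframe_def)
  define N where "N = (\<lambda>x. Q' ** \<phi> (diagop P P' x) ** Q)"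
  define \<mu> where "\<mu> = (\<lambda>x. \<chi> i. N x $ i $ i)"
  show "continuous_on (tuples X) \<mu>"
    unfolding \<mu>_def N_def by (intro continuous_on_vec_lambda continuous_intros continuous_on_\<phi>_diagop P)
  have "N x0 = cdiag x0" unfolding N_def 0 by (rule diagop_conj[OF Q])
  then show "\<mu> x0 = x0" by (simp add: \<mu>_def vec_eq_iff)
  show *: "\<phi> (diagop P P' x) = diagop Q Q' (\<mu> x)" if x: "x \<in> tuples X" for x
  proof -
    have "\<phi> (diagop P P' x) ** \<phi> (diagop P P' x0) = \<phi> (diagop P P' x0) ** \<phi> (diagop P P' x)"
      using x C_tuples[OF x0] by (intro comm diagop_in_ss P diagop_commute)
    then have "Q' ** (\<phi> (diagop P P' x) ** diagop Q Q' x0) ** Q = Q' ** (diagop Q Q' x0 ** \<phi> (diagop P P' x)) ** Q"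
      by (simp add: 0)
    then have "N x ** cdiag x0 = cdiag x0 ** N x"
      using Q by (simp add: N_def diagop_def matrix_mul_assoc inverse_pairD)
    then have "N x = cdiag (\<mu> x)"
      unfolding \<mu>_def by (rule commute_cdiag_imp_diag) (use config_inj[OF x0_config] in auto)
    then have "Q ** N x ** Q' = diagop Q Q' (\<mu> x)" by (simp add: diagop_def)
    then show ?thesis using Q by (simp add: N_def matrix_mul_assoc inverse_pairD)
  qed
  show "range (($) (\<mu> x)) = range (($) x)" if x: "x \<in> tuples X" for x
    using eig[OF diagop_in_ss[OF P x]] unfolding *[OF x] eigenvalues_diagop[OF P] eigenvalues_diagop[OF Q] .
qed

lemma on_translate:
  assumes F: "eigenframe P P' Q Q'" and \<theta>: "\<theta> permutes UNIV"
  obtains \<rho> where "\<rho> permutes UNIV" "\<And>x. x \<in> C \<Longrightarrow> \<phi> (diagop P P' (x \<lhd>\<lhd> \<theta>)) = diagop Q Q' (x \<lhd>\<lhd> \<rho>)"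
    "\<theta> = id \<Longrightarrow> \<rho> = id"
proof -
  obtain \<mu> where \<mu>: "continuous_on (tuples X) \<mu>" "\<mu> x0 = x0"
    "\<And>x. x \<in> tuples X \<Longrightarrow> \<phi> (diagop P P' x) = diagop Q Q' (\<mu> x)"
    "\<And>x. x \<in> tuples X \<Longrightarrow> range (($) (\<mu> x)) = range (($) x)"
    by (rule simultaneous_diagonalization[OF F]) blast
  have t: "x \<lhd>\<lhd> \<theta> \<in> tuples X" if "x \<in> C" for x using C_tuples[OF that] by (rule tuples_act)
  have r: "range (($) (x \<lhd>\<lhd> \<theta>)) = range (($) x)" for x :: "complex ^ 'n"
  proof -
    have "range (($) (x \<lhd>\<lhd> \<theta>)) = ($) x ` range \<theta>" by auto
    then show ?thesis using permutes_surj[OF \<theta>] by simp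
  qed
  obtain \<rho> where \<rho>: "\<rho> permutes UNIV" "\<And>x. x \<in> C \<Longrightarrow> \<mu> (x \<lhd>\<lhd> \<theta>) = x \<lhd>\<lhd> \<rho>"
  proof (rule connected_coordinate_permutation[OF connC C _ _ x0, of "\<lambda>x. \<mu> (x \<lhd>\<lhd> \<theta>)"])
    show "continuous_on C (\<lambda>x. \<mu> (x \<lhd>\<lhd> \<theta>))"
      by (rule continuous_on_compose2[OF \<mu>(1)]) (auto intro!: continuous_on_act continuous_intros t)
    show "range (($) (\<mu> (x \<lhd>\<lhd> \<theta>))) = range (($) x)" if "x \<in> C" for x
      using \<mu>(4)[OF t[OF that]] r by simp
  qed blast
  have "\<rho> = id" if "\<theta> = id"
    using \<rho>(2)[OF x0] \<mu>(2) config_act_inject[OF x0_config, of \<rho> id] that by simp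
  then show thesis using that \<rho> \<mu>(3)[OF t] by auto
qed

lemma on_component:
  assumes "eigenframe P P' Q Q'" "x \<in> C"
  shows "\<phi> (diagop P P' x) = diagop Q Q' x"
proof -
  obtain \<rho> where "\<rho> permutes UNIV" "\<And>x. x \<in> C \<Longrightarrow> \<phi> (diagop P P' (x \<lhd>\<lhd> id)) = diagop Q Q' (x \<lhd>\<lhd> \<rho>)"
    "id = id \<Longrightarrow> \<rho> = id"
    by (rule on_translate[OF assms(1) permutes_id]) blast
  then show ?thesis using assms(2) by simp
qed

text \<open>The space of frames is connected, and the trace below is a continuous function of the frame that
  takes finitely many values.\<close>

lemma on_translate_unique:
  assumes F1: "eigenframe P1 P1' Q1 Q1'" and F2: "eigenframe P2 P2' Q2 Q2'"
    and e1: "\<phi> (diagop P1 P1' (x0 \<lhd>\<lhd> \<theta>)) = diagop Q1 Q1' (x0 \<lhd>\<lhd> \<rho>1)"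
    and e2: "\<phi> (diagop P2 P2' (x0 \<lhd>\<lhd> \<theta>)) = diagop Q2 Q2' (x0 \<lhd>\<lhd> \<rho>2)"
    and \<theta>: "\<theta> permutes UNIV"
  shows "\<rho>1 = \<rho>2"
proof
  fix k
  \<comment> \<open>The nodes are the eigenvalues at \<open>x0\<close> other than
    \<open>x0 $ k\<close>, so \<open>lprod\<close> of the image at \<open>x0\<close> is
    \<open>c\<close> times the projection onto the \<open>k\<close>-th line of
    \<open>Q\<close>.\<close>
  obtain z m where z: "bij_betw z {..<m::nat} (($) x0 ` (-{k}))"
    by (metis ex_bij_betw_nat_finite finite finite_imageI atLeast0LessThan)
  define c where "c = (\<Prod>l<m. x0 $ k - z l)"
  have zimg: "z ` {..<m} = ($) x0 ` (-{k})" using z by (simp add: bij_betw_def)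
  have c: "c \<noteq> 0"
  proof
    assume "c = 0"
    then obtain l where l: "l < m" "z l = x0 $ k" by (auto simp: c_def)
    have "z l \<in> z ` {..<m}" using l(1) by (intro imageI) simp
    then have "x0 $ k \<in> ($) x0 ` (-{k})" unfolding zimg l(2) .
    then show False using config_inj[OF x0_config] by auto
  qed
  have lag: "(\<Prod>l<m. x0 $ i - z l) = (if i = k then c else 0)" for i
  proof (cases "i = k")
    case False
    then have "x0 $ i \<in> z ` {..<m}" unfolding zimg by auto
    then show ?thesis using False by (auto intro!: prod_zero)
  qed (simp add: c_def)
  \<comment> \<open>The trace reads off the eigenvalue on the \<open>k\<close>-th line without a
    choice of \<open>Q\<close>, for which no continuity in \<open>P\<close> is available.\<close>
  define f where "f = (\<lambda>P. trace (lprod (\<phi> (diagop P (matrix_inv P) x0)) z m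
    ** \<phi> (diagop P (matrix_inv P) (x0 \<lhd>\<lhd> \<theta>))))"
  have f: "f P = c * x0 $ \<rho> k"
    if F: "eigenframe P P' Q Q'" and e: "\<phi> (diagop P P' (x0 \<lhd>\<lhd> \<theta>)) = diagop Q Q' (x0 \<lhd>\<lhd> \<rho>)" for P P' Q Q' \<rho>
  proof -
    have P: "inverse_pair P P'" and Q: "inverse_pair Q Q'" and 0: "\<phi> (diagop P P' x0) = diagop Q Q' x0"
      using F by (auto simp: eigenframe_def)
    have P': "P' = matrix_inv P" using P by (simp add: inverse_pair_iff)
    show ?thesis
      unfolding f_def P'[symmetric] 0 e lprod_diagop[OF Q] diagop_mult[OF Q] trace_diagop[OF Q]
      by (simp add: lag if_distrib if_distribR cong: if_cong)
  qed
  have "f constant_on {P. invertible P}"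
  proof (rule continuous_finite_range_constant[OF connected_GL])
    have "continuous_on {P. invertible P} (\<lambda>P. \<phi> (diagop P (matrix_inv P) y))" if "y \<in> tuples X" for y
      by (rule continuous_on_compose2[OF cont])
         (use that in \<open>auto intro!: continuous_intros continuous_on_matrix_inv diagop_in_ss inverse_pair_matrix_inv\<close>)
    then show "continuous_on {P. invertible P} f"
      unfolding f_def using C_tuples[OF x0] tuples_act
      by (intro continuous_on_trace continuous_intros continuous_on_lprod) auto
    have "f P \<in> range (\<lambda>i. c * x0 $ i)" if iP: "invertible P" for P
    proof -
      obtain Q Q' where F: "eigenframe P (matrix_inv P) Q Q'"
        by (rule eigenframe_exists[OF inverse_pair_matrix_inv[OF iP]])
      obtain \<rho> where "\<And>x. x \<in> C \<Longrightarrow> \<phi> (diagop P (matrix_inv P) (x \<lhd>\<lhd> \<theta>)) = diagop Q Q' (x \<lhd>\<lhd> \<rho>)"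
        by (rule on_translate[OF F \<theta>]) blast
      then show ?thesis using f[OF F] x0 by blast
    qed
    then have "f ` {P. invertible P} \<subseteq> range (\<lambda>i. c * x0 $ i)" by blast
    then show "finite (f ` {P. invertible P})" by (rule finite_subset) simp
  qed
  then have "f P1 = f P2"
    using F1 F2 unfolding constant_on_def eigenframe_def inverse_pair_iff by (metis mem_Collect_eq)
  then show "\<rho>1 k = \<rho>2 k"
    using f[OF F1 e1] f[OF F2 e2] c config_inj[OF x0_config] by simp
qed

definition is_monodromy :: "(('n \<Rightarrow> 'n) \<Rightarrow> 'n \<Rightarrow> 'n) \<Rightarrow> bool" where
  "is_monodromy \<psi> \<longleftrightarrow> (\<forall>\<theta>. \<theta> permutes UNIV \<longrightarrow> \<psi> \<theta> permutes UNIV \<and>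
    (\<forall>P P' Q Q' x. eigenframe P P' Q Q' \<longrightarrow> x \<in> C \<longrightarrow>
      \<phi> (diagop P P' (x \<lhd>\<lhd> \<theta>)) = diagop Q Q' (x \<lhd>\<lhd> \<psi> \<theta>)))"

lemma is_monodromyD:
  assumes "is_monodromy \<psi>" "\<theta> permutes UNIV"
  shows "\<psi> \<theta> permutes UNIV" "\<And>P P' Q Q' x. eigenframe P P' Q Q' \<Longrightarrow> x \<in> C \<Longrightarrow>
    \<phi> (diagop P P' (x \<lhd>\<lhd> \<theta>)) = diagop Q Q' (x \<lhd>\<lhd> \<psi> \<theta>)"
  using assms unfolding is_monodromy_def by blast+

lemma monodromy: "\<exists>\<psi>. is_monodromy \<psi>"
proof -
  have "\<exists>\<rho>. \<rho> permutes UNIV \<and> (\<forall>P P' Q Q' x. eigenframe P P' Q Q' \<longrightarrow> x \<in> C \<longrightarrow>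
      \<phi> (diagop P P' (x \<lhd>\<lhd> \<theta>)) = diagop Q Q' (x \<lhd>\<lhd> \<rho>))" if \<theta>: "\<theta> permutes UNIV" for \<theta>
  proof -
    have I: "inverse_pair (mat 1) (mat 1 :: complex ^ 'n ^ 'n)" by (simp add: inverse_pair_def)
    obtain R R' where F: "eigenframe (mat 1) (mat 1) R R'" by (rule eigenframe_exists[OF I])
    obtain \<rho> where \<rho>: "\<rho> permutes UNIV"
      "\<And>x. x \<in> C \<Longrightarrow> \<phi> (diagop (mat 1) (mat 1) (x \<lhd>\<lhd> \<theta>)) = diagop R R' (x \<lhd>\<lhd> \<rho>)"
      by (rule on_translate[OF F \<theta>]) blast
    have "\<phi> (diagop P P' (x \<lhd>\<lhd> \<theta>)) = diagop Q Q' (x \<lhd>\<lhd> \<rho>)" if F2: "eigenframe P P' Q Q'" and "x \<in> C" for P P' Q Q' x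
    proof -
      obtain \<rho>' where \<rho>': "\<And>x. x \<in> C \<Longrightarrow> \<phi> (diagop P P' (x \<lhd>\<lhd> \<theta>)) = diagop Q Q' (x \<lhd>\<lhd> \<rho>')"
        by (rule on_translate[OF F2 \<theta>]) blast
      have "\<rho>' = \<rho>" by (rule on_translate_unique[OF F2 F \<rho>'[OF x0] \<rho>(2)[OF x0] \<theta>])
      then show ?thesis using \<rho>' that by blast
    qed
    with \<rho>(1) show ?thesis by blast
  qed
  then show ?thesis unfolding is_monodromy_def by metis
qed

text \<open>Permuting by \<rho> is the same as passing to a reordered frame \<open>R\<close>, which
  has the same monodromy. The eigenframe of \<open>R\<close> differs from that of the original frame
  by \<open>\<psi> \<rho>\<close>, and reading \<open>\<psi> \<theta>\<close> through it produces
  the composition.\<close>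

lemma monodromy_hom:
  assumes \<psi>: "is_monodromy \<psi>"
    and \<theta>: "\<theta> permutes UNIV" and \<rho>: "\<rho> permutes UNIV"
  shows "\<psi> (\<theta> \<circ> \<rho>) = \<psi> \<theta> \<circ> \<psi> \<rho>"
proof -
  have I: "inverse_pair (mat 1) (mat 1 :: complex ^ 'n ^ 'n)" by (simp add: inverse_pair_def)
  obtain Q Q' where F: "eigenframe (mat 1) (mat 1) Q Q'" by (rule eigenframe_exists[OF I])
  obtain R R' where R: "inverse_pair R R'"
    "\<And>x. diagop (mat 1) (mat 1 :: complex ^ 'n ^ 'n) (x \<lhd>\<lhd> \<rho>) = diagop R R' x"
    by (rule diagop_permute[OF \<rho> I]) blast
  obtain S S' where G: "eigenframe R R' S S'" by (rule eigenframe_exists[OF R(1)])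
  have Q: "inverse_pair Q Q'" and S: "inverse_pair S S'" using F G by (auto simp: eigenframe_def)
  have "diagop S S' x0 = diagop Q Q' (x0 \<lhd>\<lhd> \<psi> \<rho>)"
    using is_monodromyD(2)[OF \<psi> \<rho> F x0] G unfolding R(2) eigenframe_def by simp
  then have "diagop S S' (x0 \<lhd>\<lhd> \<psi> \<theta>) = diagop Q Q' (x0 \<lhd>\<lhd> \<psi> \<theta> \<lhd>\<lhd> \<psi> \<rho>)"
    by (rule diagop_transfer[OF S Q]) (simp add: config_inj[OF x0_config])
  moreover have "diagop S S' (x0 \<lhd>\<lhd> \<psi> \<theta>) = diagop Q Q' (x0 \<lhd>\<lhd> \<psi> (\<theta> \<circ> \<rho>))"
    using is_monodromyD(2)[OF \<psi> \<theta> G x0] is_monodromyD(2)[OF \<psi> permutes_compose[OF \<rho> \<theta>] F x0] R(2)[of "x0 \<lhd>\<lhd> \<theta>"] by (simp add: act_act)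
  ultimately have "x0 \<lhd>\<lhd> (\<psi> \<theta> \<circ> \<psi> \<rho>) = x0 \<lhd>\<lhd> \<psi> (\<theta> \<circ> \<rho>)"
    using diagop_inject[OF Q] by (simp add: act_act)
  then show ?thesis using config_act_inject[OF x0_config] by metis
qed

text \<open>At a point of both closures \<phi> is a limit from either side. Comparing the two values
  shows that \<open>transposition i j \<circ> \<psi> (transposition i j)\<close> leaves this point
  unchanged, so it moves at most the one coinciding pair.\<close>

lemma monodromy_edge:
  assumes \<psi>: "is_monodromy \<psi>"
    and edge: "{i, j} \<in> Gamma X C"
  shows "\<psi> (transposition i j) = id \<or> \<psi> (transposition i j) = transposition i j"
proof -
  obtain i' j' y where ij: "{i, j} = {i', j'}" "i' \<noteq> j'" and y: "y \<in> tuples X"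
    "y \<in> top_of_set (tuples X) closure_of C" "y \<in> top_of_set (tuples X) closure_of act_set C (transposition i' j')"
    "coincidences y = {{i', j'}}"
    using edge unfolding Gamma_def mem_Collect_eq by blast
  define \<tau> where "\<tau> = transposition i j"
  have \<tau>: "\<tau> = transposition i' j'" using ij by (auto simp: \<tau>_def doubleton_eq_iff transpose_commute)
  have p\<tau>: "\<tau> permutes UNIV" by (simp add: \<tau>_def permutes_swap_id)
  have inv: "\<tau> \<circ> \<tau> = id" by (simp add: \<tau>_def)
  have I: "inverse_pair (mat 1) (mat 1 :: complex ^ 'n ^ 'n)" by (simp add: inverse_pair_def)
  obtain Q Q' where F: "eigenframe (mat 1) (mat 1) Q Q'" by (rule eigenframe_exists[OF I])
  then have Q: "inverse_pair Q Q'" by (simp add: eigenframe_def)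
  define \<sigma> where "\<sigma> = \<tau> \<circ> \<psi> \<tau>"
  have p\<sigma>: "\<sigma> permutes UNIV" unfolding \<sigma>_def by (rule permutes_compose[OF is_monodromyD(1)[OF \<psi> p\<tau>] p\<tau>])
  have 1: "\<phi> (diagop (mat 1) (mat 1) y) = diagop Q Q' y"
    by (rule eq_on_closure[OF continuous_on_\<phi>_diagop[OF I] _ _ on_component[OF F] y(1) closure_of_tuplesD[OF y(2)]])
       (auto intro!: continuous_intros C_tuples)
  have 2: "\<phi> (diagop (mat 1) (mat 1) y) = diagop Q Q' (y \<lhd>\<lhd> \<sigma>)"
  proof (rule eq_on_closure[OF continuous_on_\<phi>_diagop[OF I] _ _ _ y(1) closure_of_tuplesD[OF y(3)]])
    show "\<phi> (diagop (mat 1) (mat 1) x) = diagop Q Q' (x \<lhd>\<lhd> \<sigma>)" if x: "x \<in> act_set C (transposition i' j')" for x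
    proof -
      obtain w where w: "w \<in> C" "x = w \<lhd>\<lhd> \<tau>" using x unfolding act_set_def \<tau> by blast
      have "x \<lhd>\<lhd> \<sigma> = w \<lhd>\<lhd> (\<tau> \<circ> \<tau> \<circ> \<psi> \<tau>)" by (simp add: w act_act \<sigma>_def o_assoc)
      then show ?thesis using is_monodromyD(2)[OF \<psi> p\<tau> F w(1)] by (simp add: w(2) inv)
    qed
    show "act_set C (transposition i' j') \<subseteq> tuples X"
      using C_tuples tuples_act by (auto simp: act_set_def)
  qed (auto intro!: continuous_intros continuous_on_act)
  have "y = y \<lhd>\<lhd> \<sigma>" using 1 2 diagop_inject[OF Q] by metis
  then have yk: "y $ k = y $ \<sigma> k" for k by (metis act_nth)
  have s: "\<sigma> k = k \<or> {k, \<sigma> k} = {i', j'}" for k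
  proof (cases "\<sigma> k = k")
    case False
    then have "{k, \<sigma> k} \<in> coincidences y"
      unfolding coincidences_def mem_Collect_eq using yk[of k] by (intro exI[of _ k] exI[of _ "\<sigma> k"]) auto
    then show ?thesis unfolding y(4) by simp
  qed simp
  have "\<sigma> = id \<or> \<sigma> = transposition i' j'"
  proof (cases "\<sigma> i' = i'")
    case True
    then have "\<sigma> j' = j'" using s[of j'] permutes_inj[OF p\<sigma>] ij(2) by (metis doubleton_eq_iff inj_eq)
    then have "\<sigma> k = k" for k using s[of k] True by (auto simp: doubleton_eq_iff)
    then show ?thesis by auto
  next
    case False
    then have i: "\<sigma> i' = j'" using s[of i'] by (auto simp: doubleton_eq_iff)
    then have j: "\<sigma> j' = i'" using s[of j'] permutes_inj[OF p\<sigma>] ij(2) by (metis doubleton_eq_iff inj_eq)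
    have "\<sigma> k = transposition i' j' k" for k
      using s[of k] i j by (cases "k = i' \<or> k = j'") (auto simp: doubleton_eq_iff)
    then show ?thesis by auto
  qed
  moreover have "\<psi> \<tau> = \<tau> \<circ> \<sigma>" unfolding \<sigma>_def by (simp add: o_assoc inv)
  ultimately show ?thesis using inv \<tau> by (auto simp: \<tau>_def[symmetric])
qed

end

theorem (in cs_preserver) frame_map:
  assumes n: "CARD('n) \<ge> 3"
    and perfect: "perfect_space X"
    and cycle: "\<And>x :: complex ^ 'n. x \<in> config X \<Longrightarrow> has_cycle_of_length (Gamma_at X x) CARD('n)"
    and transitive: "transitive_on_components TYPE('n) X"
    and not_free: "\<not> free_on_components TYPE('n) X"
    and P: "inverse_pair P P'"
  obtains Q Q' where "inverse_pair Q Q'" "\<And>x. x \<in> tuples X \<Longrightarrow> \<phi> (diagop P P' x) = diagop Q Q' x"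
proof -
  obtain C \<theta>0 where CC: "C \<in> components (config X :: (complex ^ 'n) set)"
    and \<theta>0: "\<theta>0 permutes UNIV" "act_set C \<theta>0 = C" "\<theta>0 \<noteq> id"
    using not_free unfolding free_on_components_def by blast
  obtain y0 where y0: "y0 \<in> config X" "C = connected_component_set (config X) y0"
    using CC by (auto simp: components_def)
  interpret cs_preserver_component X \<phi> C y0
    using CC y0 by unfold_locales (auto simp: in_components_connected connected_component_refl
      intro: subsetD[OF in_components_subset])
  obtain \<psi> where \<psi>: "is_monodromy \<psi>" using monodromy by blast
  obtain Q Q' where F: "eigenframe P P' Q Q'" by (rule eigenframe_exists[OF P])
  then have Q: "inverse_pair Q Q'" by (simp add: eigenframe_def)
  have \<psi>_id: "\<psi> \<theta> = \<theta>" if "\<theta> permutes UNIV" for \<theta>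
  proof (rule symmetric_group_endomorphism_id[OF n is_monodromyD(1)[OF \<psi>] _ _ _ \<theta>0(1) _ \<theta>0(3) that])
    show "\<psi> (\<theta> \<circ> \<rho>) = \<psi> \<theta> \<circ> \<psi> \<rho>" if "\<theta> permutes UNIV" "\<rho> permutes UNIV" for \<theta> \<rho>
      by (rule monodromy_hom[OF \<psi> that])
    show "has_cycle_of_length (Gamma X C) CARD('n)"
      using cycle[OF y0(1)] by (simp add: Gamma_at_def y0(2))
    show "\<psi> (transposition i j) = id \<or> \<psi> (transposition i j) = transposition i j" if "{i, j} \<in> Gamma X C" for i j
      by (rule monodromy_edge[OF \<psi> that])
    \<comment> \<open>Here the isotropy enters: at this point of \<open>C\<close> the image is known
      both from \<open>on_component\<close> and through \<open>\<psi> \<theta>0\<close>.\<close>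
    have "y0 \<lhd>\<lhd> \<theta>0 \<in> C" using \<theta>0(2) x0
      by (auto simp: act_set_def)
    then have "diagop Q Q' (y0 \<lhd>\<lhd> \<psi> \<theta>0) = diagop Q Q' (y0 \<lhd>\<lhd> \<theta>0)"
      using is_monodromyD(2)[OF \<psi> \<theta>0(1) F] on_component[OF F] x0 by metis
    then show "\<psi> \<theta>0 = \<theta>0" using diagop_inject[OF Q] config_act_inject[OF y0(1)] by metis
  qed
  have conf: "\<phi> (diagop P P' x) = diagop Q Q' x" if "x \<in> config X" for x
  proof -
    let ?D = "connected_component_set (config X) x"
    have D: "?D \<in> components (config X)" using that by (auto simp: components_def)
    obtain \<theta> where \<theta>: "\<theta> permutes UNIV" "act_set C \<theta> = ?D"
      using transitive[unfolded transitive_on_components_def, rule_format, OF CC D] by blast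
    have "x \<in> ?D" using that by (simp add: connected_component_refl)
    then have "x \<in> act_set C \<theta>" unfolding \<theta>(2) .
    then obtain w where w: "w \<in> C" "x = w \<lhd>\<lhd> \<theta>" unfolding act_set_def by blast
    then show ?thesis using is_monodromyD(2)[OF \<psi> \<theta>(1) F w(1)] \<psi>_id[OF \<theta>(1)] by simp
  qed
  have "\<phi> (diagop P P' x) = diagop Q Q' x" if "x \<in> tuples X" for x
    by (rule eq_on_closure[OF continuous_on_\<phi>_diagop[OF P] _ _ conf that perfect_dense_config[OF perfect that]])
       (auto intro!: continuous_intros config_tuples)
  with Q that show thesis by blast
qed

subsection \<open>From preservers to rank-one idempotents\<close>

text \<open>A basis of the common kernel of \<open>x1\<close> and \<open>x2\<close> completes
  \<open>v1\<close> and \<open>v2\<close>, and the dual basis then contains exactly these two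
  forms.\<close>

lemma extend_to_basis:
  fixes v1 v2 x1 x2 :: "complex ^ 'n"
  assumes b: "bil x1 v1 = 1" "bil x2 v2 = 1" "bil x1 v2 = 0" "bil x2 v1 = 0"
  obtains P P' i j where "inverse_pair P P'" "i \<noteq> j"
    "outer v1 x1 = diagop P P' (ax i)" "outer v2 x2 = diagop P P' (ax j)"
proof -
  define W where "W = {u. bil x1 u = 0 \<and> bil x2 u = 0}"
  have "vec.subspace W" unfolding W_def by (rule vec.subspaceI) auto
  obtain B where B: "B \<subseteq> W" "vec.independent B" "W \<subseteq> vec.span B" "card B = vec.dim W"
    by (rule vec.basis_exists[of W])
  have spB: "vec.span B \<subseteq> W" using B(1) \<open>vec.subspace W\<close> by (rule vec.span_minimal)
  have n1: "v2 \<notin> vec.span B" using spB b by (auto simp: W_def)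
  have "vec.subspace {u. bil x1 u = 0}" by (rule vec.subspaceI) auto
  then have "vec.span (insert v2 B) \<subseteq> {u. bil x1 u = 0}"
    using B(1) b by (intro vec.span_minimal) (auto simp: W_def)
  then have n2: "v1 \<notin> vec.span (insert v2 B)" using b by auto
  define S where "S = insert v1 (insert v2 B)"
  have indS: "vec.independent S"
    unfolding S_def using B(2) n1 n2 by (intro vec.independent_insertI)
  have "u \<in> vec.span S" for u
  proof -
    have "u - bil x1 u *s v1 - bil x2 u *s v2 \<in> W" using b by (auto simp: W_def)
    then have "u - bil x1 u *s v1 - bil x2 u *s v2 \<in> vec.span S"
      using B(3) vec.span_mono[of B S] by (auto simp: S_def)
    moreover have "bil x1 u *s v1 + bil x2 u *s v2 \<in> vec.span S"
      by (intro vec.span_add vec.span_scale vec.span_base) (auto simp: S_def)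
    ultimately show ?thesis using vec.span_add by fastforce
  qed
  then have spS: "vec.span S = UNIV" by blast
  have "card S = CARD('n)" using vec.dim_eq_card[OF _ indS, of UNIV] spS by (simp add: card_cart_basis)
  moreover have "finite S" using indS by (rule vec.finiteI_independent)
  ultimately obtain f :: "'n \<Rightarrow> complex ^ 'n" where f: "bij_betw f UNIV S"
    using finite_same_card_bij[of "UNIV :: 'n set" S] by auto
  define P :: "complex ^ 'n ^ 'n" where "P = (\<chi> a k. f k $ a)"
  have col: "column k P = f k" for k by (simp add: P_def column_def vec_eq_iff)
  have "columns P = S" using f by (auto simp: columns_def col bij_betw_def)
  then obtain P' where "P ** P' = mat 1"
    using spS matrix_right_invertible_span_columns[of P] by auto
  then have PP': "inverse_pair P P'" by (rule inverse_pairI)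
  have inS: "f k = v1 \<or> f k = v2 \<or> f k \<in> B" for k using f by (auto simp: bij_betw_def S_def)
  have inj: "f k = f l \<longleftrightarrow> k = l" for k l using f by (auto simp: bij_betw_def inj_eq)
  obtain i j where i: "f i = v1" and j: "f j = v2"
    using f unfolding bij_betw_def S_def by (metis imageE insertI1 insertI2)
  have "v1 \<noteq> v2" using b by auto
  then have ij: "i \<noteq> j" using i j by auto
  have row: "row k P' = x" if "\<And>l. bil x (f l) = (if l = k then 1 else 0)" for k x
  proof -
    have "x v* P = ax k"
      using that by (simp add: vec_eq_iff vector_matrix_mult_def P_def bil_def eq_commute)
    then have "x v* P v* P' = ax k v* P'" by simp
    then have "x = ax k v* P'" by (simp add: vector_matrix_mul_assoc inverse_pairD[OF PP'])
    then show ?thesis by (simp add: vec_eq_iff row_def vector_matrix_mult_def if_distrib if_distribR cong: if_cong)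
  qed
  have "row i P' = x1"
  proof (rule row)
    show "bil x1 (f l) = (if l = i then 1 else 0)" for l
      using inS[of l] B(1) b inj i by (auto simp: W_def)
  qed
  moreover have "row j P' = x2"
  proof (rule row)
    show "bil x2 (f l) = (if l = j then 1 else 0)" for l
      using inS[of l] B(1) b inj j by (auto simp: W_def)
  qed
  ultimately show thesis
    using that[OF PP' ij] by (simp add: diagop_axis col i j)
qed

lemma orthogonal_rank1_exists:
  fixes x v :: "complex ^ 'n"
  assumes card: "CARD('n) \<ge> 3" and xv: "bil x v = 1"
  obtains y w where "bil y w = 1" "bil x w = 0" "bil y v = 0"
proof -
  obtain i j :: 'n where ij: "i \<noteq> j" using third_index[OF card] by metis
  obtain \<omega> :: "complex ^ 'n" where \<omega>: "\<omega> \<noteq> 0" "bil \<omega> v = 0"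
  proof (cases "v $ i = 0")
    case True
    moreover have "ax i \<noteq> (0 :: complex ^ 'n)" by (simp add: axis_eq_0_iff)
    ultimately show thesis using that[of "ax i"] by simp
  next
    case False
    let ?\<omega> = "v $ j *s ax i - v $ i *s ax j"
    have "?\<omega> $ j \<noteq> 0" using False ij by simp
    then have "?\<omega> \<noteq> 0" by force
    then show thesis using that[of ?\<omega>] by simp
  qed
  obtain w k where "bil x w = 0" "bil \<omega> w = 1" "w $ k = 0"
    by (rule two_support_vector[OF card xv \<omega>(2,1)])
  with \<omega> that show thesis by blast
qed

lemma rank1_idem_pair_frame:
  fixes p q :: "complex ^ 'n ^ 'n"
  assumes "rank1_idem p" "rank1_idem q" "p ** q = 0" "q ** p = 0"
  obtains P P' i j where "inverse_pair P P'" "i \<noteq> j" "p = diagop P P' (ax i)" "q = diagop P P' (ax j)"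
proof -
  obtain v x w y where *: "bil x v = 1" "p = outer v x" "bil y w = 1" "q = outer w y"
    using assms(1,2) unfolding rank1_idem_def by blast
  have "outer v y \<noteq> 0" "outer w x \<noteq> 0"
    using bil_nonzero[OF *(1)] bil_nonzero[OF *(3)] by (auto simp: matrix_eq_iff)
  moreover have "cscale (bil x w) (outer v y) = 0" "cscale (bil y v) (outer w x) = 0"
    using assms(3,4) by (simp_all add: * outer_mult)
  ultimately have "bil x w = 0" "bil y v = 0" by (metis cscale_cancel cscale_simps(3))+
  then show thesis using extend_to_basis[OF *(1,3)] that * by metis
qed

lemma rank1_idem_frame:
  fixes p :: "complex ^ 'n ^ 'n"
  assumes "CARD('n) \<ge> 3" "rank1_idem p"
  obtains P P' i where "inverse_pair P P'" "p = diagop P P' (ax i)"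
proof -
  obtain v x where p: "bil x v = 1" "p = outer v x" using assms(2) by (auto simp: rank1_idem_def)
  obtain y w where "bil y w = 1" "bil x w = 0" "bil y v = 0"
    by (rule orthogonal_rank1_exists[OF assms(1) p(1)])
  then obtain P P' i j where "inverse_pair P P'" "i \<noteq> j"
    "outer v x = diagop P P' (ax i)" "outer w y = diagop P P' (ax j)"
    by (rule extend_to_basis[OF p(1)])
  with that p(2) show thesis by blast
qed

lemma rank1_idem_diagop_ax: "inverse_pair P P' \<Longrightarrow> rank1_idem (diagop P P' (ax i))"
  by (simp add: diagop_axis bil_row_column)

text \<open>With \<open>a \<noteq> b\<close> in the spectrum, \<open>\<phi>\<close> restricts to the operators \<open>b + (a - b) R\<close> with \<open>R\<close> idempotent.\<close>

lemma (in cs_preserver) induced_rank1_map: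
  assumes n: "CARD('n) \<ge> 3" and ab: "a \<in> X" "b \<in> X" "a \<noteq> b"
    and frame: "\<And>P P'. inverse_pair P P' \<Longrightarrow>
      \<exists>Q Q'. inverse_pair Q Q' \<and> (\<forall>x\<in>tuples X. \<phi> (diagop P P' x) = diagop Q Q' x)"
  defines "\<Psi> \<equiv> \<lambda>R. cscale (1 / (a - b)) (\<phi> (mat b + cscale (a - b) R) - mat b)"
  shows "rank1_map \<Psi>"
    and "\<And>P P' x. inverse_pair P P' \<Longrightarrow> x \<in> tuples X \<Longrightarrow>
      \<phi> (diagop P P' x) = (\<Sum>i\<in>UNIV. cscale (x $ i) (\<Psi> (diagop P P' (ax i))))"
proof -
  define lift where "lift = (\<lambda>u :: complex ^ 'n. \<chi> k. b + (a - b) * u $ k)"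
  have lift: "mat b + cscale (a - b) (diagop P P' u) = diagop P P' (lift u)" if "inverse_pair P P'" for P P' u
  proof -
    have "lift u = (\<chi> k. b) + (a - b) *s u" by (simp add: lift_def vec_eq_iff algebra_simps)
    then show ?thesis by (simp only: diagop_add diagop_scale diagop_const[OF that])
  qed
  have lift_tuples: "lift u \<in> tuples X" if "\<And>k. u $ k = 0 \<or> u $ k = 1" for u
  proof -
    have "b + (a - b) * u $ k \<in> X" for k using that[of k] ab by auto
    then show ?thesis by (simp add: lift_def tuples_def)
  qed
  have \<Psi>: "\<Psi> (diagop P P' u) = diagop Q Q' u"
    if P: "inverse_pair P P'" and Q: "inverse_pair Q Q'" "\<And>x. x \<in> tuples X \<Longrightarrow> \<phi> (diagop P P' x) = diagop Q Q' x"
      and u: "\<And>k. u $ k = 0 \<or> u $ k = 1" for P P' Q Q' u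
  proof -
    have "\<Psi> (diagop P P' u) = cscale (1 / (a - b)) (diagop Q Q' (lift u) - mat b)"
      unfolding \<Psi>_def lift[OF P] Q(2)[OF lift_tuples[OF u]] ..
    also have "\<dots> = diagop Q Q' u"
      unfolding lift[OF Q(1), symmetric] using ab(3) by simp
    finally show ?thesis .
  qed
  have ax01: "ax i $ k = 0 \<or> ax i $ k = (1 :: complex)" for i k :: 'n by simp
  have two: "\<exists>Q Q' i j. inverse_pair Q Q' \<and> i \<noteq> j \<and> \<Psi> p = diagop Q Q' (ax i) \<and> \<Psi> q = diagop Q Q' (ax j)
      \<and> \<Psi> (p + q) = diagop Q Q' (ax i + ax j)"
    if pq: "rank1_idem p" "rank1_idem q" "p ** q = 0" "q ** p = 0" for p q
  proof -
    obtain P P' i j where P: "inverse_pair P P'" "i \<noteq> j" "p = diagop P P' (ax i)" "q = diagop P P' (ax j)"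
      by (rule rank1_idem_pair_frame[OF pq])
    obtain Q Q' where Q: "inverse_pair Q Q'" "\<And>x. x \<in> tuples X \<Longrightarrow> \<phi> (diagop P P' x) = diagop Q Q' x"
      using frame[OF P(1)] by blast
    have s: "(ax i + ax j :: complex ^ 'n) $ k = 0 \<or> (ax i + ax j :: complex ^ 'n) $ k = 1" for k
      using P(2) by auto
    show ?thesis
      using \<Psi>[OF P(1) Q ax01] \<Psi>[OF P(1) Q s] Q(1) P(2) unfolding P(3,4) diagop_add[symmetric] by blast
  qed
  have one: "\<exists>P P' Q Q' i. inverse_pair P P' \<and> inverse_pair Q Q' \<and> p = diagop P P' (ax i) \<and> \<Psi> p = diagop Q Q' (ax i)"
    if p: "rank1_idem p" for p
  proof -
    obtain P P' i where P: "inverse_pair P P'" "p = diagop P P' (ax i)" by (rule rank1_idem_frame[OF n p])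
    obtain Q Q' where Q: "inverse_pair Q Q'" "\<And>x. x \<in> tuples X \<Longrightarrow> \<phi> (diagop P P' x) = diagop Q Q' x"
      using frame[OF P(1)] by blast
    show ?thesis using \<Psi>[OF P(1) Q ax01] P Q(1) by blast
  qed
  show "rank1_map \<Psi>"
  proof
    show "CARD('n) \<ge> 3" by (rule n)
    show "rank1_idem (\<Psi> p)" if "rank1_idem p" for p
      using one[OF that] rank1_idem_diagop_ax by metis
    show "\<Psi> p ** \<Psi> q = 0" if pq: "rank1_idem p" "rank1_idem q" "p ** q = 0" "q ** p = 0" for p q
    proof -
      obtain Q Q' i j where Q: "inverse_pair Q Q'" "i \<noteq> j" "\<Psi> p = diagop Q Q' (ax i)" "\<Psi> q = diagop Q Q' (ax j)"
        using two[OF pq] by blast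
      have "ax i * ax j = (0 :: complex ^ 'n)" using Q(2) by (auto simp: vec_eq_iff)
      then show ?thesis unfolding Q(3,4) diagop_mult[OF Q(1)] by (simp add: matrix_eq_iff diagop_nth)
    qed
    \<comment> \<open>The operator lifted from \<open>p + q\<close> still has its eigenvalues in
      \<open>{a, b}\<close>, so \<Psi> may be evaluated there; equal sums then have equal
      images.\<close>
    have "\<Psi> (p + q) = \<Psi> p + \<Psi> q" if "rank1_idem p" "rank1_idem q" "p ** q = 0" "q ** p = 0" for p q
      using two[OF that] diagop_add by metis
    then show "\<Psi> p + \<Psi> q = \<Psi> p' + \<Psi> q'"
      if "rank1_idem p" "rank1_idem q" "rank1_idem p'" "rank1_idem q'"
        "p ** q = 0" "q ** p = 0" "p' ** q' = 0" "q' ** p' = 0" "p + q = p' + q'" for p q p' q'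
      using that by metis
    have cscale_cont: "continuous_on S (\<lambda>R. cscale c (f R))" if "continuous_on S f"
      for S :: "(complex ^ 'n ^ 'n) set" and f :: "complex ^ 'n ^ 'n \<Rightarrow> complex ^ 'n ^ 'n" and c
      unfolding cscale_def using that by (intro continuous_on_vec_lambda continuous_intros)
    have "mat b + cscale (a - b) R \<in> ss_with_spectrum_in X" if R: "rank1_idem R" for R :: "complex ^ 'n ^ 'n"
    proof -
      obtain P P' i where P: "inverse_pair P P'" "R = diagop P P' (ax i)" using one[OF R] by blast
      show ?thesis unfolding P(2) lift[OF P(1)] by (intro diagop_in_ss P lift_tuples ax01)
    qed
    then show "continuous_on {p. rank1_idem p} \<Psi>"
      unfolding \<Psi>_def
      by (intro cscale_cont continuous_intros continuous_on_compose2[OF cont]) auto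
  qed
  show "\<phi> (diagop P P' x) = (\<Sum>i\<in>UNIV. cscale (x $ i) (\<Psi> (diagop P P' (ax i))))"
    if P: "inverse_pair P P'" and x: "x \<in> tuples X" for P P' x
  proof -
    obtain Q Q' where Q: "inverse_pair Q Q'" "\<And>x. x \<in> tuples X \<Longrightarrow> \<phi> (diagop P P' x) = diagop Q Q' x"
      using frame[OF P] by blast
    have "\<phi> (diagop P P' x) = (\<Sum>i\<in>UNIV. cscale (x $ i) (diagop Q Q' (ax i)))"
      unfolding Q(2)[OF x] diagop_axis by (rule diagop_eq_sum)
    moreover have "\<Psi> (diagop P P' (ax i)) = diagop Q Q' (ax i)" for i
      by (rule \<Psi>[OF P Q ax01])
    ultimately show ?thesis by simp
  qed
qed

lemma transpose_cscale: "mtransp (cscale c A) = cscale c (mtransp A)"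
  by (simp add: matrix_eq_iff transpose_def)

lemma transpose_sum: "mtransp (\<Sum>i\<in>S. f i) = (\<Sum>i\<in>S. mtransp (f i))"
  by (simp add: matrix_eq_iff transpose_def sum_component)

lemma conjugation_linear:
  fixes \<alpha> :: "complex ^ 'n ^ 'n \<Rightarrow> complex ^ 'n ^ 'n"
  assumes "conjugation \<alpha> \<or> transpose_conjugation \<alpha>"
  shows "\<alpha> (\<Sum>i\<in>S. cscale (c i) (f i)) = (\<Sum>i\<in>S. cscale (c i) (\<alpha> (f i)))"
proof -
  obtain T T' where "\<alpha> = (\<lambda>A. T ** A ** T') \<or> \<alpha> = (\<lambda>A. T ** mtransp A ** T')"
    using assms unfolding conjugation_alt transpose_conjugation_alt by blast
  then show ?thesis
    by (auto simp: transpose_sum transpose_cscale matrix_mult_sum_left matrix_mult_sum_right)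
qed

text \<open>\<phi> respects the spectral decomposition in each frame, so the formula for \<Psi>
  extends linearly within a frame although \<phi> is not assumed linear.\<close>

theorem (in cs_preserver) spectral_structure:
  assumes n: "CARD('n) \<ge> 3" and ab: "a \<in> X" "b \<in> X" "a \<noteq> b"
    and frame: "\<And>P P'. inverse_pair P P' \<Longrightarrow>
      \<exists>Q Q'. inverse_pair Q Q' \<and> (\<forall>x\<in>tuples X. \<phi> (diagop P P' x) = diagop Q Q' x)"
  obtains \<alpha> \<tau> where "conjugation \<alpha> \<or> transpose_conjugation \<alpha>" "\<tau> = id \<or> \<tau> = cnj"
    "\<forall>P P' x. inverse_pair P P' \<longrightarrow> x \<in> tuples X \<longrightarrow>
      \<phi> (diagop P P' x) = \<alpha> (diagop (mmap \<tau> P) (mmap \<tau> P') x)"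
proof -
  define \<Psi> where "\<Psi> = (\<lambda>R. cscale (1 / (a - b)) (\<phi> (mat b + cscale (a - b) R) - mat b))"
  have "rank1_map \<Psi>"
    unfolding \<Psi>_def by (rule induced_rank1_map(1)[OF n ab]) (rule frame)
  then obtain \<alpha> \<tau> where \<alpha>: "conjugation \<alpha> \<or> transpose_conjugation \<alpha>" and \<tau>: "\<tau> = id \<or> \<tau> = cnj"
    and \<Psi>: "\<And>R. rank1_idem R \<Longrightarrow> \<Psi> R = \<alpha> (mmap \<tau> R)"
    by (rule rank1_map_classification) blast
  have "\<phi> (diagop P P' x) = \<alpha> (diagop (mmap \<tau> P) (mmap \<tau> P') x)"
    if P: "inverse_pair P P'" and x: "x \<in> tuples X" for P P' x
  proof -
    have "\<phi> (diagop P P' x) = (\<Sum>i\<in>UNIV. cscale (x $ i) (\<Psi> (diagop P P' (ax i))))"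
      unfolding \<Psi>_def by (rule induced_rank1_map(2)[OF n ab]) (use frame P x in blast)+
    also have "\<dots> = (\<Sum>i\<in>UNIV. cscale (x $ i) (\<alpha> (mmap \<tau> (diagop P P' (ax i)))))"
      using \<Psi> rank1_idem_diagop_ax[OF P] by simp
    also have "\<dots> = \<alpha> (\<Sum>i\<in>UNIV. cscale (x $ i) (mmap \<tau> (diagop P P' (ax i))))"
      by (rule conjugation_linear[OF \<alpha>, symmetric])
    also have "(\<Sum>i\<in>UNIV. cscale (x $ i) (mmap \<tau> (diagop P P' (ax i)))) = diagop (mmap \<tau> P) (mmap \<tau> P') x"
    proof -
      have "mmap \<tau> (diagop P P' (ax i)) = outer (column i (mmap \<tau> P)) (row i (mmap \<tau> P'))" for i
        using \<tau> unfolding diagop_axis by (auto simp: matrix_eq_iff mmap_def column_def row_def)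
      then show ?thesis by (simp add: diagop_eq_sum)
    qed
    finally show ?thesis .
  qed
  with \<alpha> \<tau> that show thesis by blast
qed

subsection \<open>The dual-lines map\<close>

abbreviation herm :: "complex ^ 'n ^ 'n \<Rightarrow> complex ^ 'n ^ 'n" where
  "herm A \<equiv> mtransp (mmap cnj A)"

lemma herm_nth: "herm A $ i $ j = cnj (A $ j $ i)"
  by (simp add: transpose_def mmap_def)

lemma mmap_cnj_nth [simp]: "mmap cnj A $ i $ j = cnj (A $ i $ j)"
  by (simp add: mmap_def)

lemma mmap_cnj_mult: "mmap cnj (A ** B) = mmap cnj A ** mmap cnj B"
  by (simp add: matrix_eq_iff matrix_mult_nth)

lemma herm_mult: "herm (A ** B) = herm B ** herm A"
  by (simp add: mmap_cnj_mult matrix_transpose_mul)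

lemma inverse_pair_herm: "inverse_pair P P' \<Longrightarrow> inverse_pair (herm P') (herm P)"
proof -
  have "herm (mat 1) = (mat 1 :: complex ^ 'a ^ 'a)" by (simp add: matrix_eq_iff herm_nth mat_def)
  then show "inverse_pair P P' \<Longrightarrow> inverse_pair (herm P') (herm P)"
    unfolding inverse_pair_def by (metis herm_mult)
qed

lemma transpose_diagop: "mtransp (diagop P P' d) = diagop (mtransp P') (mtransp P) d"
  by (simp add: matrix_eq_iff diagop_nth transpose_def mult_ac)

lemma mmap_cnj_diagop: "mmap cnj (diagop P P' d) = diagop (mmap cnj P) (mmap cnj P') (vmap cnj d)"
  by (simp add: matrix_eq_iff diagop_nth vmap_def)

lemma diagop_ax_vec: "inverse_pair P P' \<Longrightarrow> diagop P P' c *v (P *v (t *s ax i)) = c $ i *s (P *v (t *s ax i))"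
proof -
  assume P: "inverse_pair P P'"
  have "c * (t *s ax i) = c $ i *s (t *s ax i)" by (simp add: vec_eq_iff)
  then show ?thesis unfolding diagop_vec[OF P] by (simp add: vec.scale)
qed

lemma column_eq: "column i P = P *v ax i"
  by (simp add: vec_eq_iff column_def matrix_vector_mult_def if_distrib cong: if_cong)

lemma lines_op_eqI:
  assumes "\<And>i v. v \<in> l i \<Longrightarrow> T *v v = c $ i *s v"
    and P: "inverse_pair P P'" "\<And>i. column i P \<in> l i"
  shows "lines_op l c = T"
  unfolding lines_op_def
proof (rule the_equality)
  fix S assume S: "\<forall>i. \<forall>v\<in>l i. S *v v = c $ i *s v"
  have "(S ** P) *v ax i = (T ** P) *v ax i" for i
    using S[rule_format, OF P(2)[of i]] assms(1)[OF P(2)[of i]]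
    by (simp add: column_eq matrix_vector_mul_assoc)
  then have "column i (S ** P) $ a = column i (T ** P) $ a" for i a by (simp add: column_eq)
  then have "S ** P = T ** P" unfolding matrix_eq_iff by (simp add: column_def)
  then have "S ** P ** P' = T ** P ** P'" by simp
  then show "S = T" by (simp add: inverse_pairD[OF P(1)])
qed (use assms in auto)

lemma spanning_lines_frame:
  assumes "spanning_lines l"
  obtains P P' where "inverse_pair P P'" "\<And>i. l i = vec.span {column i P}"
proof -
  have "\<exists>v. l i = vec.span {v}" for i
  proof -
    have l: "vec.subspace (l i)" "vec.dim (l i) = 1" using assms by (auto simp: spanning_lines_def)
    obtain B where B: "B \<subseteq> l i" "vec.independent B" "l i \<subseteq> vec.span B" "card B = vec.dim (l i)"
      by (rule vec.basis_exists[of "l i"])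
    then obtain v where "B = {v}" using l(2) by (auto simp: card_1_singleton_iff)
    then show ?thesis using B vec.span_minimal[OF B(1) l(1)] by blast
  qed
  then obtain v where v: "\<And>i. l i = vec.span {v i}" by metis
  define P :: "complex ^ 'a ^ 'a" where "P = (\<chi> a i. v i $ a)"
  have col: "column i P = v i" for i by (simp add: P_def column_def vec_eq_iff)
  have "l i \<subseteq> vec.span (columns P)" for i
    unfolding v by (rule vec.span_mono) (auto simp: columns_def col)
  then have "vec.span (\<Union>i. l i) \<subseteq> vec.span (columns P)"
    by (intro vec.span_minimal) auto
  then have "vec.span (columns P) = UNIV" using assms by (auto simp: spanning_lines_def)
  then obtain P' where "P ** P' = mat 1" using matrix_right_invertible_span_columns[of P] by auto
  then have "inverse_pair P P'" by (rule inverse_pairI)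
  with that v col show thesis by simp
qed

lemma spanning_lines_columns:
  assumes P: "inverse_pair P P'"
  shows "spanning_lines (\<lambda>i. vec.span {column i P})"
  unfolding spanning_lines_def
proof (intro conjI allI)
  fix i
  show "vec.subspace (vec.span {column i P})" by simp
  have "column i P \<noteq> 0"
  proof
    assume "column i P = 0"
    then have "ax i = (0 :: complex ^ 'a)" using inverse_pairD(8)[OF P, of "ax i"] by (simp add: column_eq)
    then show False by (simp add: axis_eq_0_iff)
  qed
  then show "vec.dim (vec.span {column i P}) = 1" by (simp add: vec.dim_span)
next
  have "\<exists>B. P ** B = mat 1" using P by (auto simp: inverse_pair_def)
  then have "vec.span (columns P) = UNIV" by (simp add: matrix_right_invertible_span_columns)
  moreover have "columns P \<subseteq> (\<Union>i. vec.span {column i P})" by (auto simp: columns_def intro: vec.span_base)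
  ultimately show "vec.span (\<Union>i. vec.span {column i P}) = UNIV" by (metis top.extremum_uniqueI vec.span_mono)
qed

lemma in_span_column: "v \<in> vec.span {column i P} \<longleftrightarrow> (\<exists>t. v = P *v (t *s ax i))"
  by (auto simp: vec.span_singleton column_eq vec.scale)

lemma lines_op_columns:
  assumes "inverse_pair P P'"
  shows "lines_op (\<lambda>i. vec.span {column i P}) c = diagop P P' c"
proof (rule lines_op_eqI[OF _ assms])
  show "diagop P P' c *v v = c $ i *s v" if "v \<in> vec.span {column i P}" for i v
    using that diagop_ax_vec[OF assms] unfolding in_span_column by blast
qed (simp add: vec.span_base)

text \<open>\<open>P' ** P = mat 1\<close> says that column \<open>i\<close> of
  \<open>herm P'\<close> is orthogonal to all columns of \<open>P\<close> but the
  \<open>i\<close>-th, so these columns span the dual lines.\<close>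

lemma lines_op_dual:
  assumes P: "inverse_pair P P'" and l: "\<And>i. l i = vec.span {column i P}"
  shows "lines_op (dual_lines l) c = diagop (herm P') (herm P) c"
proof (rule lines_op_eqI[OF _ inverse_pair_herm[OF P]])
  note H = inverse_pair_herm[OF P]
  show "diagop (herm P') (herm P) c *v v = c $ i *s v" if v: "v \<in> dual_lines l i" for i v
  proof -
    have "(herm P *v v) $ j = 0" if "j \<noteq> i" for j
    proof -
      have "column j P \<in> vec.span (\<Union>j\<in>-{i}. l j)"
        using that by (intro vec.span_base) (auto simp: l intro!: vec.span_base)
      then have "hermitian_inner v (column j P) = 0"
        using v by (auto simp: dual_lines_def orth_complement_def)
      then show ?thesis
        by (simp add: hermitian_inner_def matrix_vector_mult_def herm_nth column_def mult.commute)
    qed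
    then have "herm P *v v = (herm P *v v) $ i *s ax i" by (auto simp: vec_eq_iff)
    then have "v = herm P' *v ((herm P *v v) $ i *s ax i)" by (metis inverse_pairD(7)[OF H])
    then show ?thesis using diagop_ax_vec[OF H] by metis
  qed
  show "column i (herm P') \<in> dual_lines l i" for i
  proof -
    let ?u = "column i (herm P')"
    have "hermitian_inner ?u w = cnj (bil (vmap cnj ?u) w)" for w
      by (simp add: hermitian_inner_def bil_def vmap_def)
    then have "vec.subspace {w. hermitian_inner ?u w = 0}"
      by (intro vec.subspaceI) auto
    moreover have "hermitian_inner ?u w = 0" if w: "w \<in> l j" and "j \<noteq> i" for w j
    proof -
      obtain t where t: "w = t *s column j P" using w unfolding l vec.span_singleton by auto
      have "hermitian_inner ?u w = cnj t * cnj (\<Sum>a\<in>UNIV. P' $ i $ a * P $ a $ j)"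
        by (simp add: hermitian_inner_def t column_def herm_nth sum_distrib_left mult_ac)
      then show ?thesis using inverse_pair_nth(2)[OF P, of i j] that by simp
    qed
    ultimately have "vec.span (\<Union>j\<in>-{i}. l j) \<subseteq> {w. hermitian_inner ?u w = 0}"
      by (intro vec.span_minimal) auto
    then show ?thesis by (auto simp: dual_lines_def orth_complement_def)
  qed
qed

lemma Phi_diagop:
  assumes P: "inverse_pair P P'"
  shows "Phi (diagop P P' c) = diagop (herm P') (herm P) c"
  unfolding Phi_def
proof (rule the_equality)
  show "\<exists>l d. spanning_lines l \<and> diagop P P' c = lines_op l d \<and>
      diagop (herm P') (herm P) c = lines_op (dual_lines l) d"
    using spanning_lines_columns[OF P] lines_op_columns[OF P, of c] lines_op_dual[OF P refl, of c] by metis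
next
  fix B assume "\<exists>l d. spanning_lines l \<and> diagop P P' c = lines_op l d \<and> B = lines_op (dual_lines l) d"
  then obtain l d where l: "spanning_lines l" "diagop P P' c = lines_op l d" "B = lines_op (dual_lines l) d" by blast
  obtain R R' where R: "inverse_pair R R'" "\<And>i. l i = vec.span {column i R}" by (rule spanning_lines_frame[OF l(1)]) blast
  have "l = (\<lambda>i. vec.span {column i R})" using R(2) by auto
  then have "diagop P P' c = diagop R R' d" using l(2) lines_op_columns[OF R(1)] by simp
  \<comment> \<open>\<open>Phi\<close> is the adjoint of a function of the operator: the eigenvalues
    are conjugated first and restored by \<open>herm\<close>. Independence of the frame is then that
    of the functional calculus.\<close>
  then have "diagop P P' (vmap cnj c) = diagop R R' (vmap cnj d)"
    by (rule diagop_transfer[OF P R(1)]) (simp add: vmap_def)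
  then have "herm (diagop P P' (vmap cnj c)) = herm (diagop R R' (vmap cnj d))" by simp
  moreover have "vmap cnj (vmap cnj e) = e" for e :: "complex ^ 'a" by (simp add: vmap_def vec_eq_iff)
  ultimately have "diagop (herm P') (herm P) c = diagop (herm R') (herm R) d"
    by (simp add: mmap_cnj_diagop transpose_diagop)
  then show "B = diagop (herm P') (herm P) c" using l(3) lines_op_dual[OF R] by simp
qed

lemma CS_preserver_compose:
  assumes "CS_preserver_on S \<psi>" "CS_preserver_on S \<alpha>" "\<And>A. A \<in> S \<Longrightarrow> \<psi> A \<in> S"
  shows "CS_preserver_on S (\<lambda>A. \<alpha> (\<psi> A))"
  using assms by (auto simp: CS_preserver_on_def)

lemma conj_diagop: "T ** diagop P P' d ** T' = diagop (T ** P) (P' ** T') d"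
  by (simp add: diagop_def matrix_mul_assoc)

lemma conjugation_preserver:
  fixes \<alpha> :: "complex ^ 'n ^ 'n \<Rightarrow> complex ^ 'n ^ 'n"
  assumes "conjugation \<alpha> \<or> transpose_conjugation \<alpha>"
  shows "CS_preserver_on (ss_with_spectrum_in X) \<alpha>" "continuous_on S \<alpha>"
proof -
  obtain T T' where T: "inverse_pair T T'" and \<alpha>: "\<alpha> = (\<lambda>A. T ** A ** T') \<or> \<alpha> = (\<lambda>A. T ** mtransp A ** T')"
    using assms conjugation_alt transpose_conjugation_alt by blast
  have mult: "T ** A ** T' ** (T ** B ** T') = T ** (A ** B) ** T'" for A B
    using T by (simp add: matrix_mul_assoc inverse_pairD)
  from \<alpha> show "CS_preserver_on (ss_with_spectrum_in X) \<alpha>"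
  proof
    assume \<alpha>: "\<alpha> = (\<lambda>A. T ** A ** T')"
    show ?thesis unfolding CS_preserver_on_def \<alpha> mult
      by (auto simp: ss_with_spectrum_in_iff conj_diagop eigenvalues_diagop inverse_pair_mult[OF T])
  next
    assume \<alpha>: "\<alpha> = (\<lambda>A. T ** mtransp A ** T')"
    show ?thesis unfolding CS_preserver_on_def \<alpha> mult
      by (auto simp: ss_with_spectrum_in_iff conj_diagop eigenvalues_diagop inverse_pair_mult[OF T]
          inverse_pair_transpose transpose_diagop simp flip: matrix_transpose_mul)
  qed
  from \<alpha> show "continuous_on S \<alpha>" by (auto intro!: continuous_intros)
qed

lemma Phi_in_ss: "A \<in> ss_with_spectrum_in X \<Longrightarrow> Phi A \<in> ss_with_spectrum_in X"
  unfolding ss_with_spectrum_in_iff using Phi_diagop inverse_pair_herm by metis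

text \<open>Commutation passes to the complex conjugation applied to both operators by functional
  calculus, and from there to the adjoints.\<close>

lemma Phi_preserver: "CS_preserver_on (ss_with_spectrum_in X) Phi"
  unfolding CS_preserver_on_def
proof (intro conjI ballI impI)
  fix A assume "A \<in> ss_with_spectrum_in X"
  then show "eigenvalues (Phi A) = eigenvalues A"
    by (auto simp: ss_with_spectrum_in_iff Phi_diagop eigenvalues_diagop inverse_pair_herm)
next
  fix A B :: "complex ^ 'a ^ 'a" assume AB: "A \<in> ss_with_spectrum_in X" "B \<in> ss_with_spectrum_in X" "A ** B = B ** A"
  obtain P P' c R R' d where P: "inverse_pair P P'" "A = diagop P P' c" and R: "inverse_pair R R'" "B = diagop R R' d"
    using AB(1,2) by (auto simp: ss_with_spectrum_in_iff)
  have "B ** diagop P P' (vmap cnj c) = diagop P P' (vmap cnj c) ** B"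
    by (rule commute_diagop_transfer[OF P(1)]) (use AB(3) P(2) in \<open>auto simp: vmap_def\<close>)
  then have "diagop P P' (vmap cnj c) ** diagop R R' (vmap cnj d) = diagop R R' (vmap cnj d) ** diagop P P' (vmap cnj c)"
    unfolding R(2) by (intro commute_diagop_transfer[OF R(1) sym]) (simp_all add: vmap_def)
  then have "herm (diagop P P' (vmap cnj c) ** diagop R R' (vmap cnj d)) = herm (diagop R R' (vmap cnj d) ** diagop P P' (vmap cnj c))"
    by simp
  moreover have "vmap cnj (vmap cnj e) = e" for e :: "complex ^ 'a" by (simp add: vmap_def vec_eq_iff)
  ultimately show "Phi A ** Phi B = Phi B ** Phi A"
    unfolding herm_mult P(2) R(2) Phi_diagop[OF P(1)] Phi_diagop[OF R(1)]
    by (simp add: mmap_cnj_diagop transpose_diagop)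
qed

subsection \<open>Divided differences\<close>

text \<open>Lagrange's form of the divided difference, taken on a set of nodes so that symmetry is
  built in.\<close>

definition divdiff :: "(complex \<Rightarrow> complex) \<Rightarrow> complex set \<Rightarrow> complex" where
  "divdiff f S = (\<Sum>z\<in>S. f z / (\<Prod>w\<in>S - {z}. z - w))"

lemma divdiff_remove:
  assumes "finite S" "b \<in> S"
  shows "divdiff f (S - {b}) = (\<Sum>z\<in>S. f z * (z - b) / (\<Prod>w\<in>S - {z}. z - w))"
proof -
  have "f z * (z - b) / (\<Prod>w\<in>S - {z}. z - w) = f z / (\<Prod>w\<in>S - {b} - {z}. z - w)" if "z \<in> S - {b}" for z
  proof -
    have "S - {z} = insert b (S - {b} - {z})" using assms that by auto
    then have "(\<Prod>w\<in>S - {z}. z - w) = (z - b) * (\<Prod>w\<in>S - {b} - {z}. z - w)"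
      using assms(1) by simp
    then show ?thesis using that by simp
  qed
  then have "divdiff f (S - {b}) = (\<Sum>z\<in>S - {b}. f z * (z - b) / (\<Prod>w\<in>S - {z}. z - w))"
    unfolding divdiff_def by (intro sum.cong) auto
  also have "\<dots> = (\<Sum>z\<in>S. f z * (z - b) / (\<Prod>w\<in>S - {z}. z - w))"
    using assms by (intro sum.mono_neutral_left) auto
  finally show ?thesis .
qed

lemma divdiff_rec:
  assumes "finite S" "a \<in> S" "b \<in> S"
  shows "divdiff f S * (a - b) = divdiff f (S - {b}) - divdiff f (S - {a})"
proof -
  have "divdiff f (S - {b}) - divdiff f (S - {a})
      = (\<Sum>z\<in>S. f z * (z - b) / (\<Prod>w\<in>S - {z}. z - w) - f z * (z - a) / (\<Prod>w\<in>S - {z}. z - w))"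
    using assms by (simp add: divdiff_remove sum_subtractf)
  also have "\<dots> = (\<Sum>z\<in>S. f z / (\<Prod>w\<in>S - {z}. z - w) * (a - b))"
    by (rule sum.cong) (auto simp: diff_divide_distrib[symmetric] algebra_simps)
  finally show ?thesis by (simp add: divdiff_def sum_distrib_right)
qed

lemma Delta_eq_divdiff:
  assumes "distinct zs" "length zs = Suc k"
  shows "(Delta ^^ k) (\<lambda>zs. f (hd zs)) zs = divdiff f (set zs)"
  using assms
proof (induction k arbitrary: zs)
  case 0
  then obtain z where "zs = [z]" by (auto simp: length_Suc_conv)
  then show ?case by (simp add: divdiff_def)
next
  case (Suc k)
  then have ne: "zs \<noteq> []" "tl zs \<noteq> []" by (auto simp: length_Suc_conv)
  have hd: "set (tl zs) = set zs - {hd zs}" using ne(1) Suc.prems(1) by (cases zs) auto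
  have last: "set (butlast zs) = set zs - {last zs}"
    using ne(1) Suc.prems(1) by (cases zs rule: rev_cases) auto
  have "last zs = last (tl zs)" using ne by (simp add: last_tl)
  then have "last zs \<in> set (tl zs)" using ne(2) by simp
  then have neq: "last zs \<noteq> hd zs" unfolding hd by auto
  have "(Delta ^^ Suc k) (\<lambda>zs. f (hd zs)) zs
      = (divdiff f (set (tl zs)) - divdiff f (set (butlast zs))) / (last zs - hd zs)"
    using Suc.IH[of "tl zs"] Suc.IH[of "butlast zs"] Suc.prems
      Delta_def[of "(Delta ^^ k) (\<lambda>zs. f (hd zs))" zs]
    by (simp add: distinct_tl distinct_butlast)
  also have "\<dots> = divdiff f (set zs)"
    unfolding hd last using divdiff_rec[of "set zs" "last zs" "hd zs" f] ne neq by (simp add: field_simps)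
  finally show ?case .
qed

text \<open>The remainder is exact, with \<open>x\<close> as an additional node, so no regularity of
  \<open>f\<close> enters.\<close>

lemma newton_remainder:
  fixes k :: nat
  assumes "inj_on z {..<k}" "x \<notin> z ` {..<k}"
  shows "f x = (\<Sum>i<k. divdiff f (z ` {..i}) * (\<Prod>l<i. x - z l))
    + divdiff f (insert x (z ` {..<k})) * (\<Prod>l<k. x - z l)"
  using assms
proof (induction k)
  case 0
  then show ?case by (simp add: divdiff_def)
next
  case (Suc k)
  have IH: "f x = (\<Sum>i<k. divdiff f (z ` {..i}) * (\<Prod>l<i. x - z l))
    + divdiff f (insert x (z ` {..<k})) * (\<Prod>l<k. x - z l)"
    using Suc by (intro Suc.IH) (auto simp: lessThan_Suc)
  have zk: "z k \<notin> z ` {..<k}" using Suc.prems(1) by (auto simp: inj_on_def lessThan_Suc)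
  then have zk': "z i \<noteq> z k" if "i < k" for i using that by (metis imageI lessThan_iff)
  let ?S = "insert x (z ` {..<Suc k})"
  have "?S - {z k} = insert x (z ` {..<k})" "?S - {x} = z ` {..k}"
    using zk' Suc.prems(2) by (auto simp: lessThan_Suc lessThan_Suc_atMost[symmetric])
  then have "divdiff f ?S * (x - z k) = divdiff f (insert x (z ` {..<k})) - divdiff f (z ` {..k})"
    using divdiff_rec[of ?S x "z k" f] by simp
  then have r: "divdiff f (insert x (z ` {..<k})) = divdiff f (z ` {..k}) + divdiff f ?S * (x - z k)"
    by simp
  show ?case by (subst IH, subst r) (simp add: algebra_simps)
qed

lemma newton_interpolation:
  assumes z: "inj_on z {..<n}" and m: "m < (n::nat)"
  shows "f (z m) = (\<Sum>k<n. divdiff f (z ` {..k}) * (\<Prod>l<k. z m - z l))"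
proof -
  have zm: "z m \<notin> z ` {..<m}"
  proof
    assume "z m \<in> z ` {..<m}"
    then obtain i where "i < m" "z m = z i" by auto
    then show False using inj_onD[OF z, of m i] m by simp
  qed
  have "inj_on z {..<m}" using z by (rule inj_on_subset) (use m in auto)
  note newton_remainder[OF this zm, of f]
  also have "insert (z m) (z ` {..<m}) = z ` {..m}" by (auto simp: atMost_Suc lessThan_Suc_atMost[symmetric] lessThan_Suc)
  also have "(\<Sum>i<m. divdiff f (z ` {..i}) * (\<Prod>l<i. z m - z l)) + divdiff f (z ` {..m}) * (\<Prod>l<m. z m - z l)
      = (\<Sum>k<Suc m. divdiff f (z ` {..k}) * (\<Prod>l<k. z m - z l))" by simp
  also have "\<dots> = (\<Sum>k<n. divdiff f (z ` {..k}) * (\<Prod>l<k. z m - z l))"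
    using m by (intro sum.mono_neutral_left) auto
  finally show ?thesis .
qed

text \<open>Here \<open>k\<close> counts the nodes: order \<open>k\<close> in \<open>B_Delta\<close>
  corresponds to \<open>Suc k\<close>.\<close>

definition divdiff_bounded_at :: "complex set \<Rightarrow> (complex \<Rightarrow> complex) \<Rightarrow> nat \<Rightarrow> complex \<Rightarrow> bool" where
  "divdiff_bounded_at X f k z \<longleftrightarrow>
    (\<exists>\<epsilon>>0. \<exists>M. \<forall>S. S \<subseteq> X \<inter> ball z \<epsilon> \<longrightarrow> finite S \<longrightarrow> card S = k \<longrightarrow> norm (divdiff f S) \<le> M)"

lemma Delta_map:
  assumes "inj_on w {..k}"
  shows "(Delta ^^ k) (\<lambda>zs. f (hd zs)) (map w [0..<Suc k]) = divdiff f (w ` {..k})"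
proof -
  have "set [0..<Suc k] = {..k}" by auto
  then show ?thesis
    using Delta_eq_divdiff[of "map w [0..<Suc k]" k f] assms by (simp add: distinct_map del: upt_Suc)
qed

lemma B_Delta_iff:
  "B_Delta k X f \<longleftrightarrow> (\<forall>z\<in>X. z islimpt X \<longrightarrow> divdiff_bounded_at X f (Suc k) z)"
  unfolding B_Delta_def
proof (intro ball_cong imp_cong refl iffI)
  fix z assume z: "z \<in> X"
  assume "\<exists>U. openin (product_topology (\<lambda>_. top_of_set X) {..k}) U \<and> (\<lambda>i\<in>{..k}. z) \<in> U \<and>
    bounded ((\<lambda>w. (Delta ^^ k) (\<lambda>zs. f (hd zs)) (map w [0..<Suc k])) ` {w \<in> U. inj_on w {..k}})"
  then obtain U where U: "openin (product_topology (\<lambda>_. top_of_set X) {..k}) U" "(\<lambda>i\<in>{..k}. z) \<in> U"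
    "bounded ((\<lambda>w. (Delta ^^ k) (\<lambda>zs. f (hd zs)) (map w [0..<Suc k])) ` {w \<in> U. inj_on w {..k}})" by blast
  obtain V where V: "\<And>i. i \<le> k \<Longrightarrow> openin (top_of_set X) (V i)" "(\<lambda>i\<in>{..k}. z) \<in> Pi\<^sub>E {..k} V" "Pi\<^sub>E {..k} V \<subseteq> U"
  proof -
    from U(1) have "\<forall>x\<in>U. \<exists>V. finite {i \<in> {..k}. V i \<noteq> topspace (top_of_set X)} \<and>
        (\<forall>i\<in>{..k}. openin (top_of_set X) (V i)) \<and> x \<in> Pi\<^sub>E {..k} V \<and> Pi\<^sub>E {..k} V \<subseteq> U"
      by (simp only: openin_product_topology_alt)
    from this[rule_format, OF U(2)] show thesis using that by auto
  qed
  have "\<exists>\<epsilon>>0. X \<inter> ball z \<epsilon> \<subseteq> V i" if i: "i \<le> k" for i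
  proof -
    have "z \<in> V i" using V(2) i by (auto simp: PiE_iff)
    then obtain \<epsilon> where "\<epsilon> > 0" "ball z \<epsilon> \<inter> X \<subseteq> V i"
      using V(1)[OF i] unfolding openin_contains_ball by blast
    then show ?thesis by (auto simp: Int_commute)
  qed
  then obtain \<epsilon> where \<epsilon>: "\<And>i. i \<le> k \<Longrightarrow> \<epsilon> i > 0 \<and> X \<inter> ball z (\<epsilon> i) \<subseteq> V i" by metis
  \<comment> \<open>A box may have different sides, whereas a set of nodes comes without an order;
    the smallest radius fits every enumeration.\<close>
  define \<delta> where "\<delta> = Min (\<epsilon> ` {..k})"
  have \<delta>: "\<delta> > 0" "\<And>i. i \<le> k \<Longrightarrow> \<delta> \<le> \<epsilon> i" unfolding \<delta>_def using \<epsilon> by auto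
  obtain M where M: "\<And>w. w \<in> U \<Longrightarrow> inj_on w {..k} \<Longrightarrow> norm (divdiff f (w ` {..k})) \<le> M"
    using U(3) by (auto simp: bounded_iff Delta_map simp del: upt_Suc)
  have "norm (divdiff f S) \<le> M" if S: "S \<subseteq> X \<inter> ball z \<delta>" "finite S" "card S = Suc k" for S
  proof -
    obtain g where g: "bij_betw g {..k} S"
      using finite_same_card_bij[of "{..k}" S] S by auto
    define w where "w = restrict g {..k}"
    have w: "bij_betw w {..k} S" using g unfolding w_def by (simp add: bij_betw_restrict_eq)
    have "w i \<in> V i" if "i \<le> k" for i
    proof -
      have "w i \<in> S" using w that by (auto simp: bij_betw_def)
      then show ?thesis using S(1) \<delta>(2)[OF that] \<epsilon>[OF that] by (auto simp: subset_iff)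
    qed
    then have "w \<in> Pi\<^sub>E {..k} V" by (auto simp: PiE_iff w_def)
    then have "w \<in> U" using V(3) by blast
    then show ?thesis using M w by (auto simp: bij_betw_def)
  qed
  then show "divdiff_bounded_at X f (Suc k) z" unfolding divdiff_bounded_at_def using \<delta>(1) by blast
next
  fix z assume z: "z \<in> X" and "divdiff_bounded_at X f (Suc k) z"
  then obtain \<epsilon> M where \<epsilon>: "\<epsilon> > 0"
    and M: "\<And>S. S \<subseteq> X \<inter> ball z \<epsilon> \<Longrightarrow> finite S \<Longrightarrow> card S = Suc k \<Longrightarrow> norm (divdiff f S) \<le> M"
    unfolding divdiff_bounded_at_def by blast
  let ?U = "Pi\<^sub>E {..k} (\<lambda>_. X \<inter> ball z \<epsilon>)"
  have "openin (product_topology (\<lambda>_. top_of_set X) {..k}) ?U"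
    by (subst openin_PiE) (auto simp: openin_open_Int)
  moreover have "(\<lambda>i\<in>{..k}. z) \<in> ?U" using z \<epsilon> by auto
  moreover have "norm (divdiff f (w ` {..k})) \<le> M" if "w \<in> ?U" "inj_on w {..k}" for w
    using that by (intro M) (auto simp: card_image PiE_iff)
  then have "bounded ((\<lambda>w. (Delta ^^ k) (\<lambda>zs. f (hd zs)) (map w [0..<Suc k])) ` {w \<in> ?U. inj_on w {..k}})"
    unfolding bounded_iff by (intro exI[of _ M]) (auto simp: Delta_map simp del: upt_Suc)
  ultimately show "\<exists>U. openin (product_topology (\<lambda>_. top_of_set X) {..k}) U \<and> (\<lambda>i\<in>{..k}. z) \<in> U \<and>
    bounded ((\<lambda>w. (Delta ^^ k) (\<lambda>zs. f (hd zs)) (map w [0..<Suc k])) ` {w \<in> U. inj_on w {..k}})" by blast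
qed

lemma perfect_infinite_ball:
  assumes "perfect_space X" "z \<in> X" "\<epsilon> > 0" shows "infinite (X \<inter> ball z \<epsilon>)"
proof -
  have "z islimpt X" using assms by (auto simp: perfect_space_def islimpt_in_closure)
  then show ?thesis using assms(3) by (auto simp: islimpt_eq_infinite_ball)
qed

text \<open>Exchanging one node at a time changes a divided difference by a difference of nodes times a
  divided difference of the next order.\<close>

lemma divdiff_bounded_at_lower:
  assumes X: "perfect_space X" "z \<in> X" and "divdiff_bounded_at X f (Suc k) z"
  shows "divdiff_bounded_at X f k z"
proof -
  obtain \<epsilon> M where \<epsilon>: "\<epsilon> > 0"
    and M: "\<And>S. S \<subseteq> X \<inter> ball z \<epsilon> \<Longrightarrow> finite S \<Longrightarrow> card S = Suc k \<Longrightarrow> norm (divdiff f S) \<le> M"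
    using assms(3) unfolding divdiff_bounded_at_def by blast
  have M0: "M \<ge> 0"
  proof -
    obtain T where "T \<subseteq> X \<inter> ball z \<epsilon>" "finite T" "card T = Suc k"
      using infinite_arbitrarily_large[OF perfect_infinite_ball[OF X \<epsilon>]] by metis
    then show ?thesis using M[of T] norm_ge_zero order_trans by blast
  qed
  obtain S0 where S0: "S0 \<subseteq> X \<inter> ball z \<epsilon>" "finite S0" "card S0 = k"
    using infinite_arbitrarily_large[OF perfect_infinite_ball[OF X \<epsilon>]] by metis
  \<comment> \<open>Induction on the number of nodes outside the fixed set \<open>S0\<close>; one
    exchange costs at most \<open>M\<close> times the diameter
    \<open>2 * \<epsilon>\<close>.\<close>
  have *: "norm (divdiff f S) \<le> norm (divdiff f S0) + real d * (2 * \<epsilon> * M)"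
    if "S \<subseteq> X \<inter> ball z \<epsilon>" "finite S" "card S = k" "card (S - S0) = d" for d S
    using that
  proof (induction d arbitrary: S)
    case 0
    then have "S \<subseteq> S0" by simp
    then have "S = S0" using S0 0 by (intro card_subset_eq) auto
    then show ?case by simp
  next
    case (Suc d)
    then have "S - S0 \<noteq> {}" by force
    then obtain a where a: "a \<in> S" "a \<notin> S0" by blast
    have "\<not> S0 \<subseteq> S" using a S0 Suc.prems card_subset_eq[of S S0] by auto
    then obtain b where b: "b \<in> S0" "b \<notin> S" by blast
    define S' where "S' = insert b (S - {a})"
    define T where "T = insert b S"
    have S': "S' \<subseteq> X \<inter> ball z \<epsilon>" "finite S'" using Suc.prems S0 b by (auto simp: S'_def)
    have "card S' = k" unfolding S'_def using a b Suc.prems card_Suc_Diff1[of S a] by simp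
    moreover have "S' - S0 = S - S0 - {a}" using b by (auto simp: S'_def)
    then have "card (S' - S0) = d" using a Suc.prems by simp
    ultimately have IH: "norm (divdiff f S') \<le> norm (divdiff f S0) + real d * (2 * \<epsilon> * M)"
      using S' by (intro Suc.IH)
    have T: "norm (divdiff f T) \<le> M"
      using Suc.prems S0 b by (intro M) (auto simp: T_def)
    have "divdiff f T * (a - b) = divdiff f (T - {b}) - divdiff f (T - {a})"
      using Suc.prems a by (intro divdiff_rec) (auto simp: T_def)
    also have "T - {b} = S" using b by (auto simp: T_def)
    also have "T - {a} = S'" using a b by (auto simp: T_def S'_def)
    finally have "divdiff f S = divdiff f S' + divdiff f T * (a - b)" by simp
    then have "norm (divdiff f S) \<le> norm (divdiff f S') + norm (divdiff f T) * norm (a - b)"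
      by (metis norm_mult norm_triangle_ineq)
    also have "norm (divdiff f T) * norm (a - b) \<le> M * (2 * \<epsilon>)"
    proof (intro mult_mono T M0)
      have "dist a z < \<epsilon>" "dist b z < \<epsilon>" using a b Suc.prems S0 by (auto simp: dist_commute)
      then show "norm (a - b) \<le> 2 * \<epsilon>" using dist_triangle2[of a b z] by (simp add: dist_norm)
    qed simp
    finally show ?case using IH by (simp add: algebra_simps)
  qed
  have "norm (divdiff f S) \<le> norm (divdiff f S0) + real k * (2 * \<epsilon> * M)"
    if S: "S \<subseteq> X \<inter> ball z \<epsilon>" "finite S" "card S = k" for S
  proof -
    have "card (S - S0) \<le> k" using S by (metis card_Diff_subset_Int card_mono Diff_subset)
    then have "real (card (S - S0)) * (2 * \<epsilon> * M) \<le> real k * (2 * \<epsilon> * M)"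
      using \<epsilon> M0 by (intro mult_right_mono) auto
    then show ?thesis using *[OF S refl] by linarith
  qed
  then show ?thesis unfolding divdiff_bounded_at_def using \<epsilon> by blast
qed

text \<open>If two nodes have different limits, the recursion removes either of them with a
  denominator that does not tend to zero. If all limits agree, the local bound at that point
  applies.\<close>

lemma divdiff_bounded_along_sequence:
  fixes z :: "nat \<Rightarrow> nat \<Rightarrow> complex"
  assumes bd: "\<And>k a. 0 < k \<Longrightarrow> k \<le> n \<Longrightarrow> a \<in> X \<Longrightarrow> divdiff_bounded_at X f k a"
    and z: "\<And>m i. i < n \<Longrightarrow> z m i \<in> X" "\<And>m. inj_on (z m) {..<n}"
    and w: "\<And>i. i < n \<Longrightarrow> w i \<in> X" "\<And>i. i < n \<Longrightarrow> (\<lambda>m. z m i) \<longlonglongrightarrow> w i"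
    and "I \<subseteq> {..<n}" "I \<noteq> {}"
  shows "Bseq (\<lambda>m. divdiff f (z m ` I))"
proof -
  have "finite I" using \<open>I \<subseteq> {..<n}\<close> finite_subset by blast
  then show ?thesis using assms(6,7)
  proof (induction "card I" arbitrary: I rule: less_induct)
    case less
    show ?case
    proof (cases "\<exists>i\<in>I. \<exists>j\<in>I. w i \<noteq> w j")
      case False
      obtain i0 where i0: "i0 \<in> I" using less.prems by blast
      have cI: "0 < card I" "card I \<le> n"
        using less.prems card_mono[of "{..<n}" I] by (auto simp: card_gt_0_iff)
      obtain \<epsilon> M where \<epsilon>: "\<epsilon> > 0"
        and M: "\<And>S. S \<subseteq> X \<inter> ball (w i0) \<epsilon> \<Longrightarrow> finite S \<Longrightarrow> card S = card I \<Longrightarrow> norm (divdiff f S) \<le> M"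
        using bd[OF cI, of "w i0"] w(1) i0 less.prems unfolding divdiff_bounded_at_def by blast
      have "eventually (\<lambda>m. dist (z m i) (w i0) < \<epsilon>) sequentially" if "i \<in> I" for i
      proof -
        have "w i = w i0" using False that i0 by blast
        then show ?thesis using tendstoD[OF w(2)[of i] \<epsilon>] that less.prems by auto
      qed
      then have "eventually (\<lambda>m. \<forall>i\<in>I. dist (z m i) (w i0) < \<epsilon>) sequentially"
        using less.prems(1) by (simp add: eventually_ball_finite)
      then have "eventually (\<lambda>m. norm (divdiff f (z m ` I)) \<le> M) sequentially"
      proof eventually_elim
        case (elim m)
        have "inj_on (z m) I" using z(2) less.prems(2) by (rule inj_on_subset)
        then show ?case
          using elim z(1) less.prems by (intro M) (auto simp: card_image dist_commute)
      qed
      then show ?thesis by (rule BfunI)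
    next
      case True
      then obtain i j where ij: "i \<in> I" "j \<in> I" "w i \<noteq> w j" by blast
      then have ne: "i \<noteq> j" by auto
      have sub: "Bseq (\<lambda>m. divdiff f (z m ` (I - {l})))" if "l = i \<or> l = j" for l
      proof (rule less.hyps)
        show "card (I - {l}) < card I" using that ij less.prems(1) by (intro psubset_card_mono) auto
        show "I - {l} \<noteq> {}" using that ij ne by auto
      qed (use less.prems in auto)
      have "(\<lambda>m. inverse (z m i - z m j)) \<longlonglongrightarrow> inverse (w i - w j)"
        using ij less.prems by (intro tendsto_intros w(2)) auto
      then have B: "Bseq (\<lambda>m. inverse (z m i - z m j))" by (rule convergentI[THEN convergent_imp_Bseq])
      have "divdiff f (z m ` I) = (divdiff f (z m ` (I - {j})) - divdiff f (z m ` (I - {i}))) * inverse (z m i - z m j)" for m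
      proof -
        have inj: "inj_on (z m) I" using z(2) less.prems(2) by (rule inj_on_subset)
        have "z m ` (I - {l}) = z m ` I - {z m l}" if "l \<in> I" for l
          using inj_on_image_set_diff[OF inj, of I "{l}"] that by auto
        moreover have "z m i \<noteq> z m j" using inj ij ne by (auto simp: inj_on_def)
        ultimately show ?thesis
          using divdiff_rec[of "z m ` I" "z m i" "z m j" f] ij less.prems(1) by (simp add: field_simps)
      qed
      moreover have "Bseq (\<lambda>m. divdiff f (z m ` (I - {j})) - divdiff f (z m ` (I - {i})))"
      proof -
        obtain K1 K2 where "\<And>m. norm (divdiff f (z m ` (I - {j}))) \<le> K1" "\<And>m. norm (divdiff f (z m ` (I - {i}))) \<le> K2"
          using sub[of j] sub[of i] by (metis BseqE)
        then show ?thesis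
          by (intro BseqI'[of _ "K1 + K2"]) (meson add_mono norm_triangle_ineq4 order_trans)
      qed
      ultimately show ?thesis using Bseq_mult[OF _ B] by simp
    qed
  qed
qed

subsection \<open>Continuity of the dual-lines map\<close>

lemma diagop_sum: "diagop P P' (\<Sum>k\<in>S. g k) = (\<Sum>k\<in>S. diagop P P' (g k))"
proof (induction S rule: infinite_finite_induct)
  case (insert k S)
  then show ?case by (simp add: diagop_add)
qed (simp_all add: matrix_eq_iff diagop_nth)

lemma det_diagop_minus:
  assumes "inverse_pair P P'"
  shows "det (diagop P P' d - mat t) = (\<Prod>k\<in>UNIV. d $ k - t)"
proof -
  have "diagop P P' d - mat t = diagop P P' (d - (\<chi> k. t))"
    by (simp add: diagop_diff diagop_const[OF assms])
  moreover have "det P * det P' = 1" using assms by (metis det_I det_mul inverse_pairD(1))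
  moreover have "det (cdiag e) = (\<Prod>k\<in>UNIV. e $ k)" for e :: "complex ^ 'a"
    by (subst det_diagonal) auto
  ultimately show ?thesis by (simp add: diagop_def det_mul mult_ac)
qed

lemma bounded_eigenvalues:
  fixes B :: "nat \<Rightarrow> complex ^ 'n ^ 'n" and c :: "nat \<Rightarrow> complex ^ 'n"
  assumes B: "B \<longlonglongrightarrow> A" and eig: "\<And>m i. c m $ i \<in> eigenvalues (B m)"
  shows "bounded (range c)"
proof -
  have "Bseq B" using B by (rule convergentI[THEN convergent_imp_Bseq])
  then obtain K where K: "K > 0" "\<And>m. norm (B m) \<le> K" by (rule BseqE) blast
  have "norm (c m $ i) \<le> CARD('n) * K" for m i
  proof -
    obtain v where v: "v \<noteq> 0" "B m *v v = c m $ i *s v" using eig[of m i] by (auto simp: eigenvalues_def)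
    \<comment> \<open>The eigenvalue equation is estimated at a largest coordinate of the
      eigenvector.\<close>
    obtain k where k: "\<And>j. norm (v $ j) \<le> norm (v $ k)"
    proof -
      have "Max (range (\<lambda>j. norm (v $ j))) \<in> range (\<lambda>j. norm (v $ j))" by (intro Max_in) auto
      then obtain k where "Max (range (\<lambda>j. norm (v $ j))) = norm (v $ k)" by (rule rangeE)
      then have "norm (v $ j) \<le> norm (v $ k)" for j by (metis Max_ge finite finite_imageI rangeI)
      with that show thesis by blast
    qed
    have vk: "norm (v $ k) > 0"
    proof (rule ccontr)
      assume "\<not> ?thesis"
      then have "v $ j = 0" for j using k[of j] by simp
      then show False using v by (simp add: vec_eq_iff)
    qed
    have "c m $ i * v $ k = (\<Sum>j\<in>UNIV. B m $ k $ j * v $ j)"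
      using v(2) by (simp add: vec_eq_iff matrix_vector_mult_def)
    then have "norm (c m $ i) * norm (v $ k) \<le> (\<Sum>j\<in>UNIV. norm (B m $ k $ j * v $ j))"
      by (metis norm_mult norm_sum)
    also have "\<dots> \<le> (\<Sum>j\<in>(UNIV :: 'n set). K * norm (v $ k))"
    proof (rule sum_mono)
      fix j
      have "norm (B m $ k $ j) \<le> K"
        using Finite_Cartesian_Product.norm_nth_le[of "B m $ k" j] Finite_Cartesian_Product.norm_nth_le[of "B m" k] K(2)[of m]
        by linarith
      then show "norm (B m $ k $ j * v $ j) \<le> K * norm (v $ k)"
        unfolding norm_mult using k[of j] K(1) by (intro mult_mono) auto
    qed
    finally have "norm (c m $ i) * norm (v $ k) \<le> (CARD('n) * K) * norm (v $ k)" by simp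
    then show ?thesis using vk by simp
  qed
  then have "norm (c m) \<le> (\<Sum>i\<in>(UNIV :: 'n set). CARD('n) * K)" for m
    unfolding norm_vec_def by (intro order_trans[OF L2_set_le_sum] sum_mono) auto
  then show ?thesis by (auto intro: boundedI)
qed

lemma enumerate_index:
  obtains e :: "nat \<Rightarrow> 'n::finite" where "bij_betw e {..<CARD('n)} UNIV"
  using ex_bij_betw_nat_finite[of "UNIV :: 'n set"] by (auto simp: atLeast0LessThan)

text \<open>Newton's formula passes to the limit along a subsequence: the nodes and the (bounded)
  divided differences converge, and the limit polynomial still interpolates \<open>f\<close> at the limit nodes,
  which contain all eigenvalues of the limit operator.\<close>

lemma functional_calculus_subsequence:
  fixes R R' :: "nat \<Rightarrow> complex ^ 'n ^ 'n"
  assumes bd: "\<And>k a. 0 < k \<Longrightarrow> k \<le> CARD('n) \<Longrightarrow> a \<in> X \<Longrightarrow> divdiff_bounded_at X f k a"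
    and f: "continuous_on UNIV f"
    and R: "\<And>m. inverse_pair (R m) (R' m)" and c: "\<And>m. c m \<in> config X"
    and B: "(\<lambda>m. diagop (R m) (R' m) (c m)) \<longlonglongrightarrow> diagop P P' a"
    and P: "inverse_pair P P'" and a: "a \<in> tuples X"
  obtains r where "strict_mono (r :: nat \<Rightarrow> nat)"
    "(\<lambda>m. diagop (R (r m)) (R' (r m)) (vmap f (c (r m)))) \<longlonglongrightarrow> diagop P P' (vmap f a)"
proof -
  let ?n = "CARD('n)"
  obtain e where e: "bij_betw e {..<?n} (UNIV :: 'n set)" by (rule enumerate_index)
  have "bounded (range c)"
    by (rule bounded_eigenvalues[OF B]) (simp add: eigenvalues_diagop[OF R])
  then obtain w r1 where r1: "strict_mono r1" "(c \<circ> r1) \<longlonglongrightarrow> w"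
    using bounded_imp_convergent_subsequence by blast
  define z where "z = (\<lambda>m l. c (r1 m) $ e l)"
  have zlim: "(\<lambda>m. z m l) \<longlonglongrightarrow> w $ e l" for l
    using tendsto_vec_nth[OF r1(2), of "e l"] by (simp add: z_def o_def)
  have zinj: "inj_on (z m) {..<?n}" for m
    using e config_inj[OF c] unfolding z_def bij_betw_def inj_on_def by metis
  have B1: "(\<lambda>m. diagop (R (r1 m)) (R' (r1 m)) (c (r1 m))) \<longlonglongrightarrow> diagop P P' a"
    using LIMSEQ_subseq_LIMSEQ[OF B r1(1)] by (simp add: o_def)
  \<comment> \<open>\<open>X\<close> is not assumed closed: a limit node lies in it because the
    vanishing determinant passes to the limit, making the node an eigenvalue of the limit
    operator.\<close>
  have wX: "w $ i \<in> X" for i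
  proof -
    have "(\<lambda>m. det (diagop (R (r1 m)) (R' (r1 m)) (c (r1 m)) - mat (c (r1 m) $ i)))
        \<longlonglongrightarrow> det (diagop P P' a - mat (w $ i))"
      unfolding det_def
      by (intro tendsto_intros tendsto_vec_nth B1 tendsto_mat r1(2)[unfolded o_def])
    moreover have "det (diagop (R (r1 m)) (R' (r1 m)) (c (r1 m)) - mat (c (r1 m) $ i)) = 0" for m
      unfolding det_diagop_minus[OF R] by (rule prod_zero) auto
    ultimately have "det (diagop P P' a - mat (w $ i)) = 0" by (simp add: LIMSEQ_const_iff)
    then obtain k where "a $ k = w $ i" unfolding det_diagop_minus[OF P] by auto
    then show ?thesis using a by (metis (mono_tags) mem_Collect_eq tuples_def)
  qed
  define g where "g = inv_into {..<?n} e"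
  have g: "g i < ?n" for i
    using bij_betw_apply[OF bij_betw_inv_into[OF e], of i] by (simp add: g_def)
  have ge: "g (e k) = k" if "k < ?n" for k
    unfolding g_def using that by (intro bij_betw_inv_into_left[OF e]) simp
  \<comment> \<open>All Newton coefficients are packed into one vector, so that a single subsequence
    makes them converge together.\<close>
  define D where "D = (\<lambda>m. \<chi> i. divdiff f (z m ` {..g i}))"
  have "bounded (range D)"
  proof -
    have "Bseq (\<lambda>m. divdiff f (z m ` {..k}))" if "k < ?n" for k
      using zinj wX zlim c that
      by (intro divdiff_bounded_along_sequence[OF bd, where w = "\<lambda>l. w $ e l"])
         (auto simp: z_def config_def tuples_def)
    then have "\<exists>K. \<forall>m. norm (D m $ i) \<le> K" for i
      using g[of i] by (auto simp: D_def elim!: BseqE)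
    then obtain K where K: "\<And>i m. norm (D m $ i) \<le> K i" by metis
    have "norm (D m) \<le> (\<Sum>i\<in>UNIV. K i)" for m
      unfolding norm_vec_def by (intro order_trans[OF L2_set_le_sum] sum_mono K) auto
    then show ?thesis by (auto intro: boundedI)
  qed
  then obtain \<delta> r2 where r2: "strict_mono r2" "(D \<circ> r2) \<longlonglongrightarrow> \<delta>"
    using bounded_imp_convergent_subsequence by blast
  define d where "d = (\<lambda>k. \<delta> $ e k)"
  have dlim: "(\<lambda>m. divdiff f (z (r2 m) ` {..k})) \<longlonglongrightarrow> d k" if "k < ?n" for k
    using tendsto_vec_nth[OF r2(2), of "e k"] ge[OF that] by (simp add: d_def D_def o_def)
  define r where "r = r1 \<circ> r2"
  have r: "strict_mono r" unfolding r_def using r1(1) r2(1) by (rule strict_mono_o)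
  have z2: "(\<lambda>m. z (r2 m) l) \<longlonglongrightarrow> w $ e l" for l
    using LIMSEQ_subseq_LIMSEQ[OF zlim r2(1), of l] by (simp add: o_def)
  let ?B = "\<lambda>m. diagop (R (r m)) (R' (r m)) (c (r m))"
  have B2: "(\<lambda>m. ?B m) \<longlonglongrightarrow> diagop P P' a"
    using LIMSEQ_subseq_LIMSEQ[OF B r] by (simp add: o_def)
  have fw: "f (w $ e l) = (\<Sum>k<?n. d k * (\<Prod>j<k. w $ e l - w $ e j))" if l: "l < ?n" for l
  proof -
    have "(\<lambda>m. \<Sum>k<?n. divdiff f (z (r2 m) ` {..k}) * (\<Prod>j<k. z (r2 m) l - z (r2 m) j))
        \<longlonglongrightarrow> (\<Sum>k<?n. d k * (\<Prod>j<k. w $ e l - w $ e j))"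
      by (intro tendsto_intros dlim z2) auto
    moreover have "(\<Sum>k<?n. divdiff f (z (r2 m) ` {..k}) * (\<Prod>j<k. z (r2 m) l - z (r2 m) j)) = f (z (r2 m) l)" for m
      by (rule newton_interpolation[OF zinj l, symmetric])
    moreover have "(\<lambda>m. f (z (r2 m) l)) \<longlonglongrightarrow> f (w $ e l)"
      using continuous_on_tendsto_compose[OF f z2] by simp
    ultimately show ?thesis using LIMSEQ_unique[OF \<open>(\<lambda>m. f (z (r2 m) l)) \<longlonglongrightarrow> f (w $ e l)\<close>] by simp
  qed
  have newton: "diagop (R (r m)) (R' (r m)) (vmap f (c (r m)))
      = (\<Sum>k<?n. cscale (divdiff f (z (r2 m) ` {..k})) (lprod (?B m) (z (r2 m)) k))" for m
  proof -
    have "vmap f (c (r m)) = (\<Sum>k<?n. divdiff f (z (r2 m) ` {..k}) *s (\<chi> i. \<Prod>l<k. c (r m) $ i - z (r2 m) l))"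
    proof -
      have "f (c (r m) $ i) = (\<Sum>k<?n. divdiff f (z (r2 m) ` {..k}) * (\<Prod>l<k. c (r m) $ i - z (r2 m) l))" for i
      proof -
        obtain l where l: "l < ?n" "i = e l" using e by (auto simp: bij_betw_def)
        show ?thesis
          using newton_interpolation[OF zinj l(1), of f "r2 m"] by (simp add: l(2) z_def r_def)
      qed
      then show ?thesis by (simp add: vec_eq_iff vmap_def sum_component)
    qed
    then show ?thesis by (simp add: diagop_sum diagop_scale lprod_diagop[OF R])
  qed
  have "(\<lambda>m. \<Sum>k<?n. cscale (divdiff f (z (r2 m) ` {..k})) (lprod (?B m) (z (r2 m)) k))
      \<longlonglongrightarrow> (\<Sum>k<?n. cscale (d k) (lprod (diagop P P' a) (\<lambda>l. w $ e l) k))"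
    unfolding cscale_def
    by (intro tendsto_sum tendsto_vec_lambda tendsto_mult dlim tendsto_vec_nth tendsto_lprod B2 z2) auto
  also have "(\<Sum>k<?n. cscale (d k) (lprod (diagop P P' a) (\<lambda>l. w $ e l) k)) = diagop P P' (vmap f a)"
  proof -
    \<comment> \<open>Each operator is annihilated by the full product over its nodes, hence so is
      the limit. Every \<open>a $ i\<close> is therefore a limit node, where the limit polynomial is
      known to interpolate.\<close>
    have "(\<lambda>m. lprod (?B m) (z (r2 m)) ?n)
        \<longlonglongrightarrow> lprod (diagop P P' a) (\<lambda>l. w $ e l) ?n"
      by (intro tendsto_lprod B2 z2)
    moreover have "lprod (?B m) (z (r2 m)) ?n = 0" for m
    proof -
      have 0: "(\<Prod>l<?n. c (r m) $ i - z (r2 m) l) = 0" for i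
      proof -
        obtain l where "l < ?n" "i = e l" using e by (auto simp: bij_betw_def)
        then show ?thesis by (intro prod_zero) (auto simp: z_def r_def)
      qed
      show ?thesis unfolding lprod_diagop[OF R] 0 by (simp add: matrix_eq_iff diagop_nth)
    qed
    ultimately have "lprod (diagop P P' a) (\<lambda>l. w $ e l) ?n = 0" by (simp add: LIMSEQ_const_iff)
    then have "diagop P P' (\<chi> i. \<Prod>l<?n. a $ i - w $ e l) = diagop P P' 0"
      unfolding lprod_diagop[OF P] by (simp add: matrix_eq_iff diagop_nth)
    then have "(\<chi> i. \<Prod>l<?n. a $ i - w $ e l) = 0" by (rule diagop_inject[OF P])
    then have "(\<Prod>l<?n. a $ i - w $ e l) = 0" for i by (simp add: vec_eq_iff)
    then have al: "\<exists>l<?n. a $ i = w $ e l" for i by (auto simp: prod_zero_iff)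
    have "f (a $ i) = (\<Sum>k<?n. d k * (\<Prod>j<k. a $ i - w $ e j))" for i
    proof -
      obtain l where "l < ?n" "a $ i = w $ e l" using al by blast
      then show ?thesis using fw by simp
    qed
    then have "vmap f a = (\<Sum>k<?n. d k *s (\<chi> i. \<Prod>l<k. a $ i - w $ e l))"
      by (simp add: vec_eq_iff vmap_def sum_component)
    then show ?thesis by (simp add: diagop_sum diagop_scale lprod_diagop[OF P])
  qed
  finally show thesis using that[OF r] by (simp add: newton)
qed

lemma Phi_eq_herm: "inverse_pair P P' \<Longrightarrow> Phi (diagop P P' c) = herm (diagop P P' (vmap cnj c))"
  by (simp add: Phi_diagop mmap_cnj_diagop transpose_diagop) (simp add: vmap_def)

lemma tendsto_herm:
  fixes F :: "'a filter" and g :: "'a \<Rightarrow> complex ^ 'n ^ 'n"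
  shows "(g \<longlongrightarrow> A) F \<Longrightarrow> ((\<lambda>x. herm (g x)) \<longlongrightarrow> herm A) F"
  unfolding transpose_def mmap_def by (intro tendsto_vec_lambda) (auto intro!: tendsto_intros tendsto_vec_nth)

text \<open>A subsequence staying away from the limit would have a further subsequence that
  converges to it.\<close>

lemma Phi_tendsto_simple:
  fixes R R' :: "nat \<Rightarrow> complex ^ 'n ^ 'n"
  assumes bd: "\<And>k a. 0 < k \<Longrightarrow> k \<le> CARD('n) \<Longrightarrow> a \<in> X \<Longrightarrow> divdiff_bounded_at X cnj k a"
    and R: "\<And>m. inverse_pair (R m) (R' m)" and c: "\<And>m. c m \<in> config X"
    and B: "(\<lambda>m. diagop (R m) (R' m) (c m)) \<longlonglongrightarrow> A" and A: "A \<in> ss_with_spectrum_in X"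
  shows "(\<lambda>m. Phi (diagop (R m) (R' m) (c m))) \<longlonglongrightarrow> Phi A"
proof (rule ccontr)
  let ?\<Phi> = "\<lambda>m. Phi (diagop (R m) (R' m) (c m))"
  obtain P P' a where P: "inverse_pair P P'" "a \<in> tuples X" "A = diagop P P' a"
    using A by (auto simp: ss_with_spectrum_in_iff)
  assume "\<not> ?\<Phi> \<longlonglongrightarrow> Phi A"
  then obtain \<epsilon> where \<epsilon>: "\<epsilon> > 0" "\<exists>\<^sub>F m in sequentially. dist (?\<Phi> m) (Phi A) \<ge> \<epsilon>"
    unfolding tendsto_iff not_all not_imp not_eventually by (auto simp: not_less)
  then obtain s :: "nat \<Rightarrow> nat" where s: "strict_mono s" "\<And>m. dist (?\<Phi> (s m)) (Phi A) \<ge> \<epsilon>"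
  proof -
    have "infinite {m. dist (?\<Phi> m) (Phi A) \<ge> \<epsilon>}"
      using \<epsilon>(2) by (simp add: frequently_cofinite flip: cofinite_eq_sequentially)
    from infinite_enumerate[OF this] obtain s :: "nat \<Rightarrow> nat" where "strict_mono s"
      "\<forall>m. s m \<in> {m. dist (?\<Phi> m) (Phi A) \<ge> \<epsilon>}" by blast
    then show thesis by (intro that) auto
  qed
  have "(\<lambda>m. diagop (R (s m)) (R' (s m)) (c (s m))) \<longlonglongrightarrow> diagop P P' a"
    using LIMSEQ_subseq_LIMSEQ[OF B s(1)] by (simp add: o_def P(3))
  then obtain r :: "nat \<Rightarrow> nat" where r: "strict_mono r"
    "(\<lambda>m. diagop (R (s (r m))) (R' (s (r m))) (vmap cnj (c (s (r m))))) \<longlonglongrightarrow> diagop P P' (vmap cnj a)"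
  proof -
    assume lim: "(\<lambda>m. diagop (R (s m)) (R' (s m)) (c (s m))) \<longlonglongrightarrow> diagop P P' a"
    show thesis
      by (rule functional_calculus_subsequence[where f = cnj, OF bd _ R c lim P(1,2)])
         (use that in \<open>auto intro!: continuous_intros\<close>)
  qed
  then have "(\<lambda>m. ?\<Phi> (s (r m))) \<longlonglongrightarrow> Phi A"
    unfolding Phi_eq_herm[OF R] P(3) Phi_eq_herm[OF P(1)] by (intro tendsto_herm)
  then have "eventually (\<lambda>m. dist (?\<Phi> (s (r m))) (Phi A) < \<epsilon>) sequentially" using \<epsilon>(1) by (rule tendstoD)
  then show False using s(2) by (auto simp: eventually_sequentially not_less[symmetric])
qed

lemma continuous_on_Phi:
  assumes X: "perfect_space X" and B: "B_Delta (CARD('n) - 1) X cnj"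
  shows "continuous_on (ss_with_spectrum_in X) (Phi :: complex ^ 'n ^ 'n \<Rightarrow> complex ^ 'n ^ 'n)"
proof -
  have lp: "a islimpt X" if "a \<in> X" for a
    using X that by (auto simp: perfect_space_def islimpt_in_closure)
  have bd: "divdiff_bounded_at X cnj k a" if "0 < k" "k \<le> CARD('n)" "a \<in> X" for k a
    using that(2)
  proof (induction rule: inc_induct)
    case base
    then show ?case using B lp[OF that(3)] that(3) by (auto simp: B_Delta_iff)
  next
    case (step k)
    then show ?case using divdiff_bounded_at_lower[OF X that(3)] by blast
  qed
  show ?thesis
    unfolding continuous_on_sequentially
  proof (intro ballI allI impI, elim conjE)
    fix A :: "complex ^ 'n ^ 'n" and As
    assume A: "A \<in> ss_with_spectrum_in X" and As: "\<forall>m. As m \<in> ss_with_spectrum_in X" "As \<longlonglongrightarrow> A"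
    \<comment> \<open>Along a fixed frame the operator and its image under \<open>Phi\<close> both
      depend continuously on the eigenvalues, so both are approximated at once by operators with
      simple spectrum.\<close>
    have "\<exists>R R' c. inverse_pair R R' \<and> c \<in> config X \<and> dist (diagop R R' c) (As m) < inverse (Suc m)
        \<and> dist (Phi (diagop R R' c)) (Phi (As m)) < inverse (Suc m)" for m
    proof -
      obtain R R' b where R: "inverse_pair R R'" "b \<in> tuples X" "As m = diagop R R' b"
        using As(1)[rule_format, of m] unfolding ss_with_spectrum_in_iff by blast
      let ?g = "\<lambda>c. (diagop R R' c, Phi (diagop R R' c))"
      have "continuous_on UNIV ?g"
        unfolding Phi_diagop[OF R(1)] by (intro continuous_intros)
      then obtain \<delta> where \<delta>: "\<delta> > 0" "\<And>c. dist c b < \<delta> \<Longrightarrow> dist (?g c) (?g b) < inverse (Suc m)"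
        unfolding continuous_on_iff by (metis UNIV_I inverse_positive_iff_positive of_nat_0_less_iff zero_less_Suc)
      obtain c where c: "c \<in> config X" "dist c b < \<delta>"
        using perfect_dense_config[OF X R(2)] \<delta>(1) unfolding closure_approachable by blast
      have "dist (fst (?g c)) (fst (?g b)) < inverse (Suc m)" "dist (snd (?g c)) (snd (?g b)) < inverse (Suc m)"
        using \<delta>(2)[OF c(2)] dist_fst_le[of "?g c" "?g b"] dist_snd_le[of "?g c" "?g b"] by linarith+
      then show ?thesis using R c(1) by auto
    qed
    then obtain R R' c where R: "\<And>m. inverse_pair (R m) (R' m)" "\<And>m. c m \<in> config X"
      and d1: "\<And>m. dist (diagop (R m) (R' m) (c m)) (As m) < inverse (Suc m)"
      and d2: "\<And>m. dist (Phi (diagop (R m) (R' m) (c m))) (Phi (As m)) < inverse (Suc m)" by metis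
    have transfer: "V \<longlonglongrightarrow> L" if "U \<longlonglongrightarrow> L" "\<And>m. dist (U m) (V m) < inverse (Suc m)"
      for U V :: "nat \<Rightarrow> complex ^ 'n ^ 'n" and L
    proof -
      have "(\<lambda>m. dist (U m) (V m)) \<longlonglongrightarrow> 0"
        by (rule tendsto_sandwich[OF _ _ tendsto_const LIMSEQ_inverse_real_of_nat])
           (use that(2) in \<open>auto intro!: always_eventually less_imp_le\<close>)
      then have "(\<lambda>m. U m - V m) \<longlonglongrightarrow> 0" by (simp add: dist_norm tendsto_norm_zero_iff)
      from tendsto_diff[OF that(1) this] show ?thesis by simp
    qed
    have lim: "(\<lambda>m. diagop (R m) (R' m) (c m)) \<longlonglongrightarrow> A"
      by (rule transfer[OF As(2)]) (use d1 in \<open>simp add: dist_commute\<close>)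
    have "(\<lambda>m. Phi (diagop (R m) (R' m) (c m))) \<longlonglongrightarrow> Phi A"
      by (rule Phi_tendsto_simple[OF bd R(1) R(2) lim A])
    then show "(Phi \<circ> As) \<longlonglongrightarrow> Phi A" unfolding o_def by (rule transfer[OF _ d2])
  qed
qed

text \<open>Multiplication by the coordinate on the functions on the nodes \<open>z\<^sub>0, \<dots>, z\<^sub>n\<^sub>-\<^sub>1\<close>, written in the
  rescaled Newton basis \<open>\<eta>\<^sup>-\<^sup>k (x - z\<^sub>0) \<dots> (x - z\<^sub>k\<^sub>-\<^sub>1)\<close>, is a bidiagonal matrix with eigenvalues \<open>z\<^sub>k\<close> and
  off-diagonal entries \<open>\<eta>\<close>, and multiplication by \<open>f\<close> has a divided difference in its corner.\<close>

lemma newton_basis_operator: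
  fixes e :: "nat \<Rightarrow> 'n::finite" and z :: "nat \<Rightarrow> complex"
  defines "g \<equiv> inv_into {..<CARD('n)} e"
  assumes e: "bij_betw e {..<CARD('n)} UNIV" and z: "inj_on z {..<CARD('n)}" and \<eta>: "\<eta> \<noteq> 0"
  obtains V V' :: "complex ^ 'n ^ 'n" where "inverse_pair V V'"
    "diagop V V' (\<chi> i. z (g i)) = (\<chi> i k. if i = k then z (g k) else if g i = Suc (g k) then \<eta> else 0)"
    "\<And>f. diagop V V' (\<chi> i. f (z (g i))) $ e (CARD('n) - 1) $ e 0
      = divdiff f (z ` {..<CARD('n)}) * \<eta> ^ (CARD('n) - 1)"
proof -
  let ?n = "CARD('n)"
  have g: "g i < ?n" and eg: "e (g i) = i" for i
    using bij_betw_apply[OF bij_betw_inv_into[OF e], of i] bij_betw_inv_into_right[OF e, of i]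
    by (simp_all add: g_def)
  have ge: "g (e k) = k" if "k < ?n" for k
    unfolding g_def using that by (intro bij_betw_inv_into_left[OF e]) simp
  have n0: "0 < ?n" by simp
  have re: "(\<Sum>j\<in>UNIV. F j) = (\<Sum>t<?n. F (e t))" for F :: "'n \<Rightarrow> complex"
    by (rule sum.reindex_bij_betw[OF e, symmetric])
  \<comment> \<open>\<open>N i t\<close> is the value of the \<open>t\<close>-th rescaled Newton
    polynomial at the node \<open>z (g i)\<close>. Thus \<open>U\<close> takes coefficients to
    values at the nodes, and it is triangular by \<open>Nbig\<close> and
    \<open>Ndiag\<close>.\<close>
  define N where "N = (\<lambda>i t. (\<Prod>l<t. z (g i) - z l) / \<eta> ^ t)"
  define U :: "complex ^ 'n ^ 'n" where "U = (\<chi> i k. N i (g k))"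
  have NSuc: "N i (Suc t) * \<eta> = N i t * (z (g i) - z t)" for i t
    using \<eta> by (simp add: N_def field_simps)
  have Nbig: "N i t = 0" if "g i < t" for i t
    unfolding N_def using that by (auto intro!: prod_zero)
  have Ndiag: "N i (g i) \<noteq> 0" for i
  proof -
    have "z (g i) \<noteq> z l" if "l < g i" for l using inj_onD[OF z, of "g i" l] g[of i] that by auto
    then show ?thesis unfolding N_def using \<eta> by auto
  qed
  have Uvec: "(U *v x) $ i = (\<Sum>t<?n. N i t * x $ e t)" for x i
  proof -
    have "(U *v x) $ i = (\<Sum>t<?n. N i (g (e t)) * x $ e t)"
      unfolding matrix_vector_mult_def by (simp add: re U_def)
    also have "\<dots> = (\<Sum>t<?n. N i t * x $ e t)" by (rule sum.cong) (simp_all add: ge)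
    finally show ?thesis .
  qed
  have "x = 0" if x: "U *v x = 0" for x
  proof -
    have "x $ e t = 0" if "t < ?n" for t
      using that
    proof (induction t rule: less_induct)
      case (less t)
      have "N (e t) s * x $ e s = 0" if "s \<in> {..<?n} - {t}" for s
        using that less Nbig[of "e t" s] ge[OF less.prems] by (cases "s < t") auto
      then have "(\<Sum>s\<in>{..<?n} - {t}. N (e t) s * x $ e s) = 0" by (intro sum.neutral ballI)
      then have "(\<Sum>s<?n. N (e t) s * x $ e s) = N (e t) t * x $ e t"
        using less.prems sum.remove[of "{..<?n}" t "\<lambda>s. N (e t) s * x $ e s"] by simp
      then have "N (e t) t * x $ e t = 0" using x Uvec[of x "e t"] by simp
      then show ?case using Ndiag[of "e t"] ge[OF less.prems] by simp
    qed
    then show ?thesis using g eg by (metis vec_eq_iff zero_index)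
  qed
  then obtain U' where U: "inverse_pair U U'" using injective_imp_inverse_pair by blast
  define c where "c = (\<chi> i. z (g i))"
  define Bd :: "complex ^ 'n ^ 'n" where
    "Bd = (\<chi> i k. if i = k then z (g k) else if g i = Suc (g k) then \<eta> else 0)"
  \<comment> \<open>Column by column this is \<open>NSuc\<close>: multiplication by the coordinate
    takes a basis polynomial to its node times itself plus \<eta> times the next one.\<close>
  have "U ** Bd = cdiag c ** U"
  proof -
    have "(U ** Bd) $ i $ k = (cdiag c ** U) $ i $ k" for i k
    proof -
      have "(U ** Bd) $ i $ k = (\<Sum>t<?n. N i (g (e t)) * Bd $ e t $ k)"
        by (simp add: matrix_mult_nth re U_def)
      also have "\<dots> = (\<Sum>t<?n. (if t = g k then N i t * z (g k) else 0) + (if t = Suc (g k) then N i t * \<eta> else 0))"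
      proof (rule sum.cong)
        fix t assume "t \<in> {..<?n}"
        then have gt: "g (e t) = t" by (simp add: ge)
        moreover have "e t = k \<longleftrightarrow> t = g k" using gt eg by metis
        ultimately have Bd: "Bd $ e t $ k = (if t = g k then z (g k) else if t = Suc (g k) then \<eta> else 0)"
          by (simp add: Bd_def)
        show "N i (g (e t)) * Bd $ e t $ k
          = (if t = g k then N i t * z (g k) else 0) + (if t = Suc (g k) then N i t * \<eta> else 0)"
          unfolding gt Bd by auto
      qed simp
      also have "\<dots> = N i (g k) * z (g k) + (if Suc (g k) < ?n then N i (Suc (g k)) * \<eta> else 0)"
        using g[of k] by (simp add: sum.distrib)
      also have "(if Suc (g k) < ?n then N i (Suc (g k)) * \<eta> else 0) = N i (Suc (g k)) * \<eta>"
        using Nbig[of i "Suc (g k)"] g[of i] by auto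
      also have "N i (g k) * z (g k) + N i (Suc (g k)) * \<eta> = z (g i) * N i (g k)"
        unfolding NSuc by (simp add: algebra_simps)
      finally show ?thesis by (simp add: U_def c_def)
    qed
    then show ?thesis unfolding matrix_eq_iff by blast
  qed
  then have "U' ** (U ** Bd) = U' ** (cdiag c ** U)" by simp
  then have 1: "diagop U' U c = Bd" using inverse_pairD(4)[OF U] by (simp add: diagop_def matrix_mul_assoc)
  have 2: "diagop U' U (\<chi> i. f (z (g i))) $ e (?n - 1) $ e 0 = divdiff f (z ` {..<?n}) * \<eta> ^ (?n - 1)" for f
  proof -
    \<comment> \<open>The coefficients of \<open>f\<close> in the rescaled basis. The first basis
      vector is the constant function 1, so multiplication by \<open>f\<close> takes it to
      \<open>y\<close>.\<close>
    define y where "y = (\<chi> k. divdiff f (z ` {..g k}) * \<eta> ^ g k)"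
    have "(U *v y) $ i = f (z (g i))" for i
    proof -
      have "(U *v y) $ i = (\<Sum>t<?n. divdiff f (z ` {..t}) * (\<Prod>l<t. z (g i) - z l))"
        unfolding Uvec by (rule sum.cong) (use \<eta> in \<open>simp_all add: y_def ge N_def\<close>)
      then show ?thesis using newton_interpolation[OF z g, of f i] by simp
    qed
    then have Uy: "U *v y = (\<chi> i. f (z (g i)))" by (simp add: vec_eq_iff)
    have "(U *v ax (e 0)) $ i = 1" for i
    proof -
      have "(U *v ax (e 0)) $ i = U $ i $ e 0"
        by (simp add: matrix_vector_mult_def if_distrib cong: if_cong)
      then show ?thesis using ge[OF n0] by (simp add: U_def N_def)
    qed
    then have "(\<chi> i. f (z (g i))) * (U *v ax (e 0)) = U *v y" unfolding Uy by (simp add: vec_eq_iff)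
    then have "diagop U' U (\<chi> i. f (z (g i))) *v ax (e 0) = U' *v (U *v y)"
      unfolding diagop_def by (simp add: matrix_vector_mul_assoc[symmetric] cdiag_mult_vec)
    then have "diagop U' U (\<chi> i. f (z (g i))) *v ax (e 0) = y" by (simp add: inverse_pairD[OF U])
    moreover have "(A *v ax j) $ i = A $ i $ j" for A :: "complex ^ 'n ^ 'n" and i j
      by (simp add: matrix_vector_mult_def if_distrib cong: if_cong)
    ultimately have "diagop U' U (\<chi> i. f (z (g i))) $ e (?n - 1) $ e 0 = y $ e (?n - 1)" by metis
    moreover have "{..?n - 1} = {..<?n}"
      using lessThan_Suc_atMost[of "?n - 1"] Suc_diff_1[OF n0] by metis
    moreover have "g (e (?n - 1)) = ?n - 1" by (rule ge) (use n0 in linarith)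
    ultimately show ?thesis by (simp add: y_def)
  qed
  have U': "inverse_pair U' U" using U inverse_pair_sym by blast
  show thesis by (rule that[OF U' 1[unfolded c_def Bd_def] 2])
qed

text \<open>Where divided differences are unbounded near \<open>a\<close>, bidiagonal operators with
  such nodes and shrinking off-diagonal entries tend to the scalar \<open>a\<close>, while a corner
  entry of their images under \<open>Phi\<close> stays at least 1 in modulus.\<close>

lemma B_Delta_if_continuous_on_Phi:
  fixes X :: "complex set"
  assumes n: "CARD('n) \<ge> 2"
    and cont: "continuous_on (ss_with_spectrum_in X) (Phi :: complex ^ 'n ^ 'n \<Rightarrow> complex ^ 'n ^ 'n)"
  shows "B_Delta (CARD('n) - 1) X cnj"
proof (rule ccontr)
  let ?n = "CARD('n)"
  assume "\<not> ?thesis"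
  moreover have "Suc (?n - 1) = ?n" using n by simp
  ultimately obtain a where a: "a \<in> X" "\<not> divdiff_bounded_at X cnj ?n a"
    by (auto simp: B_Delta_iff)
  define \<eta> where "\<eta> = (\<lambda>m::nat. inverse (real (Suc m)))"
  have \<eta>: "\<eta> m > 0" for m by (simp add: \<eta>_def)
  \<comment> \<open>The threshold is the reciprocal of \<open>\<eta> m ^ (CARD('n) - 1)\<close>, the
    factor by which rescaling the basis damps the corner entry.\<close>
  have "\<exists>S. S \<subseteq> X \<inter> ball a (\<eta> m) \<and> finite S \<and> card S = ?n \<and> norm (divdiff cnj S) > real (Suc m) ^ (?n - 1)" for m
    using a(2) \<eta>[of m] unfolding divdiff_bounded_at_def by (meson not_le)
  then obtain S where S: "\<And>m. S m \<subseteq> X \<inter> ball a (\<eta> m)" "\<And>m. finite (S m)" "\<And>m. card (S m) = ?n"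
    "\<And>m. norm (divdiff cnj (S m)) > real (Suc m) ^ (?n - 1)" by metis
  have "\<exists>z. bij_betw z {..<?n} (S m)" for m
    using ex_bij_betw_nat_finite[OF S(2)[of m]] by (simp add: S(3) atLeast0LessThan)
  then obtain z where z: "\<And>m. bij_betw (z m) {..<?n} (S m)" by metis
  obtain e where e: "bij_betw e {..<?n} (UNIV :: 'n set)" by (rule enumerate_index)
  define g where "g = inv_into {..<?n} e"
  have g: "g i < ?n" for i using bij_betw_apply[OF bij_betw_inv_into[OF e], of i] by (simp add: g_def)
  define Bd :: "nat \<Rightarrow> complex ^ 'n ^ 'n" where
    "Bd = (\<lambda>m. \<chi> i k. if i = k then z m (g k) else if g i = Suc (g k) then of_real (\<eta> m) else 0)"
  have "\<exists>V V'. inverse_pair V V' \<and> diagop V V' (\<chi> i. z m (g i)) = Bd m \<and>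
      diagop V V' (\<chi> i. cnj (z m (g i))) $ e (?n - 1) $ e 0 = divdiff cnj (S m) * of_real (\<eta> m) ^ (?n - 1)" for m
  proof -
    have inj: "inj_on (z m) {..<?n}" and Sm: "z m ` {..<?n} = S m" using z by (auto simp: bij_betw_def)
    have "complex_of_real (\<eta> m) \<noteq> 0" using \<eta>[of m] by simp
    from newton_basis_operator[OF e inj this, folded g_def]
    obtain V V' :: "complex ^ 'n ^ 'n" where "inverse_pair V V'" "diagop V V' (\<chi> i. z m (g i)) = Bd m"
      "\<And>f. diagop V V' (\<chi> i. f (z m (g i))) $ e (?n - 1) $ e 0
        = divdiff f (z m ` {..<?n}) * of_real (\<eta> m) ^ (?n - 1)" unfolding Bd_def by blast
    then show ?thesis unfolding Sm by blast
  qed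
  then obtain V V' where V: "\<And>m. inverse_pair (V m) (V' m)" "\<And>m. diagop (V m) (V' m) (\<chi> i. z m (g i)) = Bd m"
    and corner: "\<And>m. diagop (V m) (V' m) (\<chi> i. cnj (z m (g i))) $ e (?n - 1) $ e 0
      = divdiff cnj (S m) * of_real (\<eta> m) ^ (?n - 1)" by metis
  have zS: "z m (g i) \<in> X \<inter> ball a (\<eta> m)" for m i
    using S(1)[of m] bij_betw_apply[OF z, of "g i" m] g by auto
  have ss: "Bd m \<in> ss_with_spectrum_in X" for m
    unfolding V(2)[symmetric] by (rule diagop_in_ss[OF V(1)]) (use zS in \<open>auto simp: tuples_def\<close>)
  have I: "inverse_pair (mat 1) (mat 1 :: complex ^ 'n ^ 'n)" by (simp add: inverse_pair_def)
  have mat_a: "mat a = diagop (mat 1) (mat 1 :: complex ^ 'n ^ 'n) (\<chi> i. a)" by (simp add: diagop_const[OF I])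
  have ssa: "(mat a :: complex ^ 'n ^ 'n) \<in> ss_with_spectrum_in X"
    unfolding mat_a by (rule diagop_in_ss[OF I]) (simp add: tuples_def a)
  have \<eta>0: "\<eta> \<longlonglongrightarrow> 0" unfolding \<eta>_def by (rule LIMSEQ_inverse_real_of_nat)
  have "Bd \<longlonglongrightarrow> mat a"
    unfolding Bd_def mat_def
  proof (intro tendsto_vec_lambda)
    fix i k
    have "(\<lambda>m. z m (g k)) \<longlonglongrightarrow> a"
    proof (rule Lim_null_comparison[OF _ \<eta>0, THEN LIM_zero_cancel])
      show "\<forall>\<^sub>F m in sequentially. norm (z m (g k) - a) \<le> \<eta> m"
        using zS by (auto simp: dist_norm norm_minus_commute intro!: always_eventually less_imp_le)
    qed
    moreover have "(\<lambda>m. complex_of_real (\<eta> m)) \<longlonglongrightarrow> 0" using tendsto_of_real[OF \<eta>0] by simp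
    ultimately show "(\<lambda>m. if i = k then z m (g k) else if g i = Suc (g k) then complex_of_real (\<eta> m) else 0)
        \<longlonglongrightarrow> (if i = k then a else 0)"
      by (cases "i = k"; cases "g i = Suc (g k)") simp_all
  qed
  then have "(\<lambda>m. Phi (Bd m)) \<longlonglongrightarrow> Phi (mat a)"
    by (rule continuous_on_tendsto_compose[OF cont _ ssa]) (simp add: ss)
  then have "(\<lambda>m. Phi (Bd m) $ e 0 $ e (?n - 1)) \<longlonglongrightarrow> Phi (mat a) $ e 0 $ e (?n - 1)"
    by (intro tendsto_vec_nth)
  moreover have "Phi (mat a) $ e 0 $ e (?n - 1) = 0"
  proof -
    have "e 0 \<noteq> e (?n - 1)" using inj_onD[OF bij_betw_imp_inj_on[OF e], of 0 "?n - 1"] n by auto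
    moreover have "diagop (mat 1) (mat 1 :: complex ^ 'n ^ 'n) (vmap cnj (\<chi> i. a)) = mat (cnj a)"
      unfolding diagop_const[OF I, of "cnj a", symmetric] by (simp add: vmap_def)
    ultimately show ?thesis
      unfolding mat_a Phi_eq_herm[OF I] by (simp add: herm_nth) (simp add: mat_def)
  qed
  ultimately have "(\<lambda>m. norm (Phi (Bd m) $ e 0 $ e (?n - 1))) \<longlonglongrightarrow> 0"
    using tendsto_norm by fastforce
  moreover have "norm (Phi (Bd m) $ e 0 $ e (?n - 1)) \<ge> 1" for m
  proof -
    have vm: "vmap cnj (\<chi> i. z m (g i)) = (\<chi> i. cnj (z m (g i)))" by (simp add: vmap_def)
    have "norm (Phi (Bd m) $ e 0 $ e (?n - 1)) = norm (divdiff cnj (S m)) * \<eta> m ^ (?n - 1)"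
      unfolding V(2)[symmetric] Phi_eq_herm[OF V(1)] herm_nth vm corner
      using \<eta>[of m] by (simp add: norm_mult norm_power)
    also have "\<dots> \<ge> real (Suc m) ^ (?n - 1) * \<eta> m ^ (?n - 1)"
      using S(4)[of m] \<eta>[of m] by (intro mult_right_mono) auto
    also have "real (Suc m) ^ (?n - 1) * \<eta> m ^ (?n - 1) = 1"
      unfolding \<eta>_def power_mult_distrib[symmetric] by simp
    finally show ?thesis .
  qed
  ultimately show False
    using LIMSEQ_le_const[of "\<lambda>m. norm (Phi (Bd m) $ e 0 $ e (?n - 1))" 0 1] by auto
qed

section \<open>The classification of continuous preservers\<close>

lemma cs_preserver_cases:
  fixes X :: "complex set" and \<phi> :: "complex ^ 'n ^ 'n \<Rightarrow> complex ^ 'n ^ 'n"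
  assumes n: "CARD('n) \<ge> 3"
    and perfect: "perfect_space X"
    and cycle: "\<And>x :: complex ^ 'n. x \<in> config X \<Longrightarrow> has_cycle_of_length (Gamma_at X x) CARD('n)"
    and transitive: "transitive_on_components TYPE('n) X"
    and not_free: "\<not> free_on_components TYPE('n) X"
    and \<phi>: "continuous_on (ss_with_spectrum_in X) \<phi>" "CS_preserver_on (ss_with_spectrum_in X) \<phi>"
  obtains \<alpha> where "conjugation \<alpha> \<or> transpose_conjugation \<alpha>"
    "(\<forall>A \<in> ss_with_spectrum_in X. \<phi> A = \<alpha> A) \<or> (\<forall>A \<in> ss_with_spectrum_in X. \<phi> A = \<alpha> (Phi A))"
proof -
  interpret cs_preserver X \<phi> by unfold_locales (rule \<phi>)+
  \<comment> \<open>An action that is not free has a component to act on, so configurations exist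
    and \<open>X\<close> has two different points.\<close>
  obtain C where "C \<in> components (config X :: (complex ^ 'n) set)"
    using not_free unfolding free_on_components_def by blast
  then obtain x :: "complex ^ 'n" where x: "x \<in> config X" by (auto simp: components_def)
  obtain i j :: 'n where "i \<noteq> j" using third_index[OF n] by metis
  with x have ab: "x $ i \<in> X" "x $ j \<in> X" "x $ i \<noteq> x $ j" by (auto simp: config_def tuples_def)
  have frame: "\<exists>Q Q'. inverse_pair Q Q' \<and> (\<forall>x\<in>tuples X. \<phi> (diagop P P' x) = diagop Q Q' x)"
    if P: "inverse_pair P P'" for P P'
  proof -
    obtain Q Q' where "inverse_pair Q Q'" "\<And>x. x \<in> tuples X \<Longrightarrow> \<phi> (diagop P P' x) = diagop Q Q' x"
      by (rule frame_map[OF n perfect cycle transitive not_free P]) blast+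
    then show ?thesis by blast
  qed
  obtain \<alpha> \<tau> where \<alpha>: "conjugation \<alpha> \<or> transpose_conjugation \<alpha>" and \<tau>: "\<tau> = id \<or> \<tau> = cnj"
    and \<phi>: "\<forall>P P' x. inverse_pair P P' \<longrightarrow> x \<in> tuples X \<longrightarrow>
      \<phi> (diagop P P' x) = \<alpha> (diagop (mmap \<tau> P) (mmap \<tau> P') x)"
    by (rule spectral_structure[OF n ab frame])
  from \<tau> show thesis
  proof
    assume "\<tau> = id"
    moreover have "mmap id P = P" for P :: "complex ^ 'n ^ 'n" by (simp add: mmap_def)
    ultimately have "\<forall>A\<in>ss_with_spectrum_in X. \<phi> A = \<alpha> A"
      using \<phi> by (auto simp: ss_with_spectrum_in_iff)
    with \<alpha> that show thesis by blast
  next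
    assume "\<tau> = cnj"
    \<comment> \<open>The conjugate frame yields the transpose of \<open>Phi\<close>; the
      transposition is absorbed into \<alpha> and merely exchanges the two kinds of
      conjugations.\<close>
    moreover have "diagop (mmap cnj P) (mmap cnj P') x = mtransp (Phi (diagop P P' x))"
      if "inverse_pair P P'" for P P' :: "complex ^ 'n ^ 'n" and x
      unfolding Phi_diagop[OF that] transpose_diagop by simp
    ultimately have "\<forall>A\<in>ss_with_spectrum_in X. \<phi> A = \<alpha> (mtransp (Phi A))"
      using \<phi> by (auto simp: ss_with_spectrum_in_iff)
    moreover have "conjugation (\<lambda>A. \<alpha> (mtransp A)) \<or> transpose_conjugation (\<lambda>A. \<alpha> (mtransp A))"
      using \<alpha> unfolding conjugation_alt transpose_conjugation_alt by force
    ultimately show thesis using that by blast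
  qed
qed

lemma continuous_on_Phi_if_comp:
  fixes \<alpha> :: "complex ^ 'n ^ 'n \<Rightarrow> complex ^ 'n ^ 'n"
  assumes \<alpha>: "conjugation \<alpha> \<or> transpose_conjugation \<alpha>" and cont: "continuous_on S (\<lambda>A. \<alpha> (Phi A))"
  shows "continuous_on S Phi"
proof -
  obtain T T' where T: "inverse_pair T T'" and \<alpha>: "\<alpha> = (\<lambda>A. T ** A ** T') \<or> \<alpha> = (\<lambda>A. T ** mtransp A ** T')"
    using \<alpha> conjugation_alt transpose_conjugation_alt by blast
  have inv: "T' ** (T ** A ** T') ** T = A" for A
    using T by (simp add: matrix_mul_assoc inverse_pairD)
  have c: "continuous_on S (\<lambda>A. T' ** \<alpha> (Phi A) ** T)" by (intro continuous_intros cont)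
  from \<alpha> show ?thesis
  proof
    assume "\<alpha> = (\<lambda>A. T ** A ** T')"
    then show ?thesis using c inv by simp
  next
    assume "\<alpha> = (\<lambda>A. T ** mtransp A ** T')"
    then show ?thesis using continuous_on_transpose[OF c] inv by simp
  qed
qed

lemma preserver_cong:
  assumes "continuous_on S \<psi>" "CS_preserver_on S \<psi>" "\<forall>A\<in>S. \<phi> A = \<psi> A"
  shows "continuous_on S \<phi> \<and> CS_preserver_on S \<phi>"
  using assms by (auto simp: CS_preserver_on_def cong: continuous_on_cong)

theorem theorem1p8:
  fixes X :: "complex set"
  assumes n: "CARD('n::finite) \<ge> 3"
    and perfect: "perfect_space X"
    and cycle: "\<And>x :: complex ^ 'n. x \<in> config X \<Longrightarrow> has_cycle_of_length (Gamma_at X x) CARD('n)"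
    and transitive: "transitive_on_components TYPE('n) X"
    and not_free: "\<not> free_on_components TYPE('n) X"
  shows
    "(\<not> B_Delta (CARD('n) - 1) X cnj \<longrightarrow>
       (\<forall>\<phi> :: complex ^ 'n ^ 'n \<Rightarrow> complex ^ 'n ^ 'n.
          continuous_on (ss_with_spectrum_in X) \<phi> \<and> CS_preserver_on (ss_with_spectrum_in X) \<phi> \<longleftrightarrow>
          (\<exists>\<alpha>. (conjugation \<alpha> \<or> transpose_conjugation \<alpha>) \<and>
               (\<forall>A \<in> ss_with_spectrum_in X. \<phi> A = \<alpha> A)))) \<and>
     (B_Delta (CARD('n) - 1) X cnj \<longrightarrow>
       (\<forall>\<phi> :: complex ^ 'n ^ 'n \<Rightarrow> complex ^ 'n ^ 'n.
          continuous_on (ss_with_spectrum_in X) \<phi> \<and> CS_preserver_on (ss_with_spectrum_in X) \<phi> \<longleftrightarrow>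
          (\<exists>\<alpha>. (conjugation \<alpha> \<or> transpose_conjugation \<alpha>) \<and>
               ((\<forall>A \<in> ss_with_spectrum_in X. \<phi> A = \<alpha> A) \<or>
                (\<forall>A \<in> ss_with_spectrum_in X. \<phi> A = \<alpha> (Phi A))))))"
proof -
  let ?S = "ss_with_spectrum_in X :: (complex ^ 'n ^ 'n) set"
  let ?good = "\<lambda>\<phi> :: complex ^ 'n ^ 'n \<Rightarrow> complex ^ 'n ^ 'n. continuous_on ?S \<phi> \<and> CS_preserver_on ?S \<phi>"
  have conj: "?good \<phi>" if "conjugation \<alpha> \<or> transpose_conjugation \<alpha>" "\<forall>A\<in>?S. \<phi> A = \<alpha> A" for \<alpha> \<phi>
    by (rule preserver_cong[OF conjugation_preserver(2)[OF that(1)] conjugation_preserver(1)[OF that(1)] that(2)])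
  have conjPhi: "?good \<phi>"
    if B: "B_Delta (CARD('n) - 1) X cnj" and \<alpha>: "conjugation \<alpha> \<or> transpose_conjugation \<alpha>"
      and \<phi>: "\<forall>A\<in>?S. \<phi> A = \<alpha> (Phi A)" for \<alpha> \<phi>
  proof (rule preserver_cong[OF _ _ \<phi>])
    show "continuous_on ?S (\<lambda>A. \<alpha> (Phi A))"
      by (rule continuous_on_compose2[OF conjugation_preserver(2)[OF \<alpha>] continuous_on_Phi[OF perfect B] subset_UNIV])
    show "CS_preserver_on ?S (\<lambda>A. \<alpha> (Phi A))"
      by (rule CS_preserver_compose[OF Phi_preserver conjugation_preserver(1)[OF \<alpha>] Phi_in_ss])
  qed
  have classify: "\<exists>\<alpha>. (conjugation \<alpha> \<or> transpose_conjugation \<alpha>) \<and>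
      ((\<forall>A\<in>?S. \<phi> A = \<alpha> A) \<or> (\<forall>A\<in>?S. \<phi> A = \<alpha> (Phi A)))" if \<phi>: "?good \<phi>" for \<phi>
  proof -
    obtain \<alpha> where "conjugation \<alpha> \<or> transpose_conjugation \<alpha>"
      "(\<forall>A\<in>?S. \<phi> A = \<alpha> A) \<or> (\<forall>A\<in>?S. \<phi> A = \<alpha> (Phi A))"
      by (rule cs_preserver_cases[OF n perfect cycle transitive not_free conjunct1[OF \<phi>] conjunct2[OF \<phi>]]) blast+
    then show ?thesis by blast
  qed
  \<comment> \<open>For case (1): \<alpha> has a continuous inverse, so continuity of its
    composition with \<open>Phi\<close> is continuity of \<open>Phi\<close> itself.\<close>
  have no_Phi: "B_Delta (CARD('n) - 1) X cnj"
    if "?good \<phi>" and \<alpha>: "conjugation \<alpha> \<or> transpose_conjugation \<alpha>" and "\<forall>A\<in>?S. \<phi> A = \<alpha> (Phi A)" for \<alpha> \<phi>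
  proof (rule B_Delta_if_continuous_on_Phi)
    have "continuous_on ?S (\<lambda>A. \<alpha> (Phi A))" using that by (simp cong: continuous_on_cong)
    then show "continuous_on ?S Phi" by (rule continuous_on_Phi_if_comp[OF \<alpha>])
  qed (use n in simp)
  show ?thesis
    using conj conjPhi classify no_Phi by blast
qed

end
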